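(* Let $\mathscr{E}$ be a weakly idempotent complete exact category (such that $\mathrm{Ext}^1(C,A)$ is a set for all objects $A,C$), equipped with an exact model structure. Then the homotopy category of this model structure, i.e. the localization of $\mathscr{E}$ at the class of weak equivalences, is triangulated (admits the structure of a triangulated category).
   Context: Exact category means exact category in the sense of Quillen; admissible monomorphisms/epimorphisms are the morphisms occurring in its short exact sequences (conflations). $\mathrm{Ext}^1(C,A)$ is the collection of equivalence classes of short exact sequences $A\to B\to C$. An additive category is weakly idempotent complete if every retraction has a kernel (equivalently every section has a cokernel). A model structure consists of classes of fibrations, cofibrations and weak equivalences satisfying the usual axioms (2-out-of-3, retracts, lifting, factorization), with no completeness or cocompleteness of $\mathscr{E}$ required. An object $X$ is (trivially) cofibrant if $0\to X$ is a (trivial) cofibration, and (trivially) fibrant if $X\to0$ is a (trivial) fibration, where "trivial" means being also a weak equivalence. The model structure is exact if a morphism is a (trivial) cofibration exactly when it is an admissible monomorphism with (trivially) cofibrant cokernel, and a (trivial) fibration exactly when it is an admissible epimorphism with (trivially) fibrant kernel. *)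

theory Defs
  imports "HOL-Algebra.Group"
begin

section \<open>Categories and functors\<close>

text \<open>Composition is written in the usual order: \<open>g \<cdot> f\<close> is first \<open>f\<close>, then \<open>g\<close>. Only its
  values on composable arrows of the category matter.\<close>

record ('o, 'm) cat =
  Obj :: "'o set"
  Arr :: "'m set"
  Dom :: "'m \<Rightarrow> 'o"
  Cod :: "'m \<Rightarrow> 'o"
  Id :: "'o \<Rightarrow> 'm"
  Comp :: "'m \<Rightarrow> 'm \<Rightarrow> 'm"  (infixr "\<cdot>\<index>" 70)

definition Hom :: "('o, 'm) cat \<Rightarrow> 'o \<Rightarrow> 'o \<Rightarrow> 'm set" where
  "Hom C A B = {f \<in> Arr C. Dom C f = A \<and> Cod C f = B}"

locale category =
  fixes C :: "('o, 'm) cat" (structure)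
  assumes Dom_Obj: "f \<in> Arr C \<Longrightarrow> Dom C f \<in> Obj C"
    and Cod_Obj: "f \<in> Arr C \<Longrightarrow> Cod C f \<in> Obj C"
    and Id_Hom: "A \<in> Obj C \<Longrightarrow> Id C A \<in> Hom C A A"
    and Comp_Hom: "\<lbrakk>f \<in> Arr C; g \<in> Arr C; Cod C f = Dom C g\<rbrakk> \<Longrightarrow> g \<cdot> f \<in> Hom C (Dom C f) (Cod C g)"
    and Comp_Id: "f \<in> Arr C \<Longrightarrow> f \<cdot> Id C (Dom C f) = f"
    and Id_Comp: "f \<in> Arr C \<Longrightarrow> Id C (Cod C f) \<cdot> f = f"
    and Comp_assoc: "\<lbrakk>f \<in> Arr C; g \<in> Arr C; h \<in> Arr C; Cod C f = Dom C g; Cod C g = Dom C h\<rbrakk>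
      \<Longrightarrow> (h \<cdot> g) \<cdot> f = h \<cdot> (g \<cdot> f)"

definition iso_arr :: "('o, 'm) cat \<Rightarrow> 'm \<Rightarrow> bool" where
  "iso_arr C f \<longleftrightarrow> f \<in> Arr C \<and>
     (\<exists>g \<in> Hom C (Cod C f) (Dom C f). g \<cdot>\<^bsub>C\<^esub> f = Id C (Dom C f) \<and> f \<cdot>\<^bsub>C\<^esub> g = Id C (Cod C f))"

definition is_functor ::
  "('o, 'm) cat \<Rightarrow> ('p, 'n) cat \<Rightarrow> ('o \<Rightarrow> 'p) \<Rightarrow> ('m \<Rightarrow> 'n) \<Rightarrow> bool" where
  "is_functor C D Fo Fm \<longleftrightarrow>
     (\<forall>A \<in> Obj C. Fo A \<in> Obj D) \<and>
     (\<forall>f \<in> Arr C. Fm f \<in> Hom D (Fo (Dom C f)) (Fo (Cod C f))) \<and>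
     (\<forall>A \<in> Obj C. Fm (Id C A) = Id D (Fo A)) \<and>
     (\<forall>f \<in> Arr C. \<forall>g \<in> Arr C. Cod C f = Dom C g \<longrightarrow> Fm (g \<cdot>\<^bsub>C\<^esub> f) = Fm g \<cdot>\<^bsub>D\<^esub> Fm f)"

definition nat_iso ::
  "('o, 'm) cat \<Rightarrow> ('p, 'n) cat \<Rightarrow> ('o \<Rightarrow> 'p) \<Rightarrow> ('m \<Rightarrow> 'n) \<Rightarrow> ('o \<Rightarrow> 'p) \<Rightarrow> ('m \<Rightarrow> 'n) \<Rightarrow>
    ('o \<Rightarrow> 'n) \<Rightarrow> bool" where
  "nat_iso C D Fo Fm Go Gm \<eta> \<longleftrightarrow>
     (\<forall>A \<in> Obj C. \<eta> A \<in> Hom D (Fo A) (Go A) \<and> iso_arr D (\<eta> A)) \<and>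
     (\<forall>f \<in> Arr C. \<eta> (Cod C f) \<cdot>\<^bsub>D\<^esub> Fm f = Gm f \<cdot>\<^bsub>D\<^esub> \<eta> (Dom C f))"

definition is_equivalence ::
  "('o, 'm) cat \<Rightarrow> ('p, 'n) cat \<Rightarrow> ('o \<Rightarrow> 'p) \<Rightarrow> ('m \<Rightarrow> 'n) \<Rightarrow> bool" where
  "is_equivalence C D Fo Fm \<longleftrightarrow> is_functor C D Fo Fm \<and>
     (\<exists>Go Gm. is_functor D C Go Gm \<and>
        (\<exists>\<eta>. nat_iso C C id id (Go \<circ> Fo) (Gm \<circ> Fm) \<eta>) \<and>
        (\<exists>\<epsilon>. nat_iso D D (Fo \<circ> Go) (Fm \<circ> Gm) id id \<epsilon>))"

definition zero_object :: "('o, 'm) cat \<Rightarrow> 'o \<Rightarrow> bool" where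
  "zero_object C Z \<longleftrightarrow> Z \<in> Obj C \<and>
     (\<forall>A \<in> Obj C. (\<exists>!f. f \<in> Hom C Z A) \<and> (\<exists>!f. f \<in> Hom C A Z))"

text \<open>The square \<open>f' \<cdot> g = g' \<cdot> f\<close>, where \<open>f'\<close> is opposite to \<open>f\<close> and \<open>g'\<close> opposite to \<open>g\<close>:
  in \<open>pushout_square\<close> the arrows \<open>f\<close>, \<open>g\<close> have a common domain, in \<open>pullback_square\<close> the arrows
  \<open>f'\<close>, \<open>g'\<close> have a common codomain and \<open>f\<close>, \<open>g\<close> are the projections.\<close>

definition commutative_square :: "('o, 'm) cat \<Rightarrow> 'm \<Rightarrow> 'm \<Rightarrow> 'm \<Rightarrow> 'm \<Rightarrow> bool" where
  "commutative_square C f g f' g' \<longleftrightarrow> {f, g, f', g'} \<subseteq> Arr C \<and>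
     Dom C f = Dom C g \<and> Cod C f = Dom C g' \<and> Cod C g = Dom C f' \<and> Cod C f' = Cod C g' \<and>
     f' \<cdot>\<^bsub>C\<^esub> g = g' \<cdot>\<^bsub>C\<^esub> f"

definition pushout_square :: "('o, 'm) cat \<Rightarrow> 'm \<Rightarrow> 'm \<Rightarrow> 'm \<Rightarrow> 'm \<Rightarrow> bool" where
  "pushout_square C f g f' g' \<longleftrightarrow> commutative_square C f g f' g' \<and>
     (\<forall>x y. commutative_square C f g x y \<longrightarrow>
        (\<exists>!u. u \<in> Hom C (Cod C f') (Cod C x) \<and> u \<cdot>\<^bsub>C\<^esub> f' = x \<and> u \<cdot>\<^bsub>C\<^esub> g' = y))"

definition pullback_square :: "('o, 'm) cat \<Rightarrow> 'm \<Rightarrow> 'm \<Rightarrow> 'm \<Rightarrow> 'm \<Rightarrow> bool" where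
  "pullback_square C f g f' g' \<longleftrightarrow> commutative_square C f g f' g' \<and>
     (\<forall>x y. commutative_square C x y f' g' \<longrightarrow>
        (\<exists>!u. u \<in> Hom C (Dom C x) (Dom C f) \<and> f \<cdot>\<^bsub>C\<^esub> u = x \<and> g \<cdot>\<^bsub>C\<^esub> u = y))"

definition retract_of :: "('o, 'm) cat \<Rightarrow> 'm \<Rightarrow> 'm \<Rightarrow> bool" where
  "retract_of C f g \<longleftrightarrow> f \<in> Arr C \<and> g \<in> Arr C \<and>
     (\<exists>s \<in> Hom C (Dom C f) (Dom C g). \<exists>r \<in> Hom C (Dom C g) (Dom C f).
      \<exists>t \<in> Hom C (Cod C f) (Cod C g). \<exists>v \<in> Hom C (Cod C g) (Cod C f).
        r \<cdot>\<^bsub>C\<^esub> s = Id C (Dom C f) \<and> v \<cdot>\<^bsub>C\<^esub> t = Id C (Cod C f) \<and>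
        g \<cdot>\<^bsub>C\<^esub> s = t \<cdot>\<^bsub>C\<^esub> f \<and> f \<cdot>\<^bsub>C\<^esub> r = v \<cdot>\<^bsub>C\<^esub> g)"


section \<open>Additive categories\<close>

text \<open>\<open>add\<close> is the addition of parallel arrows and \<open>null A B\<close> the zero arrow from \<open>A\<close> to \<open>B\<close>.\<close>

definition hom_group ::
  "('o, 'm) cat \<Rightarrow> ('m \<Rightarrow> 'm \<Rightarrow> 'm) \<Rightarrow> ('o \<Rightarrow> 'o \<Rightarrow> 'm) \<Rightarrow> 'o \<Rightarrow> 'o \<Rightarrow> 'm monoid" where
  "hom_group C add null A B = \<lparr>carrier = Hom C A B, mult = add, one = null A B\<rparr>"

locale preadditive_category = category C
  for C :: "('o, 'm) cat" (structure) +
  fixes add :: "'m \<Rightarrow> 'm \<Rightarrow> 'm" and null :: "'o \<Rightarrow> 'o \<Rightarrow> 'm"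
  assumes hom_comm_group: "\<lbrakk>A \<in> Obj C; B \<in> Obj C\<rbrakk> \<Longrightarrow> comm_group (hom_group C add null A B)"
    and Comp_add_left: "\<lbrakk>f \<in> Hom C A B; g \<in> Hom C B D; g' \<in> Hom C B D\<rbrakk>
      \<Longrightarrow> add g g' \<cdot> f = add (g \<cdot> f) (g' \<cdot> f)"
    and Comp_add_right: "\<lbrakk>f \<in> Hom C A B; f' \<in> Hom C A B; g \<in> Hom C B D\<rbrakk>
      \<Longrightarrow> g \<cdot> add f f' = add (g \<cdot> f) (g \<cdot> f')"

definition is_biproduct ::
  "('o, 'm) cat \<Rightarrow> ('m \<Rightarrow> 'm \<Rightarrow> 'm) \<Rightarrow> ('o \<Rightarrow> 'o \<Rightarrow> 'm) \<Rightarrow> 'o \<Rightarrow> 'o \<Rightarrow>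
    'o \<Rightarrow> 'm \<Rightarrow> 'm \<Rightarrow> 'm \<Rightarrow> 'm \<Rightarrow> bool" where
  "is_biproduct C add null A B P i j p q \<longleftrightarrow>
     i \<in> Hom C A P \<and> j \<in> Hom C B P \<and> p \<in> Hom C P A \<and> q \<in> Hom C P B \<and>
     p \<cdot>\<^bsub>C\<^esub> i = Id C A \<and> q \<cdot>\<^bsub>C\<^esub> j = Id C B \<and> p \<cdot>\<^bsub>C\<^esub> j = null B A \<and> q \<cdot>\<^bsub>C\<^esub> i = null A B \<and>
     add (i \<cdot>\<^bsub>C\<^esub> p) (j \<cdot>\<^bsub>C\<^esub> q) = Id C P"

locale additive_category = preadditive_category +
  assumes ex_zero_object: "\<exists>Z. zero_object C Z"
    and ex_biproduct: "\<lbrakk>A \<in> Obj C; B \<in> Obj C\<rbrakk>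
      \<Longrightarrow> \<exists>P \<in> Obj C. \<exists>i j p q. is_biproduct C add null A B P i j p q"

definition is_kernel :: "('o, 'm) cat \<Rightarrow> ('o \<Rightarrow> 'o \<Rightarrow> 'm) \<Rightarrow> 'm \<Rightarrow> 'm \<Rightarrow> bool" where
  "is_kernel C null k f \<longleftrightarrow> k \<in> Arr C \<and> f \<in> Arr C \<and> Cod C k = Dom C f \<and>
     f \<cdot>\<^bsub>C\<^esub> k = null (Dom C k) (Cod C f) \<and>
     (\<forall>g \<in> Arr C. Cod C g = Dom C f \<and> f \<cdot>\<^bsub>C\<^esub> g = null (Dom C g) (Cod C f) \<longrightarrow>
        (\<exists>!u. u \<in> Hom C (Dom C g) (Dom C k) \<and> k \<cdot>\<^bsub>C\<^esub> u = g))"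

definition is_cokernel :: "('o, 'm) cat \<Rightarrow> ('o \<Rightarrow> 'o \<Rightarrow> 'm) \<Rightarrow> 'm \<Rightarrow> 'm \<Rightarrow> bool" where
  "is_cokernel C null c f \<longleftrightarrow> c \<in> Arr C \<and> f \<in> Arr C \<and> Cod C f = Dom C c \<and>
     c \<cdot>\<^bsub>C\<^esub> f = null (Dom C f) (Cod C c) \<and>
     (\<forall>g \<in> Arr C. Dom C g = Cod C f \<and> g \<cdot>\<^bsub>C\<^esub> f = null (Dom C f) (Cod C g) \<longrightarrow>
        (\<exists>!u. u \<in> Hom C (Cod C c) (Cod C g) \<and> u \<cdot>\<^bsub>C\<^esub> c = g))"

definition weakly_idempotent_complete :: "('o, 'm) cat \<Rightarrow> ('o \<Rightarrow> 'o \<Rightarrow> 'm) \<Rightarrow> bool" where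
  "weakly_idempotent_complete C null \<longleftrightarrow>
     (\<forall>r \<in> Arr C. (\<exists>s \<in> Hom C (Cod C r) (Dom C r). r \<cdot>\<^bsub>C\<^esub> s = Id C (Cod C r)) \<longrightarrow>
        (\<exists>k. is_kernel C null k r))"


section \<open>Exact categories\<close>

text \<open>Quillen's exact categories, with the axioms in the self-dual form of Keller and Buehler.
  \<open>conf\<close> is the class of conflations \<open>(i, p)\<close>. Hom-collections and the collections
  \<open>Ext\<^sup>1(C, A)\<close> of equivalence classes of conflations are always sets in HOL, so no smallness
  condition appears.\<close>

definition adm_mono :: "('m \<times> 'm) set \<Rightarrow> 'm \<Rightarrow> bool" where
  "adm_mono conf i \<longleftrightarrow> (\<exists>p. (i, p) \<in> conf)"

definition adm_epi :: "('m \<times> 'm) set \<Rightarrow> 'm \<Rightarrow> bool" where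
  "adm_epi conf p \<longleftrightarrow> (\<exists>i. (i, p) \<in> conf)"

locale exact_category = additive_category +
  fixes conf :: "('b \<times> 'b) set"
  assumes conf_kernel_cokernel: "(i, p) \<in> conf \<Longrightarrow> is_kernel C null i p \<and> is_cokernel C null p i"
    and conf_iso: "\<lbrakk>(i, p) \<in> conf; i' \<in> Arr C; p' \<in> Arr C; Cod C i' = Dom C p';
        a \<in> Hom C (Dom C i) (Dom C i'); b \<in> Hom C (Cod C i) (Cod C i');
        c \<in> Hom C (Cod C p) (Cod C p'); iso_arr C a; iso_arr C b; iso_arr C c;
        b \<cdot> i = i' \<cdot> a; c \<cdot> p = p' \<cdot> b\<rbrakk> \<Longrightarrow> (i', p') \<in> conf"
    and Id_adm_mono: "A \<in> Obj C \<Longrightarrow> adm_mono conf (Id C A)"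
    and Id_adm_epi: "A \<in> Obj C \<Longrightarrow> adm_epi conf (Id C A)"
    and Comp_adm_mono: "\<lbrakk>adm_mono conf i; adm_mono conf j; Cod C i = Dom C j\<rbrakk>
      \<Longrightarrow> adm_mono conf (j \<cdot> i)"
    and Comp_adm_epi: "\<lbrakk>adm_epi conf p; adm_epi conf q; Cod C p = Dom C q\<rbrakk>
      \<Longrightarrow> adm_epi conf (q \<cdot> p)"
    and pushout_adm_mono: "\<lbrakk>adm_mono conf i; f \<in> Arr C; Dom C f = Dom C i\<rbrakk>
      \<Longrightarrow> \<exists>i' f'. pushout_square C i f i' f' \<and> adm_mono conf i'"
    and pullback_adm_epi: "\<lbrakk>adm_epi conf p; f \<in> Arr C; Cod C f = Cod C p\<rbrakk>
      \<Longrightarrow> \<exists>p' f'. pullback_square C p' f' p f \<and> adm_epi conf p'"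


section \<open>Exact model structures\<close>

locale model_structure = category C
  for C :: "('o, 'm) cat" (structure) +
  fixes cof fib weq :: "'m set"
  assumes cof_Arr: "cof \<subseteq> Arr C" and fib_Arr: "fib \<subseteq> Arr C" and weq_Arr: "weq \<subseteq> Arr C"
    and weq_Comp: "\<lbrakk>f \<in> weq; g \<in> weq; Cod C f = Dom C g\<rbrakk> \<Longrightarrow> g \<cdot> f \<in> weq"
    and weq_cancel_left: "\<lbrakk>f \<in> Arr C; g \<in> weq; Cod C f = Dom C g; g \<cdot> f \<in> weq\<rbrakk> \<Longrightarrow> f \<in> weq"
    and weq_cancel_right: "\<lbrakk>f \<in> weq; g \<in> Arr C; Cod C f = Dom C g; g \<cdot> f \<in> weq\<rbrakk> \<Longrightarrow> g \<in> weq"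
    and cof_retract: "\<lbrakk>retract_of C f g; g \<in> cof\<rbrakk> \<Longrightarrow> f \<in> cof"
    and fib_retract: "\<lbrakk>retract_of C f g; g \<in> fib\<rbrakk> \<Longrightarrow> f \<in> fib"
    and weq_retract: "\<lbrakk>retract_of C f g; g \<in> weq\<rbrakk> \<Longrightarrow> f \<in> weq"
    and lifting: "\<lbrakk>i \<in> cof; p \<in> fib; i \<in> weq \<or> p \<in> weq; x \<in> Hom C (Dom C i) (Dom C p);
        y \<in> Hom C (Cod C i) (Cod C p); p \<cdot> x = y \<cdot> i\<rbrakk>
      \<Longrightarrow> \<exists>l \<in> Hom C (Cod C i) (Dom C p). l \<cdot> i = x \<and> p \<cdot> l = y"
    and factor_trivial_cof: "f \<in> Arr C
      \<Longrightarrow> \<exists>i \<in> cof \<inter> weq. \<exists>p \<in> fib. Cod C i = Dom C p \<and> f = p \<cdot> i"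
    and factor_trivial_fib: "f \<in> Arr C
      \<Longrightarrow> \<exists>i \<in> cof. \<exists>p \<in> fib \<inter> weq. Cod C i = Dom C p \<and> f = p \<cdot> i"

text \<open>For \<open>S = cof\<close> these are the cofibrant objects, for \<open>S = cof \<inter> weq\<close> the trivially cofibrant
  ones; similarly for \<open>fibrant_obj\<close>.\<close>

definition cofibrant_obj :: "('o, 'm) cat \<Rightarrow> 'm set \<Rightarrow> 'o \<Rightarrow> bool" where
  "cofibrant_obj C S X \<longleftrightarrow> (\<exists>Z f. zero_object C Z \<and> f \<in> Hom C Z X \<and> f \<in> S)"

definition fibrant_obj :: "('o, 'm) cat \<Rightarrow> 'm set \<Rightarrow> 'o \<Rightarrow> bool" where
  "fibrant_obj C S X \<longleftrightarrow> (\<exists>Z f. zero_object C Z \<and> f \<in> Hom C X Z \<and> f \<in> S)"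

locale exact_model_structure =
  exact_category C add null conf + model_structure C cof fib weq
  for C :: "('o, 'm) cat" (structure) and add null conf cof fib weq +
  assumes cof_iff: "f \<in> cof \<longleftrightarrow> (\<exists>p. (f, p) \<in> conf \<and> cofibrant_obj C cof (Cod C p))"
    and trivial_cof_iff: "f \<in> cof \<inter> weq \<longleftrightarrow>
      (\<exists>p. (f, p) \<in> conf \<and> cofibrant_obj C (cof \<inter> weq) (Cod C p))"
    and fib_iff: "f \<in> fib \<longleftrightarrow> (\<exists>i. (i, f) \<in> conf \<and> fibrant_obj C fib (Dom C i))"
    and trivial_fib_iff: "f \<in> fib \<inter> weq \<longleftrightarrow>
      (\<exists>i. (i, f) \<in> conf \<and> fibrant_obj C (fib \<inter> weq) (Dom C i))"


section \<open>Localization at a class of arrows\<close>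

text \<open>The Gabriel--Zisman construction: an arrow \<open>X \<rightarrow> Y\<close> of the localization is an equivalence
  class of finite zigzags from \<open>X\<close> to \<open>Y\<close>, whose backward steps are taken in \<open>W\<close>; it is encoded
  as \<open>(X, c, Y)\<close>. Zigzags are lists with the step leaving \<open>X\<close> first.\<close>

datatype 'm step = Fwd 'm | Bwd 'm

fun zigzag :: "('o, 'm) cat \<Rightarrow> 'm set \<Rightarrow> 'o \<Rightarrow> 'm step list \<Rightarrow> 'o \<Rightarrow> bool" where
  "zigzag C W X [] Y \<longleftrightarrow> X \<in> Obj C \<and> X = Y"
| "zigzag C W X (Fwd f # s) Y \<longleftrightarrow> f \<in> Arr C \<and> Dom C f = X \<and> zigzag C W (Cod C f) s Y"
| "zigzag C W X (Bwd w # s) Y \<longleftrightarrow> w \<in> Arr C \<inter> W \<and> Cod C w = X \<and> zigzag C W (Dom C w) s Y"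

inductive zigzag_red :: "('o, 'm) cat \<Rightarrow> 'm set \<Rightarrow> 'm step list \<Rightarrow> 'm step list \<Rightarrow> bool"
  for C W where
  "\<lbrakk>f \<in> Arr C; g \<in> Arr C; Cod C f = Dom C g\<rbrakk> \<Longrightarrow> zigzag_red C W [Fwd f, Fwd g] [Fwd (g \<cdot>\<^bsub>C\<^esub> f)]"
| "A \<in> Obj C \<Longrightarrow> zigzag_red C W [Fwd (Id C A)] []"
| "w \<in> Arr C \<inter> W \<Longrightarrow> zigzag_red C W [Fwd w, Bwd w] []"
| "w \<in> Arr C \<inter> W \<Longrightarrow> zigzag_red C W [Bwd w, Fwd w] []"

inductive zigzag_eq ::
  "('o, 'm) cat \<Rightarrow> 'm set \<Rightarrow> 'o \<Rightarrow> 'o \<Rightarrow> 'm step list \<Rightarrow> 'm step list \<Rightarrow> bool"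
  for C W X Y where
  red: "\<lbrakk>zigzag_red C W u v; zigzag C W X (a @ u @ b) Y; zigzag C W X (a @ v @ b) Y\<rbrakk>
    \<Longrightarrow> zigzag_eq C W X Y (a @ u @ b) (a @ v @ b)"
| refl: "zigzag C W X s Y \<Longrightarrow> zigzag_eq C W X Y s s"
| sym: "zigzag_eq C W X Y s t \<Longrightarrow> zigzag_eq C W X Y t s"
| trans: "\<lbrakk>zigzag_eq C W X Y s t; zigzag_eq C W X Y t r\<rbrakk> \<Longrightarrow> zigzag_eq C W X Y s r"

definition zigzag_class ::
  "('o, 'm) cat \<Rightarrow> 'm set \<Rightarrow> 'o \<Rightarrow> 'm step list \<Rightarrow> 'o \<Rightarrow> 'o \<times> 'm step list set \<times> 'o" where
  "zigzag_class C W X s Y = (X, {t. zigzag_eq C W X Y s t}, Y)"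

definition localization ::
  "('o, 'm) cat \<Rightarrow> 'm set \<Rightarrow> ('o, 'o \<times> 'm step list set \<times> 'o) cat" where
  "localization C W = \<lparr>
     Obj = Obj C,
     Arr = {zigzag_class C W X s Y | X s Y. zigzag C W X s Y},
     Dom = fst,
     Cod = snd \<circ> snd,
     Id = (\<lambda>X. zigzag_class C W X [] X),
     Comp = (\<lambda>(_, d, Z) (X, c, _). (X, {r. \<exists>s \<in> c. \<exists>t \<in> d. zigzag_eq C W X Z (s @ t) r}, Z))\<rparr>"

definition loc_arr ::
  "('o, 'm) cat \<Rightarrow> 'm set \<Rightarrow> 'm \<Rightarrow> 'o \<times> 'm step list set \<times> 'o" where
  "loc_arr C W f = zigzag_class C W (Dom C f) [Fwd f] (Cod C f)"

text \<open>The construction has the universal property of the localization: see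
  \<open>localization_functor\<close>, \<open>localization_inverts\<close> and \<open>localization_universal\<close>.\<close>

lemma zigzag_ends: "category C \<Longrightarrow> zigzag C W X s Y \<Longrightarrow> X \<in> Obj C \<and> Y \<in> Obj C"
  by (induction C W X s Y rule: zigzag.induct) (auto simp: category_def)

lemma zigzag_append:
  "category C \<Longrightarrow> zigzag C W X (s @ t) Z \<longleftrightarrow> (\<exists>Y. zigzag C W X s Y \<and> zigzag C W Y t Z)"
proof (induction s arbitrary: X)
  case Nil
  then show ?case by (auto dest: zigzag_ends)
next
  case (Cons x s)
  then show ?case by (cases x) auto
qed

lemma zigzag_eq_zigzag:
  "zigzag_eq C W X Y s t \<Longrightarrow> zigzag C W X s Y \<and> zigzag C W X t Y"
  by (induction rule: zigzag_eq.induct) auto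

lemma zigzag_eq_append_left:
  assumes "category C" and "zigzag_eq C W Y Z s t" and "zigzag C W X r Y"
  shows "zigzag_eq C W X Z (r @ s) (r @ t)"
  using assms(2)
proof induction
  case (red u v a b)
  have "zigzag C W X (r @ a @ u @ b) Z" "zigzag C W X (r @ a @ v @ b) Z"
    using red zigzag_append[OF assms(1)] assms(3) by blast+
  then show ?case
    using zigzag_eq.red[of C W u v X "r @ a" b Z] red(1) by auto
next
  case (refl s)
  then have "zigzag C W X (r @ s) Z" using zigzag_append[OF assms(1)] assms(3) by blast
  then show ?case by (rule zigzag_eq.refl)
qed (blast intro: zigzag_eq.sym zigzag_eq.trans)+

lemma zigzag_eq_append_right:
  assumes "category C" and "zigzag_eq C W X Y s t" and "zigzag C W Y r Z"
  shows "zigzag_eq C W X Z (s @ r) (t @ r)"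
  using assms(2)
proof induction
  case (red u v a b)
  have "zigzag C W X ((a @ u @ b) @ r) Z" "zigzag C W X ((a @ v @ b) @ r) Z"
    using red zigzag_append[OF assms(1)] assms(3) by blast+
  then show ?case
    using zigzag_eq.red[of C W u v X a "b @ r" Z] red(1) by auto
next
  case (refl s)
  then have "zigzag C W X (s @ r) Z" using zigzag_append[OF assms(1)] assms(3) by blast
  then show ?case by (rule zigzag_eq.refl)
qed (blast intro: zigzag_eq.sym zigzag_eq.trans)+

lemma zigzag_class_eq_iff:
  assumes "zigzag C W X s Y"
  shows "zigzag_class C W X s Y = zigzag_class C W X' t Y' \<longleftrightarrow>
    X = X' \<and> Y = Y' \<and> zigzag_eq C W X Y s t"
proof -
  have "{r. zigzag_eq C W X Y s r} = {r. zigzag_eq C W X Y t r} \<longleftrightarrow> zigzag_eq C W X Y s t"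
    using zigzag_eq.refl[OF assms] by (blast intro: zigzag_eq.sym zigzag_eq.trans)
  then show ?thesis by (auto simp: zigzag_class_def)
qed

lemma localization_Comp:
  assumes C: "category C" and s: "zigzag C W X s Y" and t: "zigzag C W Y t Z"
  shows "Comp (localization C W) (zigzag_class C W Y t Z) (zigzag_class C W X s Y) =
    zigzag_class C W X (s @ t) Z"
proof -
  have "zigzag_eq C W X Z (s @ t) r" if "zigzag_eq C W X Y s s'" "zigzag_eq C W Y Z t t'"
    "zigzag_eq C W X Z (s' @ t') r" for s' t' r
  proof -
    have "zigzag_eq C W X Z (s @ t) (s' @ t)" by (rule zigzag_eq_append_right[OF C that(1) t])
    moreover have "zigzag_eq C W X Z (s' @ t) (s' @ t')"
      using zigzag_eq_append_left[OF C that(2)] zigzag_eq_zigzag[OF that(1)] by blast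
    ultimately show ?thesis using that(3) by (blast intro: zigzag_eq.trans)
  qed
  then show ?thesis
    unfolding localization_def zigzag_class_def
    using zigzag_eq.refl[OF s] zigzag_eq.refl[OF t] by auto
qed

lemma localization_simps [simp]:
  "Obj (localization C W) = Obj C"
  "Dom (localization C W) (zigzag_class C W X s Y) = X"
  "Cod (localization C W) (zigzag_class C W X s Y) = Y"
  "Id (localization C W) X = zigzag_class C W X [] X"
  by (simp_all add: localization_def zigzag_class_def)

lemma zigzag_class_Arr: "zigzag C W X s Y \<Longrightarrow> zigzag_class C W X s Y \<in> Arr (localization C W)"
  by (auto simp: localization_def)

lemma localization_ArrE:
  assumes "f \<in> Arr (localization C W)"
  obtains X s Y where "f = zigzag_class C W X s Y" "zigzag C W X s Y"
  using assms by (auto simp: localization_def)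

lemma category_localization:
  assumes C: "category C"
  shows "category (localization C W)"
proof
  note E = zigzag_ends[OF C] and L = localization_Comp[OF C]
  have app: "zigzag C W X (s @ t) Z" if "zigzag C W X s Y" "zigzag C W Y t Z" for X s Y t Z
    using that zigzag_append[OF C] by blast
  have nil: "zigzag C W X [] X" if "X \<in> Obj C" for X using that by simp
  let ?L = "localization C W"
  have idr: "Comp ?L (zigzag_class C W X s Y) (zigzag_class C W X [] X) = zigzag_class C W X s Y"
    and idl: "Comp ?L (zigzag_class C W Y [] Y) (zigzag_class C W X s Y) = zigzag_class C W X s Y"
    if "zigzag C W X s Y" for X s Y
    using E[OF that] L[OF nil that] L[OF that nil] by auto
  show "Dom ?L f \<in> Obj ?L" "Cod ?L f \<in> Obj ?L" if "f \<in> Arr ?L" for f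
    using that by (auto elim!: localization_ArrE dest: E)
  show "Id ?L A \<in> Hom ?L A A" if "A \<in> Obj ?L" for A
    using that by (simp add: Hom_def zigzag_class_Arr)
  show "Comp ?L g f \<in> Hom ?L (Dom ?L f) (Cod ?L g)"
    if "f \<in> Arr ?L" "g \<in> Arr ?L" "Cod ?L f = Dom ?L g" for f g
    using that by (auto elim!: localization_ArrE simp: L Hom_def intro!: zigzag_class_Arr intro: app)
  show "Comp ?L f (Id ?L (Dom ?L f)) = f" "Comp ?L (Id ?L (Cod ?L f)) f = f" if "f \<in> Arr ?L" for f
    using that by (auto elim!: localization_ArrE simp: idr idl)
  show "Comp ?L (Comp ?L h g) f = Comp ?L h (Comp ?L g f)"
    if "f \<in> Arr ?L" "g \<in> Arr ?L" "h \<in> Arr ?L" "Cod ?L f = Dom ?L g" "Cod ?L g = Dom ?L h" for f g h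
    using that by (auto elim!: localization_ArrE)
      (metis L app append_assoc)
qed

lemma localization_functor:
  assumes C: "category C"
  shows "is_functor C (localization C W) id (loc_arr C W)"
proof -
  interpret category C by fact
  have z: "zigzag C W (Dom C f) [Fwd f] (Cod C f)" if "f \<in> Arr C" for f
    using that by (simp add: Cod_Obj)
  have i: "loc_arr C W (Id C A) = zigzag_class C W A [] A" if A: "A \<in> Obj C" for A
  proof -
    have "zigzag C W A [Fwd (Id C A)] A" using z[of "Id C A"] Id_Hom[OF A] by (auto simp: Hom_def)
    then have "zigzag_eq C W A A [Fwd (Id C A)] []"
      using zigzag_eq.red[of C W "[Fwd (Id C A)]" "[]" A "[]" "[]" A] zigzag_red.intros(2)[OF A] A by simp
    then show ?thesis
      using Id_Hom[OF A] by (simp add: loc_arr_def Hom_def zigzag_class_eq_iff[OF \<open>zigzag C W A _ A\<close>])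
  qed
  have c: "loc_arr C W (Comp C g f) = Comp (localization C W) (loc_arr C W g) (loc_arr C W f)"
    if f: "f \<in> Arr C" and g: "g \<in> Arr C" and fg: "Cod C f = Dom C g" for f g
  proof -
    have h: "Comp C g f \<in> Arr C" "Dom C (Comp C g f) = Dom C f" "Cod C (Comp C g f) = Cod C g"
      using Comp_Hom[OF f g fg] by (auto simp: Hom_def)
    have 1: "zigzag C W (Dom C f) [Fwd f, Fwd g] (Cod C g)" using f g fg by (simp add: Cod_Obj)
    then have "zigzag_eq C W (Dom C f) (Cod C g) [Fwd f, Fwd g] [Fwd (Comp C g f)]"
      using zigzag_eq.red[of C W "[Fwd f, Fwd g]" "[Fwd (Comp C g f)]" "Dom C f" "[]" "[]" "Cod C g"]
        zigzag_red.intros(1)[OF f g fg] z[OF h(1)] h by simp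
    with 1 have "zigzag_class C W (Dom C f) [Fwd f, Fwd g] (Cod C g) = loc_arr C W (Comp C g f)"
      by (simp add: zigzag_class_eq_iff loc_arr_def h)
    moreover have "Comp (localization C W) (loc_arr C W g) (loc_arr C W f) =
        zigzag_class C W (Dom C f) ([Fwd f] @ [Fwd g]) (Cod C g)"
      unfolding loc_arr_def using localization_Comp[OF C z[OF f], of "[Fwd g]" "Cod C g"] z[OF g] fg
      by simp
    ultimately show ?thesis by simp
  qed
  show ?thesis
    unfolding is_functor_def
    using i c z by (auto simp: Hom_def loc_arr_def intro!: zigzag_class_Arr)
qed

lemma localization_inverse:
  assumes C: "category C" and w: "w \<in> Arr C \<inter> W"
  defines "v \<equiv> zigzag_class C W (Cod C w) [Bwd w] (Dom C w)"
  shows "v \<in> Hom (localization C W) (Cod C w) (Dom C w)"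
    and "Comp (localization C W) v (loc_arr C W w) = Id (localization C W) (Dom C w)"
    and "Comp (localization C W) (loc_arr C W w) v = Id (localization C W) (Cod C w)"
proof -
  interpret category C by fact
  have O: "Dom C w \<in> Obj C" "Cod C w \<in> Obj C" using w Dom_Obj Cod_Obj by auto
  have z: "zigzag C W (Dom C w) [Fwd w] (Cod C w)" "zigzag C W (Cod C w) [Bwd w] (Dom C w)"
    "zigzag C W (Dom C w) [Fwd w, Bwd w] (Dom C w)" "zigzag C W (Cod C w) [Bwd w, Fwd w] (Cod C w)"
    using w O by auto
  show "v \<in> Hom (localization C W) (Cod C w) (Dom C w)"
    unfolding v_def Hom_def using z zigzag_class_Arr by fastforce
  have "zigzag_eq C W (Dom C w) (Dom C w) [Fwd w, Bwd w] []"
    using zigzag_eq.red[of C W "[Fwd w, Bwd w]" "[]" "Dom C w" "[]" "[]" "Dom C w"]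
      zigzag_red.intros(3)[OF w] z O by simp
  then show "Comp (localization C W) v (loc_arr C W w) = Id (localization C W) (Dom C w)"
    unfolding v_def loc_arr_def by (simp add: localization_Comp[OF C z(1,2)] zigzag_class_eq_iff[OF z(3)])
  have "zigzag_eq C W (Cod C w) (Cod C w) [Bwd w, Fwd w] []"
    using zigzag_eq.red[of C W "[Bwd w, Fwd w]" "[]" "Cod C w" "[]" "[]" "Cod C w"]
      zigzag_red.intros(4)[OF w] z O by simp
  then show "Comp (localization C W) (loc_arr C W w) v = Id (localization C W) (Cod C w)"
    unfolding v_def loc_arr_def by (simp add: localization_Comp[OF C z(2,1)] zigzag_class_eq_iff[OF z(4)])
qed

lemma localization_inverts:
  assumes C: "category C" and w: "w \<in> Arr C \<inter> W"
  shows "iso_arr (localization C W) (loc_arr C W w)"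
proof -
  have "zigzag C W (Dom C w) [Fwd w] (Cod C w)" using w category.Cod_Obj[OF C] by simp
  from zigzag_class_Arr[OF this] show ?thesis
    unfolding iso_arr_def using localization_inverse[OF C w] by (auto simp: loc_arr_def)
qed

definition inv_arr :: "('o, 'm) cat \<Rightarrow> 'm \<Rightarrow> 'm" where
  "inv_arr C f = (SOME g. g \<in> Hom C (Cod C f) (Dom C f) \<and> g \<cdot>\<^bsub>C\<^esub> f = Id C (Dom C f) \<and> f \<cdot>\<^bsub>C\<^esub> g = Id C (Cod C f))"

lemma inv_arr:
  assumes "iso_arr C f"
  shows "inv_arr C f \<in> Hom C (Cod C f) (Dom C f)"
    "inv_arr C f \<cdot>\<^bsub>C\<^esub> f = Id C (Dom C f)" "f \<cdot>\<^bsub>C\<^esub> inv_arr C f = Id C (Cod C f)"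
proof -
  from assms have "\<exists>g. g \<in> Hom C (Cod C f) (Dom C f) \<and> g \<cdot>\<^bsub>C\<^esub> f = Id C (Dom C f) \<and> f \<cdot>\<^bsub>C\<^esub> g = Id C (Cod C f)"
    unfolding iso_arr_def by blast
  from someI_ex[OF this] show "inv_arr C f \<in> Hom C (Cod C f) (Dom C f)"
    "inv_arr C f \<cdot>\<^bsub>C\<^esub> f = Id C (Dom C f)" "f \<cdot>\<^bsub>C\<^esub> inv_arr C f = Id C (Cod C f)"
    unfolding inv_arr_def by blast+
qed

lemma inv_arr_unique:
  assumes "category C" "f \<in> Arr C" "g \<in> Hom C (Cod C f) (Dom C f)" "h \<in> Hom C (Cod C f) (Dom C f)"
    "g \<cdot>\<^bsub>C\<^esub> f = Id C (Dom C f)" "f \<cdot>\<^bsub>C\<^esub> h = Id C (Cod C f)"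
  shows "g = h"
proof -
  interpret category C by fact
  have "g \<cdot>\<^bsub>C\<^esub> (f \<cdot>\<^bsub>C\<^esub> h) = (g \<cdot>\<^bsub>C\<^esub> f) \<cdot>\<^bsub>C\<^esub> h"
    using assms Comp_assoc[of h f g] by (auto simp: Hom_def)
  then show ?thesis using assms Comp_Id[of g] Id_Comp[of h] by (auto simp: Hom_def)
qed

fun zigzag_eval where
  "zigzag_eval C D Fo Fm X [] = Id D (Fo X)"
| "zigzag_eval C D Fo Fm X (Fwd f # s) = Comp D (zigzag_eval C D Fo Fm (Cod C f) s) (Fm f)"
| "zigzag_eval C D Fo Fm X (Bwd w # s) = Comp D (zigzag_eval C D Fo Fm (Dom C w) s) (inv_arr D (Fm w))"

context
  fixes C :: "('o, 'm) cat" and D :: "('p, 'n) cat" and W Fo Fm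
  assumes C: "category C" and D: "category D" and F: "is_functor C D Fo Fm"
    and inv: "\<And>w. w \<in> Arr C \<inter> W \<Longrightarrow> iso_arr D (Fm w)"
begin

interpretation C: category C by (fact C)
interpretation D: category D by (fact D)

lemma loc_Fm_arr: "f \<in> Arr C \<Longrightarrow> Fm f \<in> Arr D \<and> Dom D (Fm f) = Fo (Dom C f) \<and> Cod D (Fm f) = Fo (Cod C f)"
  using F by (auto simp: is_functor_def Hom_def)

lemma loc_Fm_inv: "w \<in> Arr C \<inter> W \<Longrightarrow> inv_arr D (Fm w) \<in> Arr D \<and>
    Dom D (inv_arr D (Fm w)) = Fo (Cod C w) \<and> Cod D (inv_arr D (Fm w)) = Fo (Dom C w) \<and>
    Comp D (inv_arr D (Fm w)) (Fm w) = Id D (Fo (Dom C w)) \<and>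
    Comp D (Fm w) (inv_arr D (Fm w)) = Id D (Fo (Cod C w))"
  using inv_arr[OF inv, of w] loc_Fm_arr[of w] by (auto simp: Hom_def)

lemma loc_D_comp: "f \<in> Arr D \<Longrightarrow> g \<in> Arr D \<Longrightarrow> Cod D f = Dom D g \<Longrightarrow>
  Comp D g f \<in> Arr D \<and> Dom D (Comp D g f) = Dom D f \<and> Cod D (Comp D g f) = Cod D g"
  using D.Comp_Hom[of f g] by (auto simp: Hom_def)

lemma loc_eval_Hom: "zigzag C W X s Y \<Longrightarrow> zigzag_eval C D Fo Fm X s \<in> Arr D \<and>
    Dom D (zigzag_eval C D Fo Fm X s) = Fo X \<and> Cod D (zigzag_eval C D Fo Fm X s) = Fo Y"
proof (induction s arbitrary: X)
  case Nil
  then show ?case using D.Id_Hom F by (auto simp: Hom_def is_functor_def)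
next
  case (Cons x s)
  then show ?case by (cases x) (auto simp: loc_D_comp loc_Fm_inv loc_Fm_arr)
qed

lemma loc_eval_append:
  "zigzag C W X s Y \<Longrightarrow> zigzag C W Y t Z \<Longrightarrow> zigzag_eval C D Fo Fm X (s @ t) =
    Comp D (zigzag_eval C D Fo Fm Y t) (zigzag_eval C D Fo Fm X s)"
proof (induction s arbitrary: X)
  case Nil
  then have [simp]: "X = Y" by simp
  then show ?case using loc_eval_Hom[OF Nil(2)] D.Comp_Id by force
next
  case (Cons x s)
  show ?case
  proof (cases x)
    case (Fwd f)
    have z: "zigzag C W (Cod C f) s Y" "f \<in> Arr C" using Cons Fwd by auto
    show ?thesis
      using Cons.IH[OF z(1) Cons.prems(2)] Fwd loc_eval_Hom[OF z(1)] loc_eval_Hom[OF Cons.prems(2)] loc_Fm_arr[OF z(2)]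
      by (simp add: D.Comp_assoc)
  next
    case (Bwd f)
    have z: "zigzag C W (Dom C f) s Y" "f \<in> Arr C \<inter> W" using Cons Bwd by auto
    show ?thesis
      using Cons.IH[OF z(1) Cons.prems(2)] Bwd loc_eval_Hom[OF z(1)] loc_eval_Hom[OF Cons.prems(2)] loc_Fm_inv[OF z(2)]
      by (simp add: D.Comp_assoc)
  qed
qed

lemma loc_Fm_Id: "A \<in> Obj C \<Longrightarrow> Fm (Id C A) = Id D (Fo A)" using F by (auto simp: is_functor_def)
lemma loc_Fm_Comp: "f \<in> Arr C \<Longrightarrow> g \<in> Arr C \<Longrightarrow> Cod C f = Dom C g \<Longrightarrow> Fm (Comp C g f) = Comp D (Fm g) (Fm f)"
  using F by (auto simp: is_functor_def)
lemma loc_IdD: "A \<in> Obj C \<Longrightarrow> Id D (Fo A) \<in> Arr D \<and> Dom D (Id D (Fo A)) = Fo A \<and> Cod D (Id D (Fo A)) = Fo A"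
  using D.Id_Hom[of "Fo A"] F by (auto simp: Hom_def is_functor_def)

lemma loc_Id_Comp': "f \<in> Arr D \<Longrightarrow> Cod D f = Y \<Longrightarrow> Comp D (Id D Y) f = f"
  using D.Id_Comp by blast

lemma loc_eval_red:
  "zigzag_red C W u v \<Longrightarrow> zigzag C W X u Y \<Longrightarrow> zigzag C W X v Y \<Longrightarrow>
    zigzag_eval C D Fo Fm X u = zigzag_eval C D Fo Fm X v"
proof (induction rule: zigzag_red.induct)
  case (1 f g)
  then have "Comp C g f \<in> Arr C \<and> Cod C (Comp C g f) = Cod C g" using C.Comp_Hom by (auto simp: Hom_def)
  with 1 show ?case by (simp add: loc_Id_Comp' loc_Fm_arr loc_D_comp loc_Fm_Comp)
next
  case (2 A)
  then have "Id C A \<in> Arr C" "Cod C (Id C A) = A" "Dom C (Id C A) = A" using C.Id_Hom by (auto simp: Hom_def)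
  with 2 show ?case by (auto simp: loc_Fm_Id loc_Id_Comp' loc_IdD)
next
  case (3 w)
  then show ?case using loc_Fm_inv[of w] by (auto simp: loc_Id_Comp')
next
  case (4 w)
  then show ?case using loc_Fm_arr[of w] loc_Fm_inv[of w] by (auto simp: loc_Id_Comp')
qed

lemma zigzag_target: "zigzag C W X s Y \<Longrightarrow> zigzag C W X s Y' \<Longrightarrow> Y = Y'"
proof (induction s arbitrary: X)
  case (Cons x s) then show ?case by (cases x) auto
qed simp

lemma zigzag_red_ends: "zigzag_red C W u v \<Longrightarrow> zigzag C W X u Y \<Longrightarrow> zigzag C W X v Y' \<Longrightarrow> Y = Y'"
  by (induction rule: zigzag_red.induct)
    (use C.Comp_Hom C.Id_Hom in \<open>auto simp: Hom_def\<close>)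

lemma loc_eval_eq:
  "zigzag_eq C W X Y s t \<Longrightarrow> zigzag_eval C D Fo Fm X s = zigzag_eval C D Fo Fm X t"
proof (induction rule: zigzag_eq.induct)
  case (red u v a b)
  obtain A B where 1: "zigzag C W X a A" "zigzag C W A u B" "zigzag C W B b Y"
    using red(2) zigzag_append[OF C] by metis
  obtain A' B' where 2: "zigzag C W X a A'" "zigzag C W A' v B'" "zigzag C W B' b Y"
    using red(3) zigzag_append[OF C] by metis
  have "A' = A" using 1 2 zigzag_target by blast
  have "B' = B" using 1 2 \<open>A' = A\<close> zigzag_red_ends[OF red(1)] by blast
  have 3: "zigzag C W A (u @ b) Y" "zigzag C W A (v @ b) Y"
    using 1 2 \<open>A' = A\<close> zigzag_append[OF C] by blast+
  show ?case
    using 1 2 3 loc_eval_red[OF red(1)] \<open>A' = A\<close> \<open>B' = B\<close> by (simp add: loc_eval_append[of _ _ A _ Y] loc_eval_append[of _ _ B _ Y])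
qed auto

lemma localization_universal_aux:
  "\<exists>Go Gm. is_functor (localization C W) D Go Gm \<and>
     (\<forall>A \<in> Obj C. Go A = Fo A) \<and> (\<forall>f \<in> Arr C. Gm (loc_arr C W f) = Fm f)"
proof -
  define Gm where "Gm x = zigzag_eval C D Fo Fm (fst x) (SOME s. s \<in> fst (snd x))"
    for x :: "'o \<times> 'm step list set \<times> 'o"
  have Gm: "Gm (zigzag_class C W X s Y) = zigzag_eval C D Fo Fm X s" if "zigzag C W X s Y" for X s Y
  proof -
    have "zigzag_eq C W X Y s (SOME t. zigzag_eq C W X Y s t)"
      using someI[of "zigzag_eq C W X Y s", OF zigzag_eq.refl[OF that]] .
    from loc_eval_eq[OF this] show ?thesis by (simp add: Gm_def zigzag_class_def)
  qed
  have "is_functor (localization C W) D Fo Gm"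
    unfolding is_functor_def
  proof (intro conjI ballI impI)
    fix A assume A: "A \<in> Obj (localization C W)"
    then show "Fo A \<in> Obj D" using F by (auto simp: is_functor_def)
    show "Gm (Id (localization C W) A) = Id D (Fo A)" using A by (simp add: Gm)
  next
    fix f assume "f \<in> Arr (localization C W)"
    then show "Gm f \<in> Hom D (Fo (Dom (localization C W) f)) (Fo (Cod (localization C W) f))"
      by (auto elim!: localization_ArrE simp: Gm Hom_def loc_eval_Hom)
  next
    fix f g assume "f \<in> Arr (localization C W)" "g \<in> Arr (localization C W)"
      "Cod (localization C W) f = Dom (localization C W) g"
    then obtain X s Y t Z where *: "f = zigzag_class C W X s Y" "zigzag C W X s Y"
      "g = zigzag_class C W Y t Z" "zigzag C W Y t Z"
      by (auto elim!: localization_ArrE)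
    then have "zigzag C W X (s @ t) Z" using zigzag_append[OF C] by blast
    with * show "Gm (Comp (localization C W) g f) = Comp D (Gm g) (Gm f)"
      by (simp add: Gm localization_Comp[OF C] loc_eval_append)
  qed
  moreover have "Gm (loc_arr C W f) = Fm f" if "f \<in> Arr C" for f
    using that Gm[of "Dom C f" "[Fwd f]" "Cod C f"] loc_Fm_arr[OF that]
    by (simp add: loc_arr_def C.Cod_Obj loc_Id_Comp')
  ultimately show ?thesis by blast
qed

end

lemma localization_unique:
  assumes C: "category C" and D: "category D"
    and G: "is_functor (localization C W) D Go Gm" and H: "is_functor (localization C W) D Ho Hm"
    and o: "\<forall>A \<in> Obj C. Go A = Ho A" and m: "\<forall>f \<in> Arr C. Gm (loc_arr C W f) = Hm (loc_arr C W f)"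
    and s: "zigzag C W X s Y"
  shows "Gm (zigzag_class C W X s Y) = Hm (zigzag_class C W X s Y)"
  using s
proof (induction s arbitrary: X)
  case Nil
  then show ?case using G H o by (auto simp: is_functor_def)
next
  case (Cons x s)
  let ?L = "localization C W"
  interpret C: category C by fact
  have cmp: "Gm (Comp ?L g f) = Comp D (Gm g) (Gm f) \<and> Hm (Comp ?L g f) = Comp D (Hm g) (Hm f)"
    if "f \<in> Arr ?L" "g \<in> Arr ?L" "Cod ?L f = Dom ?L g" for f g
    using that G H by (auto simp: is_functor_def)
  show ?case
  proof (cases x)
    case (Fwd f)
    then have f: "f \<in> Arr C" "Dom C f = X" "zigzag C W (Cod C f) s Y" using Cons.prems by auto
    then have z: "zigzag C W X [Fwd f] (Cod C f)" by (simp add: C.Cod_Obj)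
    have "zigzag_class C W X (x # s) Y = Comp ?L (zigzag_class C W (Cod C f) s Y) (zigzag_class C W X [Fwd f] (Cod C f))"
      using localization_Comp[OF C z f(3)] Fwd by simp
    moreover have "Gm (zigzag_class C W X [Fwd f] (Cod C f)) = Hm (zigzag_class C W X [Fwd f] (Cod C f))"
      using m f by (auto simp: loc_arr_def)
    ultimately show ?thesis
      using cmp[OF zigzag_class_Arr[OF z] zigzag_class_Arr[OF f(3)]] Cons.IH[OF f(3)] by simp
  next
    case (Bwd w)
    then have f: "w \<in> Arr C \<inter> W" "Cod C w = X" "zigzag C W (Dom C w) s Y" using Cons.prems by auto
    then have z: "zigzag C W X [Bwd w] (Dom C w)" by (simp add: C.Dom_Obj)
    let ?v = "zigzag_class C W X [Bwd w] (Dom C w)" and ?w = "loc_arr C W w"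
    have eq: "zigzag_class C W X (x # s) Y = Comp ?L (zigzag_class C W (Dom C w) s Y) ?v"
      using localization_Comp[OF C z f(3)] Bwd by simp
    have wA: "?w \<in> Hom ?L (Dom C w) X"
      using localization_functor[OF C, of W] f by (auto simp: is_functor_def)
    have vA: "?v \<in> Hom ?L X (Dom C w)" using z by (simp add: Hom_def zigzag_class_Arr)
    have O: "Dom C w \<in> Obj C" "X \<in> Obj C" using f C.Dom_Obj C.Cod_Obj by auto
    have I: "Comp ?L ?v ?w = Id ?L (Dom C w)" "Comp ?L ?w ?v = Id ?L X"
      using localization_inverse[OF C f(1)] f(2) by auto
    have gw: "Gm ?w = Hm ?w" using m f by auto
    have A: "?w \<in> Arr ?L" "?v \<in> Arr ?L" "Dom ?L ?w = Dom C w" "Cod ?L ?w = X"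
      "Dom ?L ?v = X" "Cod ?L ?v = Dom C w"
      using wA vA by (simp_all add: Hom_def)
    have gv: "Gm (Comp ?L ?v ?w) = Comp D (Gm ?v) (Gm ?w)"
      using cmp[of ?w ?v] A by simp
    have hv: "Hm (Comp ?L ?w ?v) = Comp D (Hm ?w) (Hm ?v)"
      using cmp[of ?v ?w] A by simp
    have "Gm (Id ?L (Dom C w)) = Id D (Go (Dom C w))" "Hm (Id ?L X) = Id D (Ho X)"
      using G H O unfolding is_functor_def localization_simps(1) by blast+
    with gv[unfolded I(1)] hv[unfolded I(2)]
    have vw: "Comp D (Gm ?v) (Gm ?w) = Id D (Go (Dom C w))" "Comp D (Hm ?w) (Hm ?v) = Id D (Ho X)"
      by metis+
    have "Gm ?w \<in> Hom D (Go (Dom C w)) (Go X)" "Gm ?v \<in> Hom D (Go X) (Go (Dom C w))"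
      "Hm ?v \<in> Hom D (Ho X) (Ho (Dom C w))"
      using G H A unfolding is_functor_def by metis+
    then have "Gm ?w \<in> Arr D" "Dom D (Gm ?w) = Go (Dom C w)" "Cod D (Gm ?w) = Go X"
      "Gm ?v \<in> Hom D (Go X) (Go (Dom C w))" "Hm ?v \<in> Hom D (Go X) (Go (Dom C w))"
      using o O by (simp_all add: Hom_def)
    then have "Gm ?v = Hm ?v"
      using inv_arr_unique[OF D, of "Gm ?w" "Gm ?v" "Hm ?v"] vw o O gw by simp
    then show ?thesis
      using eq cmp[OF zigzag_class_Arr[OF z] zigzag_class_Arr[OF f(3)]] Cons.IH[OF f(3)] by simp
  qed
qed

lemma localization_universal:
  assumes "category C" and "category D" and "is_functor C D Fo Fm"
    and "\<And>w. w \<in> Arr C \<inter> W \<Longrightarrow> iso_arr D (Fm w)"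
  shows "\<exists>Go Gm. is_functor (localization C W) D Go Gm \<and>
    (\<forall>A \<in> Obj C. Go A = Fo A) \<and> (\<forall>f \<in> Arr C. Gm (loc_arr C W f) = Fm f) \<and>
    (\<forall>Ho Hm. is_functor (localization C W) D Ho Hm \<and>
       (\<forall>A \<in> Obj C. Ho A = Fo A) \<and> (\<forall>f \<in> Arr C. Hm (loc_arr C W f) = Fm f) \<longrightarrow>
       (\<forall>A \<in> Obj C. Ho A = Go A) \<and> (\<forall>x \<in> Arr (localization C W). Hm x = Gm x))"
proof -
  obtain Go Gm where G: "is_functor (localization C W) D Go Gm" "\<forall>A \<in> Obj C. Go A = Fo A"
    "\<forall>f \<in> Arr C. Gm (loc_arr C W f) = Fm f"
    using localization_universal_aux[OF assms] by blast
  have u: "Hm x = Gm x" if H: "is_functor (localization C W) D Ho Hm" "\<forall>A \<in> Obj C. Ho A = Fo A"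
    "\<forall>f \<in> Arr C. Hm (loc_arr C W f) = Fm f" and x: "x \<in> Arr (localization C W)" for Ho Hm x
  proof -
    obtain X s Y where s: "x = zigzag_class C W X s Y" "zigzag C W X s Y"
      using x by (rule localization_ArrE)
    show ?thesis
      unfolding s(1) by (rule localization_unique[OF assms(1,2) H(1) G(1) _ _ s(2)]) (simp_all add: H(2,3) G(2,3))
  qed
  show ?thesis
    by (intro exI[of _ Go] exI[of _ Gm] conjI allI impI; (elim conjE)?)
      (use G u in \<open>simp_all\<close>)
qed


section \<open>Triangulated categories\<close>

text \<open>A triangle \<open>X \<rightarrow> Y \<rightarrow> Z \<rightarrow> \<Sigma> X\<close> is given by its three arrows; \<open>So\<close> and \<open>Sm\<close> are the action of
  the suspension \<open>\<Sigma>\<close> on objects and on arrows. \<open>\<Sigma>\<close> is an auto-equivalence, not necessarily an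
  automorphism.\<close>

definition triangle :: "('o, 'm) cat \<Rightarrow> ('o \<Rightarrow> 'o) \<Rightarrow> 'm \<Rightarrow> 'm \<Rightarrow> 'm \<Rightarrow> bool" where
  "triangle C So f g h \<longleftrightarrow> f \<in> Arr C \<and> g \<in> Arr C \<and> h \<in> Arr C \<and>
     Cod C f = Dom C g \<and> Cod C g = Dom C h \<and> Cod C h = So (Dom C f)"

locale triangulated_category = additive_category C add null
  for C :: "('o, 'm) cat" (structure) and add null +
  fixes So :: "'o \<Rightarrow> 'o" and Sm :: "'m \<Rightarrow> 'm" and tri :: "('m \<times> 'm \<times> 'm) set"
  assumes suspension_equivalence: "is_equivalence C C So Sm"
    and suspension_additive: "\<lbrakk>f \<in> Hom C A B; g \<in> Hom C A B\<rbrakk> \<Longrightarrow> Sm (add f g) = add (Sm f) (Sm g)"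
    and tri_triangle: "(f, g, h) \<in> tri \<Longrightarrow> triangle C So f g h"
    and TR1_iso: "\<lbrakk>(f, g, h) \<in> tri; triangle C So f' g' h';
        a \<in> Hom C (Dom C f) (Dom C f'); b \<in> Hom C (Dom C g) (Dom C g');
        c \<in> Hom C (Dom C h) (Dom C h'); iso_arr C a; iso_arr C b; iso_arr C c;
        b \<cdot> f = f' \<cdot> a; c \<cdot> g = g' \<cdot> b; Sm a \<cdot> h = h' \<cdot> c\<rbrakk> \<Longrightarrow> (f', g', h') \<in> tri"
    and TR1_Id: "\<lbrakk>X \<in> Obj C; zero_object C Z\<rbrakk> \<Longrightarrow> (Id C X, null X Z, null Z (So X)) \<in> tri"
    and TR1_ex: "f \<in> Arr C \<Longrightarrow> \<exists>g h. (f, g, h) \<in> tri"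
    and TR2: "triangle C So f g h \<Longrightarrow> (f, g, h) \<in> tri \<longleftrightarrow>
        (g, h, inv\<^bsub>hom_group C add null (So (Dom C f)) (So (Cod C f))\<^esub> (Sm f)) \<in> tri"
    and TR3: "\<lbrakk>(f, g, h) \<in> tri; (f', g', h') \<in> tri; a \<in> Hom C (Dom C f) (Dom C f');
        b \<in> Hom C (Dom C g) (Dom C g'); b \<cdot> f = f' \<cdot> a\<rbrakk>
      \<Longrightarrow> \<exists>c \<in> Hom C (Dom C h) (Dom C h'). c \<cdot> g = g' \<cdot> b \<and> Sm a \<cdot> h = h' \<cdot> c"
    and TR4: "\<lbrakk>(f, f1, f2) \<in> tri; (g, g1, g2) \<in> tri; Cod C f = Dom C g; (g \<cdot> f, k1, k2) \<in> tri\<rbrakk>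
      \<Longrightarrow> \<exists>u \<in> Hom C (Cod C f1) (Cod C k1). \<exists>v \<in> Hom C (Cod C k1) (Cod C g1).
            (u, v, Sm f1 \<cdot> g2) \<in> tri \<and>
            u \<cdot> f1 = k1 \<cdot> g \<and> k2 \<cdot> u = f2 \<and> v \<cdot> k1 = g1 \<and> g2 \<cdot> v = Sm f \<cdot> k2"

end

theory Submission
  imports Defs
begin

text \<open>Let \<open>N\<close> be the class of trivial objects. An inflation is a weak equivalence if and only if
  its cokernel is in \<open>N\<close>, dually for deflations. Modulo the maps factoring through \<open>N\<close> (phantom maps)
  the weak equivalences are monic and epic and satisfy both Ore conditions, so the localization is a
  category of fractions in which two maps \<open>f\<close>, \<open>g\<close> are identified exactly if \<open>f - g\<close> is phantom.

  The suspension of \<open>A\<close> is the cokernel of a cofibration from \<open>A\<close> to a trivially fibrant object, and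
  every conflation \<open>A \<rightarrow> B \<rightarrow> D\<close> has a natural connecting morphism \<open>D \<rightarrow> \<Sigma> A\<close>, found by extending
  \<open>A \<rightarrow> I\<close> over \<open>B\<close> after replacing \<open>D\<close> by a cofibrant object. The distinguished triangles are those
  isomorphic to the triangles of conflations; rotation rests on the fact that the two conflations
  belonging to a pullback of two deflations have opposite connecting morphisms, and the octahedral
  axiom on Noether's isomorphism for inflations.\<close>

section \<open>Categories and additive categories\<close>

text \<open>There is no restriction to bifibrant objects: all objects are kept, and an object is
  replaced by a cofibrant or fibrant one only where a lifting problem asks for it. As factorizations
  are chosen and not functorial, the suspension and the connecting morphism are determined in the
  exact category only modulo phantom maps; \<open>Q_eq_iff\<close> says that this is exactly the
  ambiguity that the localization removes. The main obstacle is that a square commuting in the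
  localization comes from one that commutes only up to a phantom map, whereas inducing a map on
  cokernels needs strict commutativity. So a conflation is replaced by a weakly equivalent one with
  a larger middle term, on which the phantom error can be subtracted (\<open>ex_roof\<close>,
  \<open>conflation_fill\<close>). Duality halves much of the work: most facts on deflations,
  pullbacks and fibrations are instances at \<open>op_cat C\<close> of facts on inflations, pushouts
  and cofibrations. Trivial objects, phantom maps and \<open>\<sim>\<close> are self-dual.\<close>

lemma HomD: "f \<in> Hom C A B \<Longrightarrow> f \<in> Arr C \<and> Dom C f = A \<and> Cod C f = B"
  by (simp add: Hom_def)

context category
begin

lemma comp_simps [simp]:
  assumes "f \<in> Arr C" "g \<in> Arr C" "Cod C f = Dom C g"
  shows "g \<cdot> f \<in> Arr C" "Dom C (g \<cdot> f) = Dom C f" "Cod C (g \<cdot> f) = Cod C g"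
  using Comp_Hom[OF assms] by (auto simp: Hom_def)

lemma comp_assoc [simp]:
  "\<lbrakk>f \<in> Arr C; g \<in> Arr C; h \<in> Arr C; Cod C f = Dom C g; Cod C g = Dom C h\<rbrakk>
      \<Longrightarrow> (h \<cdot> g) \<cdot> f = h \<cdot> (g \<cdot> f)"
  by (rule Comp_assoc)

lemma id_simps [simp]:
  assumes "A \<in> Obj C"
  shows "Id C A \<in> Arr C" "Dom C (Id C A) = A" "Cod C (Id C A) = A"
  using Id_Hom[OF assms] by (auto simp: Hom_def)

lemma comp_id [simp]:
  "f \<in> Arr C \<Longrightarrow> Dom C f = A \<Longrightarrow> f \<cdot> Id C A = f"
  "f \<in> Arr C \<Longrightarrow> Cod C f = A \<Longrightarrow> Id C A \<cdot> f = f"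
  using Comp_Id Id_Comp by auto

lemma Hom_objs: "f \<in> Hom C A B \<Longrightarrow> A \<in> Obj C" "f \<in> Hom C A B \<Longrightarrow> B \<in> Obj C"
  using Dom_Obj Cod_Obj by (auto simp: Hom_def)

lemma Dom_Cod_Obj [simp]: "f \<in> Arr C \<Longrightarrow> Dom C f \<in> Obj C" "f \<in> Arr C \<Longrightarrow> Cod C f \<in> Obj C"
  using Dom_Obj Cod_Obj by auto

lemma comp_Hom: "f \<in> Hom C A B \<Longrightarrow> g \<in> Hom C B X \<Longrightarrow> g \<cdot> f \<in> Hom C A X"
  by (simp add: Hom_def)

text \<open>Since \<open>comp_assoc\<close> nests composites to the right, the left side of
  \<open>g \<cdot> f = h\<close> is no longer visible once an arrow precedes \<open>f\<close>. This
  form makes such an equation usable as a rewrite rule.\<close>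

lemma comp_reassoc: "g \<cdot> f = h \<Longrightarrow> f \<in> Arr C \<Longrightarrow> g \<in> Arr C \<Longrightarrow> Cod C f = Dom C g \<Longrightarrow>
   x \<in> Arr C \<Longrightarrow> Cod C x = Dom C f \<Longrightarrow> g \<cdot> (f \<cdot> x) = h \<cdot> x"
  by (metis Comp_assoc)

lemma iso_arrI:
  assumes "f \<in> Hom C A B" "g \<in> Hom C B A" "g \<cdot> f = Id C A" "f \<cdot> g = Id C B"
  shows "iso_arr C f"
  using assms unfolding iso_arr_def Hom_def by auto

lemma iso_arrE:
  assumes "iso_arr C f" "f \<in> Hom C A B"
  obtains g where "g \<in> Hom C B A" "g \<cdot> f = Id C A" "f \<cdot> g = Id C B" "iso_arr C g"
  using assms unfolding iso_arr_def Hom_def by auto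

lemma iso_arr_Id: "A \<in> Obj C \<Longrightarrow> iso_arr C (Id C A)"
  by (rule iso_arrI[of _ A A "Id C A"]) (auto simp: Hom_def)

lemma iso_arr_comp:
  assumes "iso_arr C f" "iso_arr C g" "f \<in> Hom C A B" "g \<in> Hom C B X"
  shows "iso_arr C (g \<cdot> f)"
proof -
  obtain f' where f': "f' \<in> Hom C B A" "f' \<cdot> f = Id C A" "f \<cdot> f' = Id C B"
    using iso_arrE[OF assms(1,3)] by blast
  obtain g' where g': "g' \<in> Hom C X B" "g' \<cdot> g = Id C B" "g \<cdot> g' = Id C X"
    using iso_arrE[OF assms(2,4)] by blast
  show ?thesis
    by (rule iso_arrI[of _ A X "f' \<cdot> g'"])
      (use assms(3,4) f' g' in \<open>simp_all add: Hom_def comp_reassoc[OF g'(2)] comp_reassoc[OF f'(3)]\<close>)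
qed

lemma iso_cancel_left:
  assumes "iso_arr C w" "w \<in> Hom C B X" "f \<in> Hom C A B" "g \<in> Hom C A B" "w \<cdot> f = w \<cdot> g"
  shows "f = g"
proof -
  obtain v where v: "v \<in> Hom C X B" "v \<cdot> w = Id C B"
    using iso_arrE[OF assms(1,2)] by blast
  have "v \<cdot> (w \<cdot> f) = v \<cdot> (w \<cdot> g)" using assms by simp
  then show ?thesis using assms(2-4) v by (simp add: Hom_def comp_reassoc[OF v(2)])
qed

lemma iso_cancel_right:
  assumes "iso_arr C w" "w \<in> Hom C A B" "f \<in> Hom C B X" "g \<in> Hom C B X" "f \<cdot> w = g \<cdot> w"
  shows "f = g"
proof -
  obtain v where v: "v \<in> Hom C B A" "w \<cdot> v = Id C B"
    using iso_arrE[OF assms(1,2)] by blast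
  have "(f \<cdot> w) \<cdot> v = (g \<cdot> w) \<cdot> v" using assms by simp
  then show ?thesis using assms(2-4) v by (simp add: Hom_def)
qed

end

context preadditive_category
begin

definition neg where
  "neg f = inv\<^bsub>hom_group C add null (Dom C f) (Cod C f)\<^esub> f"

lemma null_Hom: "\<lbrakk>A \<in> Obj C; B \<in> Obj C\<rbrakk> \<Longrightarrow> null A B \<in> Hom C A B"
  using monoid.one_closed[OF comm_monoid.axioms(1)[OF comm_group.axioms(1)[OF hom_comm_group[of A B]]]]
  by (simp add: hom_group_def)

lemma null_simps [simp]:
  assumes "A \<in> Obj C" "B \<in> Obj C"
  shows "null A B \<in> Arr C" "Dom C (null A B) = A" "Cod C (null A B) = B"
  using null_Hom[OF assms] by (auto simp: Hom_def)

context
  fixes A B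
  assumes AB: "A \<in> Obj C" "B \<in> Obj C"
begin

text \<open>The rewrites make the group laws speak of \<open>Hom\<close>, \<open>add\<close> and
  \<open>null\<close> instead of record fields.\<close>

interpretation G: comm_group "hom_group C add null A B"
  rewrites "carrier (hom_group C add null A B) = Hom C A B"
    and "mult (hom_group C add null A B) = add"
    and "one (hom_group C add null A B) = null A B"
  using hom_comm_group[OF AB] by (auto simp: hom_group_def)

lemmas Hom_group_facts = G.m_closed G.m_assoc G.m_comm G.l_one G.r_one G.inv_closed G.l_inv G.r_inv

end

lemma add_simps [simp]:
  assumes "f \<in> Arr C" "g \<in> Arr C" "Dom C f = Dom C g" "Cod C f = Cod C g"
  shows "add f g \<in> Arr C" "Dom C (add f g) = Dom C g" "Cod C (add f g) = Cod C g"
  using assms Hom_group_facts(1)[of "Dom C g" "Cod C g" f g] by (auto simp: Hom_def)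

lemma add_Hom: "f \<in> Hom C A B \<Longrightarrow> g \<in> Hom C A B \<Longrightarrow> add f g \<in> Hom C A B"
  by (simp add: Hom_def)

lemma neg_simps [simp]:
  assumes "f \<in> Arr C"
  shows "neg f \<in> Arr C" "Dom C (neg f) = Dom C f" "Cod C (neg f) = Cod C f"
  using assms Hom_group_facts(6)[of "Dom C f" "Cod C f" f] by (auto simp: Hom_def neg_def)

lemma neg_Hom: "f \<in> Hom C A B \<Longrightarrow> neg f \<in> Hom C A B"
  by (simp add: Hom_def)

lemma add_assoc:
  "\<lbrakk>f \<in> Arr C; g \<in> Arr C; h \<in> Arr C; Dom C f = Dom C h; Cod C f = Cod C h; Dom C g = Dom C h; Cod C g = Cod C h\<rbrakk>
  \<Longrightarrow> add (add f g) h = add f (add g h)"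
  using Hom_group_facts(2)[of "Dom C h" "Cod C h" f g h] by (simp add: Hom_def)

lemma add_commute:
  "\<lbrakk>f \<in> Arr C; g \<in> Arr C; Dom C f = Dom C g; Cod C f = Cod C g\<rbrakk> \<Longrightarrow> add f g = add g f"
  using Hom_group_facts(3)[of "Dom C g" "Cod C g" f g] by (simp add: Hom_def)

lemma add_left_commute:
  "\<lbrakk>f \<in> Arr C; g \<in> Arr C; h \<in> Arr C; Dom C f = Dom C h; Cod C f = Cod C h; Dom C g = Dom C h; Cod C g = Cod C h\<rbrakk>
  \<Longrightarrow> add f (add g h) = add g (add f h)"
  by (metis add_assoc add_commute)

lemmas add_ac = add_assoc add_commute add_left_commute

lemma add_null [simp]:
  "\<lbrakk>f \<in> Arr C; Dom C f = A; Cod C f = B\<rbrakk> \<Longrightarrow> add f (null A B) = f"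
  "\<lbrakk>f \<in> Arr C; Dom C f = A; Cod C f = B\<rbrakk> \<Longrightarrow> add (null A B) f = f"
  using Hom_group_facts(4,5)[of A B f] by (auto simp: Hom_def)

lemma add_neg [simp]:
  "f \<in> Arr C \<Longrightarrow> add f (neg f) = null (Dom C f) (Cod C f)"
  "f \<in> Arr C \<Longrightarrow> add (neg f) f = null (Dom C f) (Cod C f)"
  using Hom_group_facts(7,8)[of "Dom C f" "Cod C f" f] by (auto simp: Hom_def neg_def)

lemma add_neg_assoc [simp]:
  "\<lbrakk>f \<in> Arr C; g \<in> Arr C; Dom C f = Dom C g; Cod C f = Cod C g\<rbrakk> \<Longrightarrow> add f (add (neg f) g) = g"
  "\<lbrakk>f \<in> Arr C; g \<in> Arr C; Dom C f = Dom C g; Cod C f = Cod C g\<rbrakk> \<Longrightarrow> add (neg f) (add f g) = g"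
  by (simp_all add: add_assoc[symmetric])

lemma add_cancel:
  "\<lbrakk>f \<in> Arr C; g \<in> Arr C; h \<in> Arr C; Dom C f = Dom C h; Cod C f = Cod C h; Dom C g = Dom C h; Cod C g = Cod C h;
    add f g = add f h\<rbrakk> \<Longrightarrow> g = h"
  by (rule HOL.trans[OF add_neg_assoc(2)[of f g, symmetric]]) simp_all

lemma neg_unique:
  assumes "f \<in> Hom C A B" "g \<in> Hom C A B" "add f g = null A B"
  shows "g = neg f"
proof -
  have "add f g = add f (neg f)" using assms by (simp add: Hom_def)
  from add_cancel[OF _ _ _ _ _ _ _ this] show ?thesis using assms(1,2) by (simp add: Hom_def)
qed

lemma neg_neg [simp]: "f \<in> Arr C \<Longrightarrow> neg (neg f) = f"
  using neg_unique[of "neg f" "Dom C f" "Cod C f" f] by (simp add: Hom_def)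

lemma neg_null [simp]: "A \<in> Obj C \<Longrightarrow> B \<in> Obj C \<Longrightarrow> neg (null A B) = null A B"
  using neg_unique[of "null A B" A B "null A B"] by (simp add: Hom_def)

lemma neg_add [simp]:
  assumes "f \<in> Arr C" "g \<in> Arr C" "Dom C f = Dom C g" "Cod C f = Cod C g"
  shows "neg (add f g) = add (neg f) (neg g)"
proof -
  have "add (add f g) (add (neg f) (neg g)) = add (add f (neg f)) (add g (neg g))"
    using assms by (simp add: add_assoc add_left_commute[of g "neg f" "neg g"] del: add_neg)
  then have "add (add f g) (add (neg f) (neg g)) = null (Dom C g) (Cod C g)"
    using assms by simp
  then show ?thesis using assms by (intro neg_unique[symmetric, rotated 2]) (simp_all add: Hom_def)
qed

lemma comp_add [simp]:
  "\<lbrakk>f \<in> Arr C; g \<in> Arr C; g' \<in> Arr C; Cod C f = Dom C g; Dom C g = Dom C g'; Cod C g = Cod C g'\<rbrakk>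
    \<Longrightarrow> add g g' \<cdot> f = add (g \<cdot> f) (g' \<cdot> f)"
  "\<lbrakk>f \<in> Arr C; f' \<in> Arr C; g \<in> Arr C; Cod C f = Dom C g; Dom C f = Dom C f'; Cod C f = Cod C f'\<rbrakk>
    \<Longrightarrow> g \<cdot> add f f' = add (g \<cdot> f) (g \<cdot> f')"
  using Comp_add_left[of f "Dom C f" "Cod C f" g "Cod C g" g'] Comp_add_right[of f "Dom C f" "Cod C f" f' g "Cod C g"]
  by (auto simp: Hom_def)

lemma comp_null [simp]:
  assumes "f \<in> Arr C"
  shows "Cod C f = A \<Longrightarrow> B \<in> Obj C \<Longrightarrow> null A B \<cdot> f = null (Dom C f) B"
    and "Dom C f = B \<Longrightarrow> A \<in> Obj C \<Longrightarrow> f \<cdot> null A B = null A (Cod C f)"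
proof -
  \<comment> \<open>In a group only zero satisfies \<open>h + h = h\<close>; a composite with a zero
    arrow does so by bilinearity.\<close>
  have idem: "h = null X Y" if "h \<in> Hom C X Y" "add h h = h" for h X Y
    by (rule add_cancel[of h]) (use that Hom_objs[OF that(1)] in \<open>simp_all add: Hom_def\<close>)
  show "null A B \<cdot> f = null (Dom C f) B" if "Cod C f = A" "B \<in> Obj C"
  proof (rule idem)
    show "add (null A B \<cdot> f) (null A B \<cdot> f) = null A B \<cdot> f"
      by (subst comp_add(1)[symmetric]) (use that assms in auto)
  qed (use that assms in \<open>auto simp: Hom_def\<close>)
  show "f \<cdot> null A B = null A (Cod C f)" if "Dom C f = B" "A \<in> Obj C"
  proof (rule idem)
    show "add (f \<cdot> null A B) (f \<cdot> null A B) = f \<cdot> null A B"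
      by (subst comp_add(2)[symmetric]) (use that assms in auto)
  qed (use that assms in \<open>auto simp: Hom_def\<close>)
qed

lemma comp_neg [simp]:
  assumes "f \<in> Arr C" "g \<in> Arr C" "Cod C f = Dom C g"
  shows "neg g \<cdot> f = neg (g \<cdot> f)" "g \<cdot> neg f = neg (g \<cdot> f)"
proof -
  have "add (g \<cdot> f) (neg g \<cdot> f) = add g (neg g) \<cdot> f"
    by (rule comp_add(1)[symmetric]) (use assms in auto)
  then have "add (g \<cdot> f) (neg g \<cdot> f) = null (Dom C f) (Cod C g)" using assms by simp
  then show "neg g \<cdot> f = neg (g \<cdot> f)"
    by (rule neg_unique[rotated 2]) (use assms in \<open>auto simp: Hom_def\<close>)
  have "add (g \<cdot> f) (g \<cdot> neg f) = g \<cdot> add f (neg f)"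
    by (rule comp_add(2)[symmetric]) (use assms in auto)
  then have "add (g \<cdot> f) (g \<cdot> neg f) = null (Dom C f) (Cod C g)" using assms by simp
  then show "g \<cdot> neg f = neg (g \<cdot> f)"
    by (rule neg_unique[rotated 2]) (use assms in \<open>auto simp: Hom_def\<close>)
qed

lemma diff_eq_null:
  assumes "f \<in> Hom C A B" "g \<in> Hom C A B" "add f (neg g) = null A B"
  shows "f = g"
proof -
  have "neg (neg g) = neg (neg f)"
    using neg_unique[OF assms(1) neg_Hom[OF assms(2)] assms(3)] by (rule arg_cong)
  then show ?thesis using assms(1,2) by (simp add: Hom_def)
qed

lemma zero_arr:
  assumes "zero_object C Z" "f \<in> Arr C" "Dom C f = Z \<or> Cod C f = Z"
  shows "f = null (Dom C f) (Cod C f)"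
proof -
  have "Dom C f \<in> Obj C" "Cod C f \<in> Obj C" "f \<in> Hom C (Dom C f) (Cod C f)" using assms by (auto simp: Hom_def)
  moreover from this have "null (Dom C f) (Cod C f) \<in> Hom C (Dom C f) (Cod C f)" by (simp add: Hom_def)
  ultimately show ?thesis using assms unfolding zero_object_def by metis
qed

lemma zero_objectI:
  assumes "Z \<in> Obj C" "Id C Z = null Z Z"
  shows "zero_object C Z"
proof -
  have "f = null Z A" if "f \<in> Hom C Z A" for A f
    using that assms comp_id(1)[of f Z] Hom_objs[OF that] by (simp add: Hom_def)
  moreover have "f = null A Z" if "f \<in> Hom C A Z" for A f
    using that assms comp_id(2)[of f Z] Hom_objs[OF that] by (simp add: Hom_def)
  ultimately show ?thesis using assms unfolding zero_object_def by (metis null_Hom)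
qed

lemma zero_Id: "zero_object C Z \<Longrightarrow> Id C Z = null Z Z"
  using zero_arr[of Z "Id C Z"] by (auto simp: zero_object_def)

lemma iso_arr_neg:
  assumes "iso_arr C f" "f \<in> Hom C A B"
  shows "iso_arr C (neg f)"
proof -
  obtain g where "g \<in> Hom C B A" "g \<cdot> f = Id C A" "f \<cdot> g = Id C B" using iso_arrE[OF assms] by blast
  then show ?thesis using assms(2) by (intro iso_arrI[of _ A B "neg g"]) (auto simp: Hom_def)
qed

end


section \<open>The opposite category\<close>

text \<open>Objects and arrows stay the same, so a lemma instantiated here unfolds to a dual
  statement about the arrows of \<open>C\<close> itself.\<close>

definition op_cat :: "('o, 'm) cat \<Rightarrow> ('o, 'm) cat" where
  "op_cat C = \<lparr>Obj = Obj C, Arr = Arr C, Dom = Cod C, Cod = Dom C, Id = Id C, Comp = (\<lambda>g f. f \<cdot>\<^bsub>C\<^esub> g)\<rparr>"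

lemma op_cat_simps [simp]:
  "Obj (op_cat C) = Obj C" "Arr (op_cat C) = Arr C" "Dom (op_cat C) = Cod C" "Cod (op_cat C) = Dom C"
  "Id (op_cat C) = Id C" "g \<cdot>\<^bsub>op_cat C\<^esub> f = f \<cdot>\<^bsub>C\<^esub> g" "Hom (op_cat C) A B = Hom C B A"
  by (auto simp: op_cat_def Hom_def)

lemma zero_object_op [simp]: "zero_object (op_cat C) Z \<longleftrightarrow> zero_object C Z"
  by (auto simp: zero_object_def)

lemma iso_arr_op [simp]: "iso_arr (op_cat C) f \<longleftrightarrow> iso_arr C f"
  by (auto simp: iso_arr_def)

lemma commutative_square_op:
  "commutative_square (op_cat C) f g f' g' \<longleftrightarrow> commutative_square C g' f' g f"
  by (auto simp: commutative_square_def)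

text \<open>Reversing arrows exchanges the two legs of a test square, hence the two bound variables
  of a universal property.\<close>

lemma all_imp_swap:
  "(\<And>x y. R y x \<Longrightarrow> P x y = Q y x) \<Longrightarrow> (\<forall>x y. R y x \<longrightarrow> P x y) = (\<forall>x y. R x y \<longrightarrow> Q x y)"
  by blast

lemma pushout_square_op: "pushout_square (op_cat C) f g f' g' \<longleftrightarrow> pullback_square C g' f' g f"
proof -
  have "(\<exists>!u. u \<in> Hom C (Dom C x) (Dom C f') \<and> f' \<cdot>\<^bsub>C\<^esub> u = x \<and> g' \<cdot>\<^bsub>C\<^esub> u = y) \<longleftrightarrow>
    (\<exists>!u. u \<in> Hom C (Dom C y) (Dom C g') \<and> g' \<cdot>\<^bsub>C\<^esub> u = y \<and> f' \<cdot>\<^bsub>C\<^esub> u = x)"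
    if "commutative_square C g' f' g f" "commutative_square C y x g f" for x y
    using that by (simp add: commutative_square_def conj_commute)
  note * = this
  show ?thesis
    unfolding pushout_square_def pullback_square_def commutative_square_op op_cat_simps
    by (intro conj_cong HOL.refl all_imp_swap; rule *)
qed

lemma pullback_square_op: "pullback_square (op_cat C) f g f' g' \<longleftrightarrow> pushout_square C g' f' g f"
proof -
  have "(\<exists>!u. u \<in> Hom C (Cod C f) (Cod C x) \<and> u \<cdot>\<^bsub>C\<^esub> f = x \<and> u \<cdot>\<^bsub>C\<^esub> g = y) \<longleftrightarrow>
    (\<exists>!u. u \<in> Hom C (Cod C g) (Cod C y) \<and> u \<cdot>\<^bsub>C\<^esub> g = y \<and> u \<cdot>\<^bsub>C\<^esub> f = x)"
    if "commutative_square C g' f' g f" "commutative_square C g' f' y x" for x y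
    using that by (simp add: commutative_square_def conj_commute)
  note * = this
  show ?thesis
    unfolding pushout_square_def pullback_square_def commutative_square_op op_cat_simps
    by (intro conj_cong HOL.refl all_imp_swap; rule *)
qed

lemma pushout_square_sym:
  assumes "pushout_square C f g f' g'"
  shows "pushout_square C g f g' f'"
proof -
  have sq: "commutative_square C g f x y \<longleftrightarrow> commutative_square C f g y x" for x y
    by (auto simp: commutative_square_def)
  have "Cod C f' = Cod C g'" using assms by (simp add: pushout_square_def commutative_square_def)
  then have "(\<exists>!u. u \<in> Hom C (Cod C g') (Cod C x) \<and> u \<cdot>\<^bsub>C\<^esub> g' = x \<and> u \<cdot>\<^bsub>C\<^esub> f' = y) \<longleftrightarrow>
      (\<exists>!u. u \<in> Hom C (Cod C f') (Cod C y) \<and> u \<cdot>\<^bsub>C\<^esub> f' = y \<and> u \<cdot>\<^bsub>C\<^esub> g' = x)"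
    if "commutative_square C f g y x" for x y
    using that by (simp add: commutative_square_def conj_commute)
  note * = this
  have "pushout_square C g f g' f' \<longleftrightarrow> pushout_square C f g f' g'"
    unfolding pushout_square_def sq by (intro conj_cong HOL.refl all_imp_swap; rule *)
  with assms show ?thesis by blast
qed

lemma pullback_square_sym:
  assumes "pullback_square C f g f' g'"
  shows "pullback_square C g f g' f'"
  using assms unfolding pushout_square_op[symmetric] by (rule pushout_square_sym)

lemma retract_of_op:
  assumes "retract_of (op_cat C) f g"
  shows "retract_of C f g"
proof -
  obtain s r t v where "s \<in> Hom C (Cod C g) (Cod C f)" "r \<in> Hom C (Cod C f) (Cod C g)"
    "t \<in> Hom C (Dom C g) (Dom C f)" "v \<in> Hom C (Dom C f) (Dom C g)" "f \<in> Arr C" "g \<in> Arr C"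
    "s \<cdot>\<^bsub>C\<^esub> r = Id C (Cod C f)" "t \<cdot>\<^bsub>C\<^esub> v = Id C (Dom C f)" "s \<cdot>\<^bsub>C\<^esub> g = f \<cdot>\<^bsub>C\<^esub> t" "r \<cdot>\<^bsub>C\<^esub> f = g \<cdot>\<^bsub>C\<^esub> v"
    using assms unfolding retract_of_def op_cat_simps by blast
  then show ?thesis
    unfolding retract_of_def
    by (intro conjI bexI[of _ v] bexI[of _ t] bexI[of _ r] bexI[of _ s]) simp_all
qed

lemma is_kernel_op [simp]: "is_kernel (op_cat C) (\<lambda>A B. null B A) k f \<longleftrightarrow> is_cokernel C null k f"
  unfolding is_kernel_def is_cokernel_def op_cat_simps eq_commute[of "Dom C k" "Cod C f"] by (rule HOL.refl)

lemma is_cokernel_op [simp]: "is_cokernel (op_cat C) (\<lambda>A B. null B A) k f \<longleftrightarrow> is_kernel C null k f"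
  unfolding is_kernel_def is_cokernel_def op_cat_simps eq_commute[of "Dom C f" "Cod C k"] by (rule HOL.refl)

lemma is_biproduct_op:
  "is_biproduct (op_cat C) add (\<lambda>A B. null B A) A B P p q i j \<longleftrightarrow> is_biproduct C add null A B P i j p q"
  by (auto simp: is_biproduct_def)

lemma adm_op [simp]: "adm_mono (conf\<inverse>) p \<longleftrightarrow> adm_epi conf p" "adm_epi (conf\<inverse>) i \<longleftrightarrow> adm_mono conf i"
  by (auto simp: adm_mono_def adm_epi_def)

lemma fibrant_obj_op: "fibrant_obj (op_cat C) S X \<longleftrightarrow> cofibrant_obj C S X"
  and cofibrant_obj_op: "cofibrant_obj (op_cat C) S X \<longleftrightarrow> fibrant_obj C S X"
  by (auto simp: fibrant_obj_def cofibrant_obj_def)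

section \<open>Opposites of the categorical structures\<close>

context category
begin

lemma category_op: "category (op_cat C)"
  by unfold_locales (auto simp: Hom_def)

end

text \<open>Arrows \<open>A \<rightarrow> B\<close> of the opposite category are arrows
  \<open>B \<rightarrow> A\<close> of \<open>C\<close>, whence the swapped arguments of
  \<open>null\<close>; the hom-groups are the same records.\<close>

lemma (in preadditive_category) preadditive_category_op:
  "preadditive_category (op_cat C) add (\<lambda>A B. null B A)"
proof -
  interpret op: category "op_cat C" by (rule category_op)
  have "hom_group (op_cat C) add (\<lambda>A B. null B A) A B = hom_group C add null B A" for A B
    by (simp add: hom_group_def)
  then show ?thesis
    by (intro preadditive_category.intro category_op preadditive_category_axioms.intro)
      (auto simp: hom_comm_group Hom_def)
qed

lemma (in additive_category) additive_category_op:
  "additive_category (op_cat C) add (\<lambda>A B. null B A)"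
proof -
  interpret op: preadditive_category "op_cat C" add "\<lambda>A B. null B A" by (rule preadditive_category_op)
  show ?thesis
    by unfold_locales (use ex_zero_object ex_biproduct in \<open>auto simp: is_biproduct_op\<close>, meson)
qed

lemma (in exact_category) exact_category_op:
  "exact_category (op_cat C) add (\<lambda>A B. null B A) (conf\<inverse>)"
proof -
  interpret op: additive_category "op_cat C" add "\<lambda>A B. null B A" by (rule additive_category_op)
  show ?thesis
  proof unfold_locales
    fix i p i' p' a b c
    assume "(i, p) \<in> conf\<inverse>" "i' \<in> Arr (op_cat C)" "p' \<in> Arr (op_cat C)" "Cod (op_cat C) i' = Dom (op_cat C) p'"
      "a \<in> Hom (op_cat C) (Dom (op_cat C) i) (Dom (op_cat C) i')" "b \<in> Hom (op_cat C) (Cod (op_cat C) i) (Cod (op_cat C) i')"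
      "c \<in> Hom (op_cat C) (Cod (op_cat C) p) (Cod (op_cat C) p')" "iso_arr (op_cat C) a" "iso_arr (op_cat C) b" "iso_arr (op_cat C) c"
      "b \<cdot>\<^bsub>op_cat C\<^esub> i = i' \<cdot>\<^bsub>op_cat C\<^esub> a" "c \<cdot>\<^bsub>op_cat C\<^esub> p = p' \<cdot>\<^bsub>op_cat C\<^esub> b"
    note * = this[unfolded op_cat_simps iso_arr_op]
    have ip: "(p, i) \<in> conf" "p \<in> Arr C" "i \<in> Arr C" "Cod C p = Dom C i"
      using * conf_kernel_cokernel[of p i] by (auto simp: is_kernel_def)
    \<comment> \<open>Read in \<open>C\<close>, the given isomorphism of conflations runs from the
      primed to the unprimed one, so \<open>conf_iso\<close> is applied to the inverses.\<close>
    obtain a' where a': "a' \<in> Hom C (Cod C i) (Cod C i')" "a' \<cdot> a = Id C (Cod C i')" "a \<cdot> a' = Id C (Cod C i)" "iso_arr C a'"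
      using iso_arrE *(5,8) by blast
    obtain b' where b': "b' \<in> Hom C (Dom C i) (Dom C i')" "b' \<cdot> b = Id C (Dom C i')" "b \<cdot> b' = Id C (Dom C i)" "iso_arr C b'"
      using iso_arrE *(6,9) by blast
    obtain c' where c': "c' \<in> Hom C (Dom C p) (Dom C p')" "c' \<cdot> c = Id C (Dom C p')" "c \<cdot> c' = Id C (Dom C p)" "iso_arr C c'"
      using iso_arrE *(7,10) by blast
    have "b' \<cdot> p = (b' \<cdot> (p \<cdot> c)) \<cdot> c'" using ip *(1-10) b' c' by (simp add: Hom_def)
    also have "\<dots> = p' \<cdot> c'"
      unfolding *(12) using ip * b' c' by (simp add: Hom_def comp_reassoc[OF b'(2)])
    finally have 1: "b' \<cdot> p = p' \<cdot> c'" .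
    have "a' \<cdot> i = (a' \<cdot> (i \<cdot> b)) \<cdot> b'" using ip *(1-10) b' a' by (simp add: Hom_def)
    also have "\<dots> = i' \<cdot> b'"
      unfolding *(11) using ip * b' a' by (simp add: Hom_def comp_reassoc[OF a'(2)])
    finally have 2: "a' \<cdot> i = i' \<cdot> b'" .
    have "(p', i') \<in> conf"
      by (rule conf_iso[OF ip(1) *(3,2) _ c'(1) _ a'(1) c'(4) b'(4) a'(4)]) (use * b' ip 1 2 in \<open>auto simp: Hom_def\<close>)
    then show "(i', p') \<in> conf\<inverse>" by simp
  next
    fix i f
    assume "adm_mono (conf\<inverse>) i" "f \<in> Arr (op_cat C)" "Dom (op_cat C) f = Dom (op_cat C) i"
    then obtain p' f' where "pullback_square C p' f' i f" "adm_epi conf p'"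
      using pullback_adm_epi[of i f] by auto
    then show "\<exists>i' f'. pushout_square (op_cat C) i f i' f' \<and> adm_mono (conf\<inverse>) i'"
      by (auto simp: pushout_square_op intro: pullback_square_sym)
  next
    fix p f
    assume "adm_epi (conf\<inverse>) p" "f \<in> Arr (op_cat C)" "Cod (op_cat C) f = Cod (op_cat C) p"
    then obtain i' f' where "pushout_square C p f i' f'" "adm_mono conf i'"
      using pushout_adm_mono[of p f] by auto
    then show "\<exists>p' f'. pullback_square (op_cat C) p' f' p f \<and> adm_epi (conf\<inverse>) p'"
      by (auto simp: pullback_square_op intro: pushout_square_sym)
  qed (use conf_kernel_cokernel Id_adm_mono Id_adm_epi Comp_adm_mono Comp_adm_epi in auto)
qed

lemma (in model_structure) model_structure_op: "model_structure (op_cat C) fib cof weq"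
proof -
  interpret op: category "op_cat C" by (rule category_op)
  show ?thesis
  proof unfold_locales
    fix i p x y
    assume "i \<in> fib" "p \<in> cof" "i \<in> weq \<or> p \<in> weq" "x \<in> Hom (op_cat C) (Dom (op_cat C) i) (Dom (op_cat C) p)"
      "y \<in> Hom (op_cat C) (Cod (op_cat C) i) (Cod (op_cat C) p)" "p \<cdot>\<^bsub>op_cat C\<^esub> x = y \<cdot>\<^bsub>op_cat C\<^esub> i"
    then show "\<exists>l\<in>Hom (op_cat C) (Cod (op_cat C) i) (Dom (op_cat C) p).
      l \<cdot>\<^bsub>op_cat C\<^esub> i = x \<and> p \<cdot>\<^bsub>op_cat C\<^esub> l = y"
      using lifting[of p i y x] by auto
  next
    fix f assume "f \<in> Arr (op_cat C)"
    then have f: "f \<in> Arr C" by simp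
    obtain i p where "i \<in> cof" "p \<in> fib \<inter> weq" "Cod C i = Dom C p" "f = p \<cdot> i"
      using factor_trivial_fib[OF f] by blast
    then show "\<exists>i\<in>fib \<inter> weq. \<exists>p\<in>cof. Cod (op_cat C) i = Dom (op_cat C) p \<and> f = p \<cdot>\<^bsub>op_cat C\<^esub> i"
      by (intro bexI[of _ p] bexI[of _ i]) auto
    obtain i p where "i \<in> cof \<inter> weq" "p \<in> fib" "Cod C i = Dom C p" "f = p \<cdot> i"
      using factor_trivial_cof[OF f] by blast
    then show "\<exists>i\<in>fib. \<exists>p\<in>cof \<inter> weq. Cod (op_cat C) i = Dom (op_cat C) p \<and> f = p \<cdot>\<^bsub>op_cat C\<^esub> i"
      by (intro bexI[of _ p] bexI[of _ i]) auto
  next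
    fix f g
    show "f \<in> weq \<Longrightarrow> g \<in> weq \<Longrightarrow> Cod (op_cat C) f = Dom (op_cat C) g \<Longrightarrow> g \<cdot>\<^bsub>op_cat C\<^esub> f \<in> weq"
      using weq_Comp[of g f] by simp
    show "f \<in> Arr (op_cat C) \<Longrightarrow> g \<in> weq \<Longrightarrow> Cod (op_cat C) f = Dom (op_cat C) g \<Longrightarrow>
        g \<cdot>\<^bsub>op_cat C\<^esub> f \<in> weq \<Longrightarrow> f \<in> weq"
      using weq_cancel_right[of g f] by simp
    show "f \<in> weq \<Longrightarrow> g \<in> Arr (op_cat C) \<Longrightarrow> Cod (op_cat C) f = Dom (op_cat C) g \<Longrightarrow>
        g \<cdot>\<^bsub>op_cat C\<^esub> f \<in> weq \<Longrightarrow> g \<in> weq"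
      using weq_cancel_left[of g f] by simp
  qed (use cof_Arr fib_Arr weq_Arr in
      \<open>auto intro: cof_retract fib_retract weq_retract dest: retract_of_op\<close>)
qed

lemma (in exact_model_structure) exact_model_structure_op:
  "exact_model_structure (op_cat C) add (\<lambda>A B. null B A) (conf\<inverse>) fib cof weq"
proof -
  interpret op: exact_category "op_cat C" add "\<lambda>A B. null B A" "conf\<inverse>" by (rule exact_category_op)
  interpret op: model_structure "op_cat C" fib cof weq by (rule model_structure_op)
  show ?thesis
    by unfold_locales
      (use cof_iff fib_iff trivial_cof_iff trivial_fib_iff in \<open>simp_all add: fibrant_obj_op cofibrant_obj_op\<close>)
qed


section \<open>Conflations, pushouts and pullbacks\<close>

text \<open>With all objects named, passing to the opposite category just reverses the argument
  list.\<close>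

definition conflation where
  "conflation C conf A i B p D \<longleftrightarrow> (i, p) \<in> conf \<and> i \<in> Hom C A B \<and> p \<in> Hom C B D"

lemma conflation_op: "conflation (op_cat C) (conf\<inverse>) A i B p D \<longleftrightarrow> conflation C conf D p B i A"
  by (auto simp: conflation_def)

text \<open>Existence and uniqueness are separate clauses typed by \<open>Hom\<close>, laid out so
  that the opposite of this formula is \<open>pullback\<close> literally.\<close>

definition pushout where
  "pushout C A B A' B' i f i' f' \<longleftrightarrow> i \<in> Hom C A B \<and> f \<in> Hom C A A' \<and> i' \<in> Hom C A' B' \<and> f' \<in> Hom C B B' \<and>
     f' \<cdot>\<^bsub>C\<^esub> i = i' \<cdot>\<^bsub>C\<^esub> f \<and>
     (\<forall>X. \<forall>x \<in> Hom C A' X. \<forall>y \<in> Hom C B X. x \<cdot>\<^bsub>C\<^esub> f = y \<cdot>\<^bsub>C\<^esub> i \<longrightarrow>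
        (\<exists>u \<in> Hom C B' X. u \<cdot>\<^bsub>C\<^esub> i' = x \<and> u \<cdot>\<^bsub>C\<^esub> f' = y)) \<and>
     (\<forall>X. \<forall>u \<in> Hom C B' X. \<forall>v \<in> Hom C B' X. u \<cdot>\<^bsub>C\<^esub> i' = v \<cdot>\<^bsub>C\<^esub> i' \<and> u \<cdot>\<^bsub>C\<^esub> f' = v \<cdot>\<^bsub>C\<^esub> f' \<longrightarrow> u = v)"

definition pullback where
  "pullback C A B A' B' i f i' f' \<longleftrightarrow> i \<in> Hom C B A \<and> f \<in> Hom C A' A \<and> i' \<in> Hom C B' A' \<and> f' \<in> Hom C B' B \<and>
     i \<cdot>\<^bsub>C\<^esub> f' = f \<cdot>\<^bsub>C\<^esub> i' \<and>
     (\<forall>X. \<forall>x \<in> Hom C X A'. \<forall>y \<in> Hom C X B. f \<cdot>\<^bsub>C\<^esub> x = i \<cdot>\<^bsub>C\<^esub> y \<longrightarrow>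
        (\<exists>u \<in> Hom C X B'. i' \<cdot>\<^bsub>C\<^esub> u = x \<and> f' \<cdot>\<^bsub>C\<^esub> u = y)) \<and>
     (\<forall>X. \<forall>u \<in> Hom C X B'. \<forall>v \<in> Hom C X B'. i' \<cdot>\<^bsub>C\<^esub> u = i' \<cdot>\<^bsub>C\<^esub> v \<and> f' \<cdot>\<^bsub>C\<^esub> u = f' \<cdot>\<^bsub>C\<^esub> v \<longrightarrow> u = v)"

lemma pushout_op: "pushout (op_cat C) A B A' B' i f i' f' \<longleftrightarrow> pullback C A B A' B' i f i' f'"
  unfolding pushout_def pullback_def op_cat_simps by (rule HOL.refl)

lemma pushoutD:
  assumes "pushout C A B A' B' i f i' f'"
  shows "i \<in> Hom C A B" "f \<in> Hom C A A'" "i' \<in> Hom C A' B'" "f' \<in> Hom C B B'" "f' \<cdot>\<^bsub>C\<^esub> i = i' \<cdot>\<^bsub>C\<^esub> f"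
    and "\<lbrakk>x \<in> Hom C A' X; y \<in> Hom C B X; x \<cdot>\<^bsub>C\<^esub> f = y \<cdot>\<^bsub>C\<^esub> i\<rbrakk> \<Longrightarrow> \<exists>u \<in> Hom C B' X. u \<cdot>\<^bsub>C\<^esub> i' = x \<and> u \<cdot>\<^bsub>C\<^esub> f' = y"
    and "\<lbrakk>u \<in> Hom C B' X; v \<in> Hom C B' X; u \<cdot>\<^bsub>C\<^esub> i' = v \<cdot>\<^bsub>C\<^esub> i'; u \<cdot>\<^bsub>C\<^esub> f' = v \<cdot>\<^bsub>C\<^esub> f'\<rbrakk> \<Longrightarrow> u = v"
  using assms unfolding pushout_def by blast+

lemma pullbackD:
  assumes "pullback C A B A' B' i f i' f'"
  shows "i \<in> Hom C B A" "f \<in> Hom C A' A" "i' \<in> Hom C B' A'" "f' \<in> Hom C B' B" "i \<cdot>\<^bsub>C\<^esub> f' = f \<cdot>\<^bsub>C\<^esub> i'"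
    and "\<lbrakk>x \<in> Hom C X A'; y \<in> Hom C X B; f \<cdot>\<^bsub>C\<^esub> x = i \<cdot>\<^bsub>C\<^esub> y\<rbrakk> \<Longrightarrow> \<exists>u \<in> Hom C X B'. i' \<cdot>\<^bsub>C\<^esub> u = x \<and> f' \<cdot>\<^bsub>C\<^esub> u = y"
    and "\<lbrakk>u \<in> Hom C X B'; v \<in> Hom C X B'; i' \<cdot>\<^bsub>C\<^esub> u = i' \<cdot>\<^bsub>C\<^esub> v; f' \<cdot>\<^bsub>C\<^esub> u = f' \<cdot>\<^bsub>C\<^esub> v\<rbrakk> \<Longrightarrow> u = v"
  using assms unfolding pullback_def by blast+

lemma pushout_sym: "pushout C A B A' B' i f i' f' \<Longrightarrow> pushout C A A' B B' f i f' i'"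
  unfolding pushout_def by (elim conjE) (intro conjI; metis)

lemma pullback_sym: "pullback C A B A' B' i f i' f' \<Longrightarrow> pullback C A A' B B' f i f' i'"
  unfolding pushout_op[symmetric] by (rule pushout_sym)

lemma (in category) pushout_square_pushout:
  assumes "pushout_square C i f i' f'"
  shows "pushout C (Dom C i) (Cod C i) (Cod C f) (Cod C i') i f i' f'"
proof -
  have sq: "commutative_square C i f i' f'" and
    up: "\<And>x y. commutative_square C i f x y \<Longrightarrow>
      \<exists>!u. u \<in> Hom C (Cod C i') (Cod C x) \<and> u \<cdot> i' = x \<and> u \<cdot> f' = y"
    using assms unfolding pushout_square_def by blast+
  show ?thesis
    unfolding pushout_def
  proof (intro conjI allI ballI impI; (elim conjE)?)
    fix X x y assume "x \<in> Hom C (Cod C f) X" "y \<in> Hom C (Cod C i) X" "x \<cdot> f = y \<cdot> i"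
    then have "commutative_square C i f x y" "Cod C x = X" using sq by (auto simp: commutative_square_def Hom_def)
    from up[OF this(1)] this(2) show "\<exists>u\<in>Hom C (Cod C i') X. u \<cdot> i' = x \<and> u \<cdot> f' = y" by blast
  next
    fix X u v assume uv: "u \<in> Hom C (Cod C i') X" "v \<in> Hom C (Cod C i') X" "u \<cdot> i' = v \<cdot> i'"
      "u \<cdot> f' = v \<cdot> f'"
    have sq': "f \<in> Arr C" "i \<in> Arr C" "i' \<in> Arr C" "f' \<in> Arr C" "Dom C f = Dom C i" "Cod C f = Dom C i'"
      "Cod C i = Dom C f'" "Cod C f' = Cod C i'" "i' \<cdot> f = f' \<cdot> i"
      using sq by (auto simp: commutative_square_def)
    have "commutative_square C i f (u \<cdot> i') (u \<cdot> f')"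
      using sq' uv(1) unfolding commutative_square_def by (simp add: Hom_def)
    from up[OF this] uv show "u = v" using sq' by (auto simp: Hom_def)
  qed (use sq in \<open>auto simp: commutative_square_def Hom_def\<close>)
qed

context exact_category
begin

abbreviation cfl where "cfl \<equiv> conflation C conf"

lemma cflD:
  assumes "cfl A i B p D"
  shows "i \<in> Arr C" "Dom C i = A" "Cod C i = B" "p \<in> Arr C" "Dom C p = B" "Cod C p = D"
    "A \<in> Obj C" "B \<in> Obj C" "D \<in> Obj C" "i \<in> Hom C A B" "p \<in> Hom C B D" "(i, p) \<in> conf"
    "p \<cdot> i = null A D" "\<And>x. x \<in> Arr C \<Longrightarrow> Cod C x = A \<Longrightarrow> p \<cdot> (i \<cdot> x) = null (Dom C x) D"
proof -
  show *: "i \<in> Arr C" "Dom C i = A" "Cod C i = B" "p \<in> Arr C" "Dom C p = B" "Cod C p = D"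
    "i \<in> Hom C A B" "p \<in> Hom C B D" "(i, p) \<in> conf"
    using assms by (auto simp: conflation_def Hom_def)
  then show **: "A \<in> Obj C" "B \<in> Obj C" "D \<in> Obj C" using Dom_Cod_Obj by blast+
  show ***: "p \<cdot> i = null A D"
    using conf_kernel_cokernel[OF \<open>(i, p) \<in> conf\<close>] * by (simp add: is_kernel_def)
  show "p \<cdot> (i \<cdot> x) = null (Dom C x) D" if "x \<in> Arr C" "Cod C x = A" for x
    using comp_reassoc[OF ***, of x] * ** that by simp
qed

lemma cflI: "(i, p) \<in> conf \<Longrightarrow> \<exists>A B D. cfl A i B p D"
  using conf_kernel_cokernel[of i p] by (auto simp: is_kernel_def conflation_def Hom_def)

lemma cfl_kernel:
  assumes "cfl A i B p D" "g \<in> Arr C" "Cod C g = B" "p \<cdot> g = null (Dom C g) D"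
  shows "\<exists>!u. u \<in> Hom C (Dom C g) A \<and> i \<cdot> u = g"
proof -
  note h = cflD[OF assms(1)]
  have "\<forall>g \<in> Arr C. Cod C g = Dom C p \<and> p \<cdot> g = null (Dom C g) (Cod C p) \<longrightarrow>
        (\<exists>!u. u \<in> Hom C (Dom C g) (Dom C i) \<and> i \<cdot> u = g)"
    using conf_kernel_cokernel[OF h(12)] unfolding is_kernel_def by blast
  from this[rule_format, of g] show ?thesis using assms(2-) unfolding h(1-6) by blast
qed

lemma cfl_lift:
  assumes "cfl A i B p D" "g \<in> Hom C X B" "p \<cdot> g = null X D"
  shows "\<exists>u \<in> Hom C X A. i \<cdot> u = g"
proof -
  have "\<exists>!u. u \<in> Hom C (Dom C g) A \<and> i \<cdot> u = g"
    by (rule cfl_kernel[OF assms(1)]) (use assms(2,3) in \<open>simp_all add: Hom_def\<close>)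
  then show ?thesis using assms(2) by (auto simp: Hom_def)
qed

lemma cfl_mono:
  assumes "cfl A i B p D" "u \<in> Hom C X A" "v \<in> Hom C X A" "i \<cdot> u = i \<cdot> v"
  shows "u = v"
proof -
  note h = cflD[OF assms(1)]
  have d: "Dom C (i \<cdot> u) = X" using assms(2) h by (simp add: Hom_def)
  have "\<exists>!w. w \<in> Hom C (Dom C (i \<cdot> u)) A \<and> i \<cdot> w = i \<cdot> u"
    by (rule cfl_kernel[OF assms(1)]) (use assms(2) h in \<open>simp_all add: Hom_def\<close>)
  then show ?thesis using assms(2-4) unfolding d by metis
qed

text \<open>Some kernel of \<open>p\<close> forms a conflation with it; two kernels of
  \<open>p\<close> are isomorphic, and conflations are closed under isomorphism.\<close>

lemma conflation_of_kernel:
  assumes p: "adm_epi conf p" "p \<in> Hom C B D" and i: "i \<in> Hom C A B" "p \<cdot> i = null A D"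
    and lift: "\<And>X g. g \<in> Hom C X B \<Longrightarrow> p \<cdot> g = null X D \<Longrightarrow> \<exists>u \<in> Hom C X A. i \<cdot> u = g"
    and mono: "\<And>X u v. u \<in> Hom C X A \<Longrightarrow> v \<in> Hom C X A \<Longrightarrow> i \<cdot> u = i \<cdot> v \<Longrightarrow> u = v"
  shows "cfl A i B p D"
proof -
  obtain k where "(k, p) \<in> conf" using p by (auto simp: adm_epi_def)
  then obtain K where k: "cfl K k B p D" using cflI[of k p] p(2) by (auto simp: conflation_def Hom_def)
  note kD = cflD[OF k]
  obtain u where u: "u \<in> Hom C A K" "k \<cdot> u = i" using cfl_lift[OF k i] by blast
  obtain v where v: "v \<in> Hom C K A" "i \<cdot> v = k" using lift[OF kD(10,13)] by blast
  note U = u(1)[THEN HomD] and V = v(1)[THEN HomD]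
    and I = i(1)[THEN HomD]
  have "u \<cdot> v = Id C K"
    by (rule cfl_mono[OF k, of _ K]) (use U V kD I in \<open>simp_all add: Hom_def comp_reassoc[OF u(2)] v(2)\<close>)
  moreover have "v \<cdot> u = Id C A"
    by (rule mono[of _ A]) (use U V kD I Hom_objs[OF i(1)] in \<open>simp_all add: Hom_def comp_reassoc[OF v(2)] u(2)\<close>)
  ultimately have "iso_arr C v" using u v by (intro iso_arrI[of v K A u]) auto
  then have "(i, p) \<in> conf"
    using p(2) i(1) v kD
    by (intro conf_iso[OF \<open>(k, p) \<in> conf\<close>, of i p v "Id C B" "Id C D"])
      (auto simp: Hom_def intro: iso_arr_Id)
  then show ?thesis using p i by (simp add: conflation_def)
qed

text \<open>The cokernel versions, by instantiation at the opposite exact category; later duals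
  follow this pattern.\<close>

lemmas cfl_desc = exact_category.cfl_lift[OF exact_category_op, unfolded conflation_op op_cat_simps]
lemmas cfl_epi = exact_category.cfl_mono[OF exact_category_op, unfolded conflation_op op_cat_simps]
lemmas conflation_of_cokernel =
  exact_category.conflation_of_kernel[OF exact_category_op, unfolded conflation_op op_cat_simps adm_op]

text \<open>The cokernel \<open>p\<close> of the identity is zero and epic, so its codomain is a
  zero object, which may be exchanged for \<open>Z\<close>.\<close>

lemma conflation_Id:
  assumes "X \<in> Obj C" "zero_object C Z"
  shows "cfl X (Id C X) X (null X Z) Z"
proof -
  obtain p where "(Id C X, p) \<in> conf" using Id_adm_mono[OF assms(1)] by (auto simp: adm_mono_def)
  then obtain D where p: "cfl X (Id C X) X p D"
    using cflI[of "Id C X" p] assms(1) by (auto simp: conflation_def Hom_def)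
  note pD = cflD[OF p]
  have p0: "p = null X D" using pD by simp
  have Z: "Z \<in> Obj C" "Id C Z = null Z Z" using assms zero_Id by (auto simp: zero_object_def)
  have "Id C D = null D D"
    by (rule cfl_epi[OF p, of _ D]) (use p0 pD in \<open>simp_all add: Hom_def\<close>)
  then have "iso_arr C (null D Z)"
    using pD Z by (intro iso_arrI[of _ D Z "null Z D"]) (auto simp: Hom_def)
  then have "(Id C X, null X Z) \<in> conf"
    using pD Z p0 by (intro conf_iso[OF pD(12), of _ _ "Id C X" "Id C X" "null D Z"])
       (auto simp: Hom_def intro: iso_arr_Id)
  then show ?thesis using assms Z by (simp add: conflation_def Hom_def)
qed

lemmas conflation_Id' = exact_category.conflation_Id[OF exact_category_op, unfolded conflation_op op_cat_simps zero_object_op]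

lemma coker_iso:
  assumes "cfl A i B p D" "cfl A i B p' D'"
  shows "\<exists>t \<in> Hom C D D'. iso_arr C t \<and> t \<cdot> p = p'"
proof -
  note h = cflD[OF assms(1)] and h' = cflD[OF assms(2)]
  obtain t where t: "t \<in> Hom C D D'" "t \<cdot> p = p'" using cfl_desc[OF assms(1) h'(11,13)] by blast
  obtain s where s: "s \<in> Hom C D' D" "s \<cdot> p' = p" using cfl_desc[OF assms(2) h(11,13)] by blast
  have "s \<cdot> t = Id C D"
    by (rule cfl_epi[OF assms(1), of _ D]) (use s t h in \<open>simp_all add: Hom_def\<close>)
  moreover have "t \<cdot> s = Id C D'"
    by (rule cfl_epi[OF assms(2), of _ D']) (use s t h' in \<open>simp_all add: Hom_def\<close>)
  ultimately show ?thesis using s t iso_arrI by blast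
qed

lemma adm_mono_iso:
  assumes "adm_mono conf i" "i \<in> Hom C A B" "t \<in> Hom C B B'" "iso_arr C t"
  shows "adm_mono conf (t \<cdot> i)"
proof -
  obtain p where "(i, p) \<in> conf" using assms by (auto simp: adm_mono_def)
  then obtain D where p: "cfl A i B p D" using cflI[of i p] assms(2) by (auto simp: conflation_def Hom_def)
  obtain s where s: "s \<in> Hom C B' B" "s \<cdot> t = Id C B" using iso_arrE assms(3,4) by blast
  note h = cflD[OF p]
  have "(t \<cdot> i, p \<cdot> s) \<in> conf"
    using s assms(3,4) h
    by (intro conf_iso[OF h(12), of _ _ "Id C A" t "Id C D"]) (auto simp: Hom_def intro: iso_arr_Id)
  then show ?thesis by (auto simp: adm_mono_def)
qed

lemma pushout_iso:
  assumes "pushout C A B A' B1 i f i1 f1" "pushout C A B A' B2 i f i2 f2"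
  shows "\<exists>t \<in> Hom C B1 B2. iso_arr C t \<and> t \<cdot> i1 = i2 \<and> t \<cdot> f1 = f2"
proof -
  note 1 = pushoutD[OF assms(1)] and 2 = pushoutD[OF assms(2)]
  obtain t where t: "t \<in> Hom C B1 B2" "t \<cdot> i1 = i2" "t \<cdot> f1 = f2" using 1(6)[OF 2(3,4) 2(5)[symmetric]] by blast
  obtain s where s: "s \<in> Hom C B2 B1" "s \<cdot> i2 = i1" "s \<cdot> f2 = f1" using 2(6)[OF 1(3,4) 1(5)[symmetric]] by blast
  note o = Hom_objs[OF 1(4)] Hom_objs[OF 2(4)]
  have "s \<cdot> t = Id C B1"
    by (rule 1(7)[of _ B1]) (use s t 1(3,4) o in \<open>simp_all add: Hom_def\<close>)
  moreover have "t \<cdot> s = Id C B2"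
    by (rule 2(7)[of _ B2]) (use s t 2(3,4) o in \<open>simp_all add: Hom_def\<close>)
  ultimately show ?thesis using s t iso_arrI by blast
qed

text \<open>The axiom supplies one pushout with \<open>i'\<close> an inflation, and any other is
  isomorphic to it. The cokernel does not change: \<open>p'\<close> is zero on \<open>A'\<close> and
  \<open>p\<close> on \<open>B\<close>, and a map killing \<open>i'\<close> is determined by its
  restriction to \<open>B\<close>, which factors through \<open>p\<close>.\<close>

lemma pushout_conflation:
  assumes c: "cfl A i B p D" and po: "pushout C A B A' B' i f i' f'"
  shows "\<exists>p'. cfl A' i' B' p' D \<and> p' \<cdot> f' = p"
proof -
  note P = pushoutD[OF po] and h = cflD[OF c]
  have am: "adm_mono conf i" using h by (auto simp: adm_mono_def)
  obtain i2 f2 where i2: "pushout_square C i f i2 f2" "adm_mono conf i2"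
    using pushout_adm_mono[OF am, of f] P(2) h by (auto simp: Hom_def)
  have po2: "pushout C A B A' (Cod C i2) i f i2 f2"
    using pushout_square_pushout[OF i2(1)] h P(2) by (simp add: Hom_def)
  obtain t where t: "t \<in> Hom C (Cod C i2) B'" "iso_arr C t" "t \<cdot> i2 = i'" using pushout_iso[OF po2 po] by blast
  have am': "adm_mono conf i'" using adm_mono_iso[OF i2(2) pushoutD(3)[OF po2] t(1,2)] t(3) by simp
  note o = Hom_objs[OF P(2)]
  obtain p' where p': "p' \<in> Hom C B' D" "p' \<cdot> i' = null A' D" "p' \<cdot> f' = p"
    using P(6)[of "null A' D" D p] h o P(2) by (auto simp: Hom_def)
  have "cfl A' i' B' p' D"
  proof (rule conflation_of_cokernel[OF am' P(3) p'(1,2)])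
    fix X g assume g: "g \<in> Hom C B' X" "g \<cdot> i' = null A' X"
    have "(g \<cdot> f') \<cdot> i = (g \<cdot> i') \<cdot> f" using g(1) P(1-5) by (simp add: Hom_def)
    then have "(g \<cdot> f') \<cdot> i = null A X" using g P(2) Hom_objs[OF g(1)] by (simp add: Hom_def)
    then obtain u where u: "u \<in> Hom C D X" "u \<cdot> p = g \<cdot> f'" using cfl_desc[OF c comp_Hom[OF P(4) g(1)]] by blast
    have "u \<cdot> p' = g"
      by (rule P(7)[of _ X]) (use u g p' P(3,4) h Hom_objs[OF g(1)] Hom_objs[OF P(3)] in \<open>simp_all add: Hom_def\<close>)
    then show "\<exists>u\<in>Hom C D X. u \<cdot> p' = g" using u by blast
  next
    fix X u v assume uv: "u \<in> Hom C D X" "v \<in> Hom C D X" "u \<cdot> p' = v \<cdot> p'"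
    then have "(u \<cdot> p') \<cdot> f' = (v \<cdot> p') \<cdot> f'" by simp
    then have "u \<cdot> p = v \<cdot> p" using uv(1,2) p' P(4) by (simp add: Hom_def)
    then show "u = v" using cfl_epi[OF c uv(1,2)] by blast
  qed
  with p' show ?thesis by blast
qed

lemma ex_pushout:
  assumes c: "cfl A i B p D" and f: "f \<in> Hom C A A'"
  shows "\<exists>B' i' f' p'. cfl A' i' B' p' D \<and> pushout C A B A' B' i f i' f' \<and> p' \<cdot> f' = p"
proof -
  note h = cflD[OF c]
  have am: "adm_mono conf i" using h by (auto simp: adm_mono_def)
  obtain i2 f2 where i2: "pushout_square C i f i2 f2" "adm_mono conf i2"
    using pushout_adm_mono[OF am, of f] f h by (auto simp: Hom_def)
  have po2: "pushout C A B A' (Cod C i2) i f i2 f2"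
    using pushout_square_pushout[OF i2(1)] h f by (simp add: Hom_def)
  from pushout_conflation[OF c this] this show ?thesis by blast
qed

text \<open>The biproduct is the pushout of \<open>0 \<rightarrow> B\<close> along
  \<open>0 \<rightarrow> A\<close>, so the conflation
  \<open>0 \<rightarrow> B \<rightarrow> B\<close> pushes out to the required one.\<close>

lemma biproduct_conflation:
  assumes "is_biproduct C add null A B P i j p q"
  shows "cfl A i P q B"
proof -
  obtain Z where Z: "zero_object C Z" using ex_zero_object by blast
  have ZO: "Z \<in> Obj C" using Z by (simp add: zero_object_def)
  have b: "i \<in> Hom C A P" "j \<in> Hom C B P" "p \<in> Hom C P A" "q \<in> Hom C P B" "p \<cdot> i = Id C A" "q \<cdot> j = Id C B"
    "p \<cdot> j = null B A" "q \<cdot> i = null A B" "add (i \<cdot> p) (j \<cdot> q) = Id C P"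
    using assms by (auto simp: is_biproduct_def)
  note o = Hom_objs[OF b(1)] Hom_objs[OF b(2)]
  have H: "i \<in> Arr C" "Dom C i = A" "Cod C i = P" "j \<in> Arr C" "Dom C j = B" "Cod C j = P"
     "p \<in> Arr C" "Dom C p = P" "Cod C p = A" "q \<in> Arr C" "Dom C q = P" "Cod C q = B"
    using b(1-4) by (auto simp: Hom_def)
  have dec: "u = add ((u \<cdot> i) \<cdot> p) ((u \<cdot> j) \<cdot> q)" if "u \<in> Hom C P X" for u X
    using that b(9) H o comp_add(2)[of "i \<cdot> p" "j \<cdot> q" u] by (simp add: Hom_def)
  have po: "pushout C Z B A P (null Z B) (null Z A) i j"
    unfolding pushout_def
  proof (intro conjI allI ballI impI; (elim conjE)?)
    fix X x y assume x: "x \<in> Hom C A X" and y: "y \<in> Hom C B X"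
    show "\<exists>u\<in>Hom C P X. u \<cdot> i = x \<and> u \<cdot> j = y"
      by (rule bexI[of _ "add (x \<cdot> p) (y \<cdot> q)"]) (use x y H b(5-8) o Hom_objs[OF x] in \<open>simp_all add: Hom_def\<close>)
  next
    fix X u v assume uv: "u \<in> Hom C P X" "v \<in> Hom C P X" "u \<cdot> i = v \<cdot> i" "u \<cdot> j = v \<cdot> j"
    show "u = v" using dec[OF uv(1)] dec[OF uv(2)] uv(3,4) by simp
  qed (use H ZO o in \<open>simp_all add: Hom_def\<close>)
  obtain p' where p': "cfl A i P p' B" "p' \<cdot> j = Id C B"
    using pushout_conflation[OF conflation_Id'[OF o(3) Z] po] by blast
  have "p' = q" using dec[OF cflD(11)[OF p'(1)]] cflD(13)[OF p'(1)] p'(2) H o by simp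
  with p' show ?thesis by simp
qed

lemma biproduct_conflation':
  assumes "is_biproduct C add null A B P i j p q"
  shows "cfl B j P p A"
proof (rule biproduct_conflation)
  show "is_biproduct C add null B A P j i q p"
    using assms by (auto simp: is_biproduct_def Hom_def add_commute)
qed

lemmas pullback_conflation = exact_category.pushout_conflation[OF exact_category_op, unfolded conflation_op op_cat_simps pushout_op]
lemmas ex_pullback = exact_category.ex_pushout[OF exact_category_op, unfolded conflation_op op_cat_simps pushout_op]

lemma biproductE:
  assumes "A \<in> Obj C" "B \<in> Obj C"
  obtains P i j p q where "is_biproduct C add null A B P i j p q" "cfl A i P q B" "cfl B j P p A"
    "i \<in> Hom C A P" "j \<in> Hom C B P" "p \<in> Hom C P A" "q \<in> Hom C P B" "p \<cdot> i = Id C A" "q \<cdot> j = Id C B"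
    "p \<cdot> j = null B A" "q \<cdot> i = null A B" "add (i \<cdot> p) (j \<cdot> q) = Id C P"
proof -
  obtain P i j p q where "is_biproduct C add null A B P i j p q" using ex_biproduct[OF assms] by blast
  with biproduct_conflation[OF this] biproduct_conflation'[OF this] that show thesis
    by (auto simp: is_biproduct_def)
qed

end


section \<open>Trivial objects and weak equivalences\<close>

text \<open>\<open>cofibrant_obj C weq M\<close> says that \<open>0 \<rightarrow> M\<close> is a
  weak equivalence, that is, \<open>M\<close> is trivial. The definition stands outside the locale
  so that it can be instantiated at \<open>op_cat C\<close>.\<close>

definition phantom where
  "phantom C weq h \<longleftrightarrow> h \<in> Arr C \<and> (\<exists>M x y. cofibrant_obj C weq M \<and> x \<in> Hom C (Dom C h) M \<and>
     y \<in> Hom C M (Cod C h) \<and> h = y \<cdot>\<^bsub>C\<^esub> x)"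

text \<open>Congruence modulo phantom maps, stated without subtraction so that it does not refer to
  the locale constant \<open>neg\<close>.\<close>

definition heq where
  "heq C add weq f g \<longleftrightarrow> g \<in> Arr C \<and> (\<exists>h \<in> Hom C (Dom C g) (Cod C g). phantom C weq h \<and> f = add g h)"

context exact_model_structure
begin

abbreviation triv where "triv \<equiv> cofibrant_obj C weq"
abbreviation cofb where "cofb \<equiv> cofibrant_obj C cof"
abbreviation fibr where "fibr \<equiv> fibrant_obj C fib"
abbreviation tcof where "tcof \<equiv> cofibrant_obj C (cof \<inter> weq)"
abbreviation tfib where "tfib \<equiv> fibrant_obj C (fib \<inter> weq)"
abbreviation phan where "phan \<equiv> phantom C weq"
abbreviation heqv (infix "\<sim>" 50) where "f \<sim> g \<equiv> heq C add weq f g"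

text \<open>The axioms do not list identities among the weak equivalences. Factoring the identity as
  \<open>p \<cdot> i\<close> exhibits it as a retract of the weak equivalence
  \<open>i\<close>.\<close>

lemma weq_Id:
  assumes "A \<in> Obj C"
  shows "Id C A \<in> weq"
proof -
  obtain i p where ip: "i \<in> cof \<inter> weq" "p \<in> fib" "Cod C i = Dom C p" "Id C A = p \<cdot> i"
    using factor_trivial_cof[of "Id C A"] assms by auto
  have a: "i \<in> Arr C" "p \<in> Arr C" using ip cof_Arr fib_Arr by auto
  have d: "Dom C i = A" "Cod C p = A"
    using arg_cong[OF ip(4), of "Dom C"] arg_cong[OF ip(4), of "Cod C"] a ip(3) assms by simp_all
  have "retract_of C (Id C A) i"
    unfolding retract_of_def using assms a d ip(3)
    by (intro conjI bexI[of _ "Id C A"] bexI[of _ "i"] bexI[of _ p]) (simp_all add: Hom_def ip(4)[symmetric])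
  then show ?thesis using weq_retract ip by blast
qed

text \<open>An isomorphism is a retract of the identity of its domain.\<close>

lemma iso_weq:
  assumes "iso_arr C f"
  shows "f \<in> weq"
proof -
  have f: "f \<in> Hom C (Dom C f) (Cod C f)" using assms by (simp add: iso_arr_def Hom_def)
  obtain g where g: "g \<in> Hom C (Cod C f) (Dom C f)" "g \<cdot> f = Id C (Dom C f)" "f \<cdot> g = Id C (Cod C f)"
    using iso_arrE[OF assms f] by blast
  note o = Hom_objs[OF f]
  have "retract_of C f (Id C (Dom C f))"
    unfolding retract_of_def using f g o
    by (intro conjI bexI[of _ "Id C (Dom C f)"] bexI[of _ g] bexI[of _ f]) (simp_all add: Hom_def)
  then show ?thesis using weq_retract weq_Id o by blast
qed

lemma triv_Obj: "triv X \<Longrightarrow> X \<in> Obj C"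
  using Hom_objs by (auto simp: cofibrant_obj_def)

lemma zero_ObjD: "zero_object C Z \<Longrightarrow> Z \<in> Obj C"
  by (simp add: zero_object_def)

lemma triv_weq_from_zero:
  assumes "triv X" "zero_object C Z"
  shows "null Z X \<in> weq"
proof -
  obtain Z' f where Z': "zero_object C Z'" "f \<in> Hom C Z' X" "f \<in> weq"
    using assms(1) by (auto simp: cofibrant_obj_def)
  note o = zero_ObjD[OF Z'(1)] zero_ObjD[OF assms(2)] triv_Obj[OF assms(1)]
  have "iso_arr C (null Z Z')"
    using o zero_Id[OF Z'(1)] zero_Id[OF assms(2)] by (intro iso_arrI[of _ Z Z' "null Z' Z"]) (simp_all add: Hom_def)
  then have "null Z Z' \<in> weq" by (rule iso_weq)
  then have "f \<cdot> null Z Z' \<in> weq" using Z' o by (intro weq_Comp) (simp_all add: Hom_def)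
  then show ?thesis using Z'(2) o by (simp add: Hom_def)
qed

lemma triv_weq_to_zero:
  assumes "triv X" "zero_object C Z"
  shows "null X Z \<in> weq"
proof (rule weq_cancel_right[OF triv_weq_from_zero[OF assms]])
  note o = zero_ObjD[OF assms(2)] triv_Obj[OF assms(1)]
  have "null Z Z \<in> weq" using weq_Id[OF o(1)] zero_Id[OF assms(2)] by simp
  then show "null X Z \<cdot> null Z X \<in> weq" "null X Z \<in> Arr C" "Cod C (null Z X) = Dom C (null X Z)"
    using o by simp_all
qed

lemma trivI: "zero_object C Z \<Longrightarrow> X \<in> Obj C \<Longrightarrow> null Z X \<in> weq \<Longrightarrow> triv X"
  unfolding cofibrant_obj_def by (rule exI[of _ Z], rule exI[of _ "null Z X"]) (simp add: Hom_def zero_ObjD)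

lemma trivI':
  assumes "zero_object C Z" "X \<in> Obj C" "null X Z \<in> weq"
  shows "triv X"
proof (rule trivI[OF assms(1,2)], rule weq_cancel_left[OF _ assms(3)])
  note o = zero_ObjD[OF assms(1)] assms(2)
  have "null Z Z \<in> weq" using weq_Id[OF o(1)] zero_Id[OF assms(1)] by simp
  then show "null X Z \<cdot> null Z X \<in> weq" "null Z X \<in> Arr C" "Cod C (null Z X) = Dom C (null X Z)"
    using o by simp_all
qed

text \<open>Both maps between \<open>X\<close> and a zero object compose to an identity, so
  two-out-of-three applies. This makes triviality, and with it \<open>phantom\<close> and
  \<open>heq\<close>, self-dual.\<close>

lemma triv_fibrant: "fibrant_obj C weq X \<longleftrightarrow> triv X"
proof
  assume "fibrant_obj C weq X"
  then obtain Z f where Z: "zero_object C Z" "f \<in> Hom C X Z" "f \<in> weq" by (auto simp: fibrant_obj_def)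
  then have "f = null X Z" using zero_arr[OF Z(1), of f] by (simp add: Hom_def)
  then show "triv X" using trivI'[OF Z(1)] Z Hom_objs by blast
next
  assume X: "triv X"
  obtain Z where Z: "zero_object C Z" using ex_zero_object by blast
  then show "fibrant_obj C weq X"
    unfolding fibrant_obj_def using triv_weq_to_zero[OF X Z] zero_ObjD[OF Z] triv_Obj[OF X]
    by (intro exI[of _ Z] exI[of _ "null X Z"]) (simp add: Hom_def)
qed

lemma phantom_op: "phantom (op_cat C) weq h \<longleftrightarrow> phan h"
  unfolding phantom_def op_cat_simps cofibrant_obj_op triv_fibrant by blast

lemma heq_op: "heq (op_cat C) add weq f g \<longleftrightarrow> f \<sim> g"
  unfolding heq_def op_cat_simps phantom_op by (rule HOL.refl)

lemma weq_triv:
  assumes "w \<in> weq" "w \<in> Hom C X Y"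
  shows "triv X \<longleftrightarrow> triv Y"
proof -
  obtain Z where Z: "zero_object C Z" using ex_zero_object by blast
  note o = zero_ObjD[OF Z] Hom_objs[OF assms(2)]
  have *: "w \<cdot> null Z X = null Z Y" using assms o by (simp add: Hom_def)
  show ?thesis
  proof
    assume "triv X"
    then have "w \<cdot> null Z X \<in> weq" using assms o triv_weq_from_zero[OF _ Z] by (intro weq_Comp) (simp_all add: Hom_def)
    then show "triv Y" using trivI[OF Z] o unfolding * by blast
  next
    assume "triv Y"
    then have "w \<cdot> null Z X \<in> weq" unfolding * using triv_weq_from_zero[OF _ Z] by blast
    then have "null Z X \<in> weq" by (rule weq_cancel_left[rotated 3]) (use assms o in \<open>simp_all add: Hom_def\<close>)
    then show "triv X" using trivI[OF Z] o by blast
  qed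
qed

lemma tcof_iff: "tcof X \<longleftrightarrow> cofb X \<and> triv X"
proof
  assume *: "cofb X \<and> triv X"
  then obtain Z f where Z: "zero_object C Z" "f \<in> Hom C Z X" "f \<in> cof" by (auto simp: cofibrant_obj_def)
  then have "f = null Z X" using zero_arr[OF Z(1), of f] by (simp add: Hom_def)
  then have "f \<in> weq" using triv_weq_from_zero * Z by blast
  with Z show "tcof X" by (auto simp: cofibrant_obj_def)
qed (auto simp: cofibrant_obj_def)

lemmas tfib_iff = exact_model_structure.tcof_iff[OF exact_model_structure_op, unfolded cofibrant_obj_op triv_fibrant]

section \<open>Cofibrations as conflations, lifting, and replacements\<close>

lemma cofI: "cfl A i B p D \<Longrightarrow> cofb D \<Longrightarrow> i \<in> cof"
  using cof_iff[of i] cflD[of A i B p D] by blast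

lemma cof_weqI: "cfl A i B p D \<Longrightarrow> tcof D \<Longrightarrow> i \<in> cof \<inter> weq"
  using trivial_cof_iff[of i] cflD[of A i B p D] by blast

lemma cofE:
  assumes "i \<in> cof" "i \<in> Hom C A B"
  obtains p D where "cfl A i B p D" "cofb D"
proof -
  obtain p where p: "(i, p) \<in> conf" "cofb (Cod C p)" using cof_iff[of i] assms by blast
  with cflI[OF p(1)] assms(2) that show thesis by (auto simp: conflation_def Hom_def)
qed

lemma cof_weqE:
  assumes "i \<in> cof \<inter> weq" "i \<in> Hom C A B"
  obtains p D where "cfl A i B p D" "tcof D"
proof -
  obtain p where p: "(i, p) \<in> conf" "tcof (Cod C p)" using trivial_cof_iff[of i] assms by blast
  with cflI[OF p(1)] assms(2) that show thesis by (auto simp: conflation_def Hom_def)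
qed

lemmas fib_weqI = exact_model_structure.cof_weqI[OF exact_model_structure_op, unfolded conflation_op cofibrant_obj_op]
lemmas fibE = exact_model_structure.cofE[OF exact_model_structure_op, unfolded conflation_op cofibrant_obj_op op_cat_simps]
lemmas fib_weqE = exact_model_structure.cof_weqE[OF exact_model_structure_op, unfolded conflation_op cofibrant_obj_op op_cat_simps]

text \<open>Lift \<open>0 \<rightarrow> X\<close> against \<open>w\<close>.\<close>

lemma cofb_lift:
  assumes "cofb X" "w \<in> fib \<inter> weq" "w \<in> Hom C T Y" "f \<in> Hom C X Y"
  shows "\<exists>g \<in> Hom C X T. w \<cdot> g = f"
proof -
  obtain Z f0 where Z: "zero_object C Z" "f0 \<in> Hom C Z X" "f0 \<in> cof" using assms(1) by (auto simp: cofibrant_obj_def)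
  have f0: "f0 = null Z X" using zero_arr[OF Z(1), of f0] Z by (simp add: Hom_def)
  note o = zero_ObjD[OF Z(1)] Hom_objs[OF assms(3)] Hom_objs[OF assms(4)]
  have "\<exists>l\<in>Hom C (Cod C f0) (Dom C w). l \<cdot> f0 = null Z T \<and> w \<cdot> l = f"
    using assms Z o by (intro lifting) (simp_all add: Hom_def f0)
  then show ?thesis using Z assms by (auto simp: Hom_def)
qed

text \<open>Cofibrancy of \<open>D\<close> makes \<open>i\<close> a cofibration, and
  \<open>J \<rightarrow> 0\<close> is a trivial fibration; the extension is the lift between the
  two.\<close>

lemma tfib_extend:
  assumes c: "cfl A i B p D" "cofb D" and J: "tfib J" and x: "x \<in> Hom C A J"
  shows "\<exists>y \<in> Hom C B J. y \<cdot> i = x"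
proof -
  obtain Z f0 where Z: "zero_object C Z" "f0 \<in> Hom C J Z" "f0 \<in> fib \<inter> weq" using J by (auto simp: fibrant_obj_def)
  have f0: "f0 = null J Z" using zero_arr[OF Z(1), of f0] Z by (simp add: Hom_def)
  note o = zero_ObjD[OF Z(1)] Hom_objs[OF x] and h = cflD[OF c(1)]
  have "\<exists>l\<in>Hom C (Cod C i) (Dom C f0). l \<cdot> i = x \<and> f0 \<cdot> l = null B Z"
    using Z cofI[OF c] x h o by (intro lifting) (simp_all add: Hom_def f0)
  then show ?thesis using Z h o by (auto simp: Hom_def f0)
qed

lemmas tcof_lift = exact_model_structure.tfib_extend[OF exact_model_structure_op,
  unfolded conflation_op cofibrant_obj_op fibrant_obj_op op_cat_simps]

text \<open>Factor \<open>X \<rightarrow> 0\<close> into a cofibration and a trivial fibration.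
  These conflations will define the suspension.\<close>

lemma ex_trivial_extension:
  assumes "X \<in> Obj C"
  shows "\<exists>a I b S. cfl X a I b S \<and> tfib I \<and> cofb S"
proof -
  obtain Z where Z: "zero_object C Z" using ex_zero_object by blast
  note o = zero_ObjD[OF Z] assms
  obtain i p where ip: "i \<in> cof" "p \<in> fib \<inter> weq" "Cod C i = Dom C p" "null X Z = p \<cdot> i"
    using factor_trivial_fib[of "null X Z"] o by auto
  have a: "i \<in> Arr C" "p \<in> Arr C" using ip cof_Arr fib_Arr by auto
  have d: "Dom C i = X" "Cod C p = Z"
    using arg_cong[OF ip(4), of "Dom C"] arg_cong[OF ip(4), of "Cod C"] a ip(3) o by simp_all
  obtain b S where "cfl X i (Cod C i) b S" "cofb S" using cofE[OF ip(1), of X "Cod C i"] a d by (auto simp: Hom_def)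
  moreover have "tfib (Cod C i)" unfolding fibrant_obj_def using Z ip a d by (auto simp: Hom_def)
  ultimately show ?thesis by blast
qed

lemma ex_cofibrant_replacement:
  assumes "X \<in> Obj C"
  shows "\<exists>X' w. w \<in> fib \<inter> weq \<and> w \<in> Hom C X' X \<and> cofb X'"
proof -
  obtain Z where Z: "zero_object C Z" using ex_zero_object by blast
  note o = zero_ObjD[OF Z] assms
  obtain i p where ip: "i \<in> cof" "p \<in> fib \<inter> weq" "Cod C i = Dom C p" "null Z X = p \<cdot> i"
    using factor_trivial_fib[of "null Z X"] o by auto
  have a: "i \<in> Arr C" "p \<in> Arr C" using ip cof_Arr fib_Arr by auto
  have d: "Dom C i = Z" "Cod C p = X"
    using arg_cong[OF ip(4), of "Dom C"] arg_cong[OF ip(4), of "Cod C"] a ip(3) o by simp_all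
  have "cofb (Cod C i)" unfolding cofibrant_obj_def using Z ip a d by (auto simp: Hom_def)
  then show ?thesis using ip a d by (auto simp: Hom_def)
qed

lemmas ex_trivial_cover = exact_model_structure.ex_trivial_extension[OF exact_model_structure_op,
  unfolded conflation_op cofibrant_obj_op fibrant_obj_op op_cat_simps]
lemmas ex_fibrant_replacement = exact_model_structure.ex_cofibrant_replacement[OF exact_model_structure_op,
  unfolded cofibrant_obj_op op_cat_simps]

text \<open>Pulling back along a cofibrant replacement of the cokernel turns an arbitrary inflation into
  a cofibration without changing it up to trivial fibrations.\<close>

lemma adm_mono_weq_iff:
  assumes c: "cfl A i B p D"
  shows "i \<in> weq \<longleftrightarrow> triv D"
proof -
  note h = cflD[OF c]
  obtain P w where w: "w \<in> fib \<inter> weq" "w \<in> Hom C P D" "cofb P" using ex_cofibrant_replacement[OF h(9)] by blast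
  obtain k K where k: "cfl K k P w D" "tfib K" using fib_weqE[OF w(1,2)] by blast
  obtain U p' w' i' where pb: "pullback C D B P U p w p' w'" "cfl A i' U p' P" "w' \<cdot> i' = i"
    using ex_pullback[OF c w(2)] by blast
  obtain k' where k': "cfl K k' U w' B" using pullback_conflation[OF k(1) pullback_sym[OF pb(1)]] by blast
  have w': "w' \<in> fib \<inter> weq" using fib_weqI[OF k' k(2)] .
  have tP: "triv P \<longleftrightarrow> triv D" using weq_triv[of w] w by blast
  note hk' = cflD[OF k'] and hp = cflD[OF pb(2)]
  show ?thesis
  proof
    assume "triv D"
    then have "i' \<in> cof \<inter> weq" using tP cof_weqI[OF pb(2)] tcof_iff w by blast
    then have "w' \<cdot> i' \<in> weq" using w' hk' hp by (intro weq_Comp) simp_all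
    then show "i \<in> weq" using pb by simp
  next
    assume "i \<in> weq"
    then have "w' \<cdot> i' \<in> weq" using pb by simp
    then have "i' \<in> weq" by (rule weq_cancel_left[rotated 3]) (use hk' hp w' in simp_all)
    \<comment> \<open>As the cokernel \<open>P\<close> is cofibrant, \<open>i'\<close> is a
      cofibration, now also a weak equivalence. A trivial cofibration has a trivially cofibrant
      cokernel, and cokernels are isomorphic.\<close>
    then have "i' \<in> cof \<inter> weq" using cofI[OF pb(2) w(3)] by blast
    then obtain p2 D2 where p2: "cfl A i' U p2 D2" "tcof D2" using cof_weqE[OF _ hp(10)] by blast
    obtain t where t: "t \<in> Hom C D2 P" "iso_arr C t" using coker_iso[OF p2(1) pb(2)] by blast
    show "triv D" using weq_triv[OF iso_weq[OF t(2)] t(1)] p2 tcof_iff tP by blast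
  qed
qed

lemmas adm_epi_weq_iff = exact_model_structure.adm_mono_weq_iff[OF exact_model_structure_op,
  unfolded conflation_op cofibrant_obj_op triv_fibrant]

text \<open>If \<open>A\<close> is trivial then \<open>p\<close> is a weak equivalence, if
  \<open>D\<close> is trivial then \<open>i\<close> is one; and a weak equivalence has a trivial
  domain exactly if it has a trivial codomain.\<close>

lemma triv_two_of_three:
  assumes "cfl A i B p D"
  shows "triv A \<Longrightarrow> triv B \<longleftrightarrow> triv D" "triv D \<Longrightarrow> triv A \<longleftrightarrow> triv B"
  using adm_mono_weq_iff[OF assms] adm_epi_weq_iff[OF assms] weq_triv[OF _ cflD(10)[OF assms]]
    weq_triv[OF _ cflD(11)[OF assms]] by blast+


section \<open>Morphisms modulo trivial objects\<close>

lemma phanI: "triv M \<Longrightarrow> x \<in> Hom C A M \<Longrightarrow> y \<in> Hom C M B \<Longrightarrow> phan (y \<cdot> x)"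
  unfolding phantom_def by (intro conjI exI[of _ M] exI[of _ x] exI[of _ y]) (simp_all add: Hom_def)

lemma phanE:
  assumes "phan h" "h \<in> Hom C A B"
  obtains M x y where "triv M" "x \<in> Hom C A M" "y \<in> Hom C M B" "h = y \<cdot> x"
  using assms by (auto simp: phantom_def Hom_def)

lemma phan_Arr: "phan h \<Longrightarrow> h \<in> Arr C"
  by (simp add: phantom_def)

lemma phan_comp_left:
  assumes "phan h" "h \<in> Hom C A B" "g \<in> Hom C B D"
  shows "phan (g \<cdot> h)"
proof -
  obtain M x y where *: "triv M" "x \<in> Hom C A M" "y \<in> Hom C M B" "h = y \<cdot> x"
    using phanE[OF assms(1,2)] .
  have "g \<cdot> h = (g \<cdot> y) \<cdot> x" unfolding *(4) using *(2,3) assms(3) by (simp add: Hom_def)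
  then show ?thesis using phanI[OF *(1,2) comp_Hom[OF *(3) assms(3)]] by simp
qed

lemmas phan_comp_right = exact_model_structure.phan_comp_left[OF exact_model_structure_op,
  unfolded phantom_op op_cat_simps]

lemma triv_zero: "zero_object C Z \<Longrightarrow> triv Z"
  using trivI[of Z Z] weq_Id[of Z] zero_Id[of Z] zero_ObjD[of Z] by simp

lemma phan_null: "A \<in> Obj C \<Longrightarrow> B \<in> Obj C \<Longrightarrow> phan (null A B)"
proof -
  assume o: "A \<in> Obj C" "B \<in> Obj C"
  obtain Z where Z: "zero_object C Z" using ex_zero_object by blast
  show ?thesis using phanI[OF triv_zero[OF Z], of "null A Z" A "null Z B" B] o zero_ObjD[OF Z] by (simp add: Hom_def)
qed

lemma phan_neg:
  assumes "phan h"
  shows "phan (neg h)"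
  using phan_comp_left[OF assms, of "Dom C h" "Cod C h" "neg (Id C (Cod C h))" "Cod C h"] phan_Arr[OF assms]
  by (simp add: Hom_def)

lemma triv_biproduct:
  assumes "cfl A i P q B" "triv A" "triv B"
  shows "triv P"
  using triv_two_of_three[OF assms(1)] assms by blast

text \<open>The sum factors through the biproduct of the two trivial objects, which is an extension
  of one by the other and hence trivial.\<close>

lemma phan_add:
  assumes "phan h" "phan h'" "Dom C h = Dom C h'" "Cod C h = Cod C h'"
  shows "phan (add h h')"
proof -
  let ?A = "Dom C h'" and ?B = "Cod C h'"
  have hh: "h \<in> Hom C ?A ?B" "h' \<in> Hom C ?A ?B" using assms phan_Arr by (auto simp: Hom_def)
  obtain M x y where 1: "triv M" "x \<in> Hom C ?A M" "y \<in> Hom C M ?B" "h = y \<cdot> x" using phanE[OF assms(1) hh(1)] .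
  obtain M' x' y' where 2: "triv M'" "x' \<in> Hom C ?A M'" "y' \<in> Hom C M' ?B" "h' = y' \<cdot> x'" using phanE[OF assms(2) hh(2)] .
  note H = 1(2,3)[THEN HomD] 2(2,3)[THEN HomD]
  obtain P i j p q where b: "cfl M i P q M'" "i \<in> Hom C M P" "j \<in> Hom C M' P" "p \<in> Hom C P M" "q \<in> Hom C P M'"
    "p \<cdot> i = Id C M" "q \<cdot> j = Id C M'" "p \<cdot> j = null M' M" "q \<cdot> i = null M M'"
    using biproductE[OF triv_Obj[OF 1(1)] triv_Obj[OF 2(1)]] by metis
  note o = triv_Obj[OF 1(1)] triv_Obj[OF 2(1)] Hom_objs[OF hh(1)]
  note B = b(2-5)[THEN HomD]
  have "add h h' = add (y \<cdot> p) (y' \<cdot> q) \<cdot> add (i \<cdot> x) (j \<cdot> x')"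
    unfolding 1(4) 2(4) using H B o
    by (simp add: comp_reassoc[OF b(6)] comp_reassoc[OF b(7)] comp_reassoc[OF b(8)] comp_reassoc[OF b(9)])
  moreover have "phan (add (y \<cdot> p) (y' \<cdot> q) \<cdot> add (i \<cdot> x) (j \<cdot> x'))"
    by (rule phanI[OF triv_biproduct[OF b(1) 1(1) 2(1)], of _ ?A _ ?B]) (use H B in \<open>simp_all add: Hom_def\<close>)
  ultimately show ?thesis by simp
qed

section \<open>The congruence modulo phantom maps\<close>

lemma heqI: "g \<in> Hom C A B \<Longrightarrow> h \<in> Hom C A B \<Longrightarrow> phan h \<Longrightarrow> f = add g h \<Longrightarrow> f \<sim> g"
  unfolding heq_def by (auto simp: Hom_def)

lemma heq_iff:
  assumes "f \<in> Hom C A B" "g \<in> Hom C A B"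
  shows "f \<sim> g \<longleftrightarrow> phan (add f (neg g))"
proof
  assume "f \<sim> g"
  then obtain h where h: "h \<in> Hom C A B" "phan h" "f = add g h" using assms by (auto simp: heq_def Hom_def)
  then have "add f (neg g) = h" using assms by (simp add: Hom_def add_assoc add_commute[of h "neg g"])
  with h show "phan (add f (neg g))" by simp
next
  assume *: "phan (add f (neg g))"
  show "f \<sim> g"
    by (rule heqI[OF assms(2) _ *]) (use assms in \<open>simp_all add: Hom_def add_assoc add_commute[of f "neg g"]\<close>)
qed

lemma heq_refl: "f \<in> Arr C \<Longrightarrow> f \<sim> f"
  using heq_iff[of f "Dom C f" "Cod C f" f] phan_null by (simp add: Hom_def)

lemma heq_sym:
  assumes "f \<sim> g" "f \<in> Hom C A B" "g \<in> Hom C A B"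
  shows "g \<sim> f"
proof -
  have "phan (neg (add f (neg g)))" using assms heq_iff phan_neg by blast
  then have "phan (add g (neg f))" using assms(2,3) by (simp add: Hom_def add_commute)
  then show ?thesis using assms heq_iff by blast
qed

lemma heq_trans:
  assumes "f \<sim> g" "g \<sim> h" "f \<in> Hom C A B" "g \<in> Hom C A B" "h \<in> Hom C A B"
  shows "f \<sim> h"
proof -
  have "phan (add (add f (neg g)) (add g (neg h)))"
    using assms heq_iff by - (rule phan_add, simp_all add: Hom_def)
  then have "phan (add f (neg h))" using assms(3-) by (simp add: Hom_def add_assoc)
  then show ?thesis using assms heq_iff by blast
qed

lemma heq_comp_left:
  assumes "f \<sim> g" "f \<in> Hom C A B" "g \<in> Hom C A B" "k \<in> Hom C B D"
  shows "k \<cdot> f \<sim> k \<cdot> g"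
proof -
  have "phan (k \<cdot> add f (neg g))"
    using assms heq_iff by (intro phan_comp_left[of _ A B _ D]) (simp_all add: Hom_def)
  then show ?thesis using assms(2-) heq_iff[of "k \<cdot> f" A D "k \<cdot> g"] by (simp add: Hom_def)
qed

lemma heq_comp_right:
  assumes "f \<sim> g" "f \<in> Hom C A B" "g \<in> Hom C A B" "k \<in> Hom C D A"
  shows "f \<cdot> k \<sim> g \<cdot> k"
proof -
  have "phan (add f (neg g) \<cdot> k)"
    using assms heq_iff by (intro phan_comp_right[of _ A B _ D]) (simp_all add: Hom_def)
  then show ?thesis using assms(2-) heq_iff[of "f \<cdot> k" D B "g \<cdot> k"] by (simp add: Hom_def)
qed

lemma heq_add:
  assumes "f \<sim> f'" "g \<sim> g'" "f \<in> Hom C A B" "g \<in> Hom C A B" "f' \<in> Hom C A B" "g' \<in> Hom C A B"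
  shows "add f g \<sim> add f' g'"
proof -
  have "phan (add (add f (neg f')) (add g (neg g')))"
    using assms heq_iff by - (rule phan_add, simp_all add: Hom_def)
  then show ?thesis using assms(3-) heq_iff[of "add f g" A B "add f' g'"] by (simp add: Hom_def add_ac)
qed

text \<open>Equivalent morphisms are restrictions of one morphism along two sections of the same weak
  equivalence, hence are identified by every functor that inverts the weak equivalences.\<close>

lemma heq_sections:
  assumes "f \<sim> g" "g \<in> Hom C X Y"
  obtains P w s t h where "w \<in> weq" "w \<in> Hom C P X" "s \<in> Hom C X P" "t \<in> Hom C X P" "w \<cdot> s = Id C X" "w \<cdot> t = Id C X"
    "h \<in> Hom C P Y" "f = h \<cdot> s" "g = h \<cdot> t"
proof -
  obtain h where h: "h \<in> Hom C X Y" "phan h" "f = add g h" using assms by (auto simp: heq_def Hom_def)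
  obtain M x y where m: "triv M" "x \<in> Hom C X M" "y \<in> Hom C M Y" "h = y \<cdot> x" using phanE[OF h(2,1)] .
  note o = Hom_objs[OF assms(2)] triv_Obj[OF m(1)]
  obtain P i j p q where b: "cfl M j P p X" "i \<in> Hom C X P" "j \<in> Hom C M P" "p \<in> Hom C P X" "q \<in> Hom C P M"
    "p \<cdot> i = Id C X" "q \<cdot> j = Id C M" "p \<cdot> j = null M X" "q \<cdot> i = null X M"
    using biproductE[OF o(1,3)] by metis
  note H = b(2-5)[THEN HomD] m(2,3)[THEN HomD] assms(2)[THEN HomD]
  note R = comp_reassoc[OF b(6)] comp_reassoc[OF b(7)] comp_reassoc[OF b(8)] comp_reassoc[OF b(9)]
  show thesis
  proof (rule that[of p P "add i (j \<cdot> x)" i "add (g \<cdot> p) (y \<cdot> q)"])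
    show "p \<in> weq" using adm_epi_weq_iff[OF b(1)] m by blast
  qed (use H b(6-9) R h(3) m(4) o in \<open>simp_all add: Hom_def\<close>)
qed

text \<open>Both sections of \<open>w\<close> are weak equivalences, so \<open>h \<cdot> s\<close>
  is one only if \<open>h\<close> is, and then \<open>h \<cdot> t\<close> is one too.\<close>

lemma heq_weq:
  assumes "f \<sim> g" "g \<in> Hom C X Y" "f \<in> weq"
  shows "g \<in> weq"
proof -
  obtain P w s t h where *: "w \<in> weq" "w \<in> Hom C P X" "s \<in> Hom C X P" "t \<in> Hom C X P" "w \<cdot> s = Id C X" "w \<cdot> t = Id C X"
    "h \<in> Hom C P Y" "f = h \<cdot> s" "g = h \<cdot> t" using heq_sections[OF assms(1,2)] .
  have "Id C X \<in> weq" using weq_Id Hom_objs[OF assms(2)] by blast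
  then have st: "s \<in> weq" "t \<in> weq"
    using weq_cancel_left[of s w] weq_cancel_left[of t w] * by (simp_all add: Hom_def)
  have "h \<in> weq" using weq_cancel_right[OF st(1), of h] assms(3) * by (simp add: Hom_def)
  then show ?thesis using weq_Comp[OF st(2), of h] * by (simp add: Hom_def)
qed

text \<open>A pushout along \<open>k\<close> itself would have the cokernel \<open>Y\<close>, which
  need not be trivial. Embedding \<open>X\<close> into the trivial object \<open>I\<close> first
  gives an inflation \<open>a \<cdot> k\<close> between trivial objects, whose cokernel
  \<open>T\<close> is trivial and survives in the pushout.\<close>

lemma ex_trivial_pushout:
  assumes k: "cfl K k X w Y" "triv K" and g: "g \<in> Hom C K Z"
  shows "\<exists>Z' z I a y T c. cfl Z z Z' c T \<and> triv T \<and> triv I \<and> a \<in> Hom C X I \<and> pushout C K I Z Z' (a \<cdot> k) g z y"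
proof -
  note h = cflD[OF k(1)]
  obtain a I b S where a: "cfl X a I b S" "triv I" using ex_trivial_extension[OF h(8)] tfib_iff by blast
  note ha = cflD[OF a(1)]
  have "adm_mono conf (a \<cdot> k)"
    by (rule Comp_adm_mono) (use h ha in \<open>auto simp: adm_mono_def\<close>)
  then obtain c where "(a \<cdot> k, c) \<in> conf" by (auto simp: adm_mono_def)
  then obtain T where c: "cfl K (a \<cdot> k) I c T" using cflI[of "a \<cdot> k" c] h ha by (auto simp: conflation_def Hom_def)
  have "triv T" using triv_two_of_three(1)[OF c k(2)] a by blast
  moreover obtain Z' z y c' where "cfl Z z Z' c' T" "pushout C K I Z Z' (a \<cdot> k) g z y"
    using ex_pushout[OF c g] by blast
  ultimately show ?thesis using a ha by blast
qed

text \<open>Push \<open>w\<close> out along the first factor \<open>x\<close> of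
  \<open>f \<cdot> w\<close>. The pushout \<open>P\<close> is an extension of the trivial
  \<open>N\<close> by the trivial \<open>M\<close>, and \<open>f\<close> factors through it.\<close>

lemma phan_cancel_adm_mono:
  assumes w: "cfl X w Y c N" "w \<in> weq" and f: "f \<in> Hom C Y Z" "phan (f \<cdot> w)"
  shows "phan f"
proof -
  note h = cflD[OF w(1)]
  obtain M x y where m: "triv M" "x \<in> Hom C X M" "y \<in> Hom C M Z" "f \<cdot> w = y \<cdot> x"
    using phanE[OF f(2) comp_Hom[OF h(10) f(1)]] .
  obtain P w' x' p' where P: "cfl M w' P p' N" "pushout C X Y M P w x w' x'" using ex_pushout[OF w(1) m(2)] by blast
  note po = pushoutD[OF P(2)]
  have "triv P" using triv_two_of_three(1)[OF P(1) m(1)] adm_mono_weq_iff[OF w(1)] w(2) by blast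
  moreover obtain u where "u \<in> Hom C P Z" "u \<cdot> x' = f" using po(6)[OF m(3) f(1)] m(4) by metis
  ultimately show ?thesis using phanI[OF _ po(4)] by metis
qed

text \<open>The factor \<open>x\<close> into \<open>M\<close> need not vanish on \<open>K\<close>
  and so need not descend to \<open>Y\<close>. In the enlargement \<open>P\<close> of
  \<open>M\<close> the maps \<open>z \<cdot> x\<close> and \<open>l \<cdot> a\<close> agree on
  \<open>K\<close>, so their difference descends to \<open>g\<close>. The map \<open>v\<close>,
  which is \<open>-y\<close> on \<open>M\<close> and zero on \<open>I\<close>, then satisfies
  \<open>v \<cdot> g = f\<close>, and \<open>P\<close> is still trivial.\<close>

lemma phan_cancel_adm_epi:
  assumes w: "cfl K k X w Y" "w \<in> weq" and f: "f \<in> Hom C Y Z" "phan (f \<cdot> w)"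
  shows "phan f"
proof -
  note h = cflD[OF w(1)]
  obtain M x y where m: "triv M" "x \<in> Hom C X M" "y \<in> Hom C M Z" "f \<cdot> w = y \<cdot> x"
    using phanE[OF f(2) comp_Hom[OF h(11) f(1)]] .
  have tK: "triv K" using adm_epi_weq_iff[OF w(1)] w(2) by blast
  obtain P z I a l T c where P: "cfl M z P c T" "triv T" "triv I" "a \<in> Hom C X I" "pushout C K I M P (a \<cdot> k) (x \<cdot> k) z l"
    using ex_trivial_pushout[OF w(1) tK comp_Hom[OF h(10) m(2)]] by blast
  note po = pushoutD[OF P(5)]
  have tP: "triv P" using triv_two_of_three(2)[OF P(1,2)] m(1) by blast
  note H = po(3,4)[THEN HomD] P(4)[THEN HomD] m(2,3)[THEN HomD]
    f(1)[THEN HomD]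
  note o = Hom_objs[OF po(3)] Hom_objs[OF po(4)] Hom_objs[OF m(3)]
  have "add (l \<cdot> a) (neg (z \<cdot> x)) \<cdot> k = null K P"
    using H h po(5) o by simp
  then obtain g where g: "g \<in> Hom C Y P" "g \<cdot> w = add (l \<cdot> a) (neg (z \<cdot> x))"
    using cfl_desc[OF w(1), of "add (l \<cdot> a) (neg (z \<cdot> x))" P] H by (auto simp: Hom_def)
  have "y \<cdot> (x \<cdot> k) = null K Z"
    using comp_reassoc[OF m(4)[symmetric], of k] H h Hom_objs[OF f(1)] by simp
  then have "neg y \<cdot> (x \<cdot> k) = null I Z \<cdot> (a \<cdot> k)"
    using H h o by simp
  then obtain v where v: "v \<in> Hom C P Z" "v \<cdot> z = neg y" "v \<cdot> l = null I Z"
    using po(6)[of "neg y" Z "null I Z"] H o by (auto simp: Hom_def)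
  have "v \<cdot> g = f"
  proof (rule cfl_epi[OF w(1) _ f(1)])
    have "(v \<cdot> g) \<cdot> w = v \<cdot> add (l \<cdot> a) (neg (z \<cdot> x))" using v(1) g h by (simp add: Hom_def)
    also have "\<dots> = y \<cdot> x" using v(1) H o by (simp add: Hom_def comp_reassoc[OF v(2)] comp_reassoc[OF v(3)])
    finally show "(v \<cdot> g) \<cdot> w = f \<cdot> w" using m(4) by simp
  qed (use v g in \<open>simp add: Hom_def\<close>)
  then show ?thesis using phanI[OF tP g(1) v(1)] by simp
qed

text \<open>A trivial cofibration followed by a fibration, which is a weak equivalence by
  two-out-of-three. Questions about weak equivalences thus split into one for inflations and one for
  deflations.\<close>

lemma weq_factor:
  assumes "w \<in> weq" "w \<in> Hom C X Y"
  obtains T j q c N K k where "cfl X j T c N" "j \<in> weq" "cfl K k T q Y" "q \<in> weq" "w = q \<cdot> j"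
proof -
  obtain j q where jq: "j \<in> cof \<inter> weq" "q \<in> fib" "Cod C j = Dom C q" "w = q \<cdot> j"
    using factor_trivial_cof[of w] assms by (auto simp: Hom_def)
  have a: "j \<in> Arr C" "q \<in> Arr C" using jq cof_Arr fib_Arr by auto
  have d: "Dom C j = X" "Cod C q = Y" using assms(2) jq(3) a unfolding jq(4) by (simp_all add: Hom_def)
  have "q \<in> weq" using weq_cancel_right[of j q] jq a assms(1) by simp
  moreover have jH: "j \<in> Hom C X (Dom C q)" "q \<in> Hom C (Dom C q) Y" using jq(3) a d by (simp_all add: Hom_def)
  moreover obtain c N where "cfl X j (Dom C q) c N" using cofE[OF _ jH(1)] jq(1) by blast
  moreover obtain k K where "cfl K k (Dom C q) q Y" using fibE[OF jq(2) jH(2)] by blast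
  ultimately show thesis using that jq by blast
qed

lemma phan_cancel_right:
  assumes "w \<in> weq" "w \<in> Hom C X Y" "f \<in> Hom C Y Z" "phan (f \<cdot> w)"
  shows "phan f"
proof -
  obtain T j q c N K k where *: "cfl X j T c N" "j \<in> weq" "cfl K k T q Y" "q \<in> weq" "w = q \<cdot> j"
    using weq_factor[OF assms(1,2)] .
  have "f \<cdot> w = (f \<cdot> q) \<cdot> j" unfolding *(5) using cflD[OF *(1)] cflD[OF *(3)] assms(3) by (simp add: Hom_def)
  then have "phan (f \<cdot> q)" using phan_cancel_adm_mono[OF *(1,2) comp_Hom[OF cflD(11)[OF *(3)] assms(3)]] assms(4) by simp
  then show ?thesis using phan_cancel_adm_epi[OF *(3,4) assms(3)] by blast
qed

lemmas phan_cancel_left = exact_model_structure.phan_cancel_right[OF exact_model_structure_op,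
  unfolded phantom_op op_cat_simps]

lemma heq_cancel_right:
  assumes "w \<in> weq" "w \<in> Hom C X Y" "f \<in> Hom C Y Z" "g \<in> Hom C Y Z" "f \<cdot> w \<sim> g \<cdot> w"
  shows "f \<sim> g"
proof -
  have "phan (add (f \<cdot> w) (neg (g \<cdot> w)))"
    using assms heq_iff[of "f \<cdot> w" X Z "g \<cdot> w"] by (simp add: Hom_def)
  then have "phan (add f (neg g) \<cdot> w)" using assms(2-4) by (simp add: Hom_def)
  then have "phan (add f (neg g))"
    by (rule phan_cancel_right[OF assms(1,2), rotated]) (use assms(3,4) in \<open>simp add: Hom_def\<close>)
  then show ?thesis using heq_iff assms by blast
qed

lemma heq_cancel_left:
  assumes "w \<in> weq" "w \<in> Hom C Y X" "f \<in> Hom C Z Y" "g \<in> Hom C Z Y" "w \<cdot> f \<sim> w \<cdot> g"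
  shows "f \<sim> g"
proof -
  have "phan (add (w \<cdot> f) (neg (w \<cdot> g)))"
    using assms heq_iff[of "w \<cdot> f" Z X "w \<cdot> g"] by (simp add: Hom_def)
  then have "phan (w \<cdot> add f (neg g))" using assms(2-4) by (simp add: Hom_def)
  then have "phan (add f (neg g))"
    by (rule phan_cancel_left[OF assms(1,2), rotated]) (use assms(3,4) in \<open>simp add: Hom_def\<close>)
  then show ?thesis using heq_iff assms by blast
qed

text \<open>For a deflation \<open>q\<close> with trivial kernel the obstruction on the kernel is absorbed by a map
  through a trivial object.\<close>

lemma ore:
  assumes w: "w \<in> weq" "w \<in> Hom C X Y" and f: "f \<in> Hom C X Z"
  shows "\<exists>Z' z g. z \<in> Hom C Z Z' \<and> z \<in> weq \<and> adm_mono conf z \<and> g \<in> Hom C Y Z' \<and> g \<cdot> w \<sim> z \<cdot> f"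
proof -
  obtain T j q c N K k where *: "cfl X j T c N" "j \<in> weq" "cfl K k T q Y" "q \<in> weq" "w = q \<cdot> j"
    using weq_factor[OF w] .
  note hj = cflD[OF *(1)] and hq = cflD[OF *(3)]
  \<comment> \<open>For the inflation \<open>j\<close> an ordinary pushout suffices: its cokernel
    \<open>N\<close> is trivial and is also the cokernel of \<open>z1\<close>.\<close>
  obtain Z1 z1 f1 c1 where 1: "cfl Z z1 Z1 c1 N" "pushout C X T Z Z1 j f z1 f1"
    using ex_pushout[OF *(1) f] by blast
  note p1 = pushoutD[OF 1(2)] and h1 = cflD[OF 1(1)]
  have z1: "z1 \<in> weq" using adm_mono_weq_iff[OF 1(1)] adm_mono_weq_iff[OF *(1)] *(2) by blast
  have tK: "triv K" using adm_epi_weq_iff[OF *(3)] *(4) by blast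
  obtain Z2 z2 I a l T' c2 where 2: "cfl Z1 z2 Z2 c2 T'" "triv T'" "triv I" "a \<in> Hom C T I"
    "pushout C K I Z1 Z2 (a \<cdot> k) (f1 \<cdot> k) z2 l"
    using ex_trivial_pushout[OF *(3) tK comp_Hom[OF hq(10) p1(4)]] by blast
  note p2 = pushoutD[OF 2(5)] and h2 = cflD[OF 2(1)]
  have z2: "z2 \<in> weq" using adm_mono_weq_iff[OF 2(1)] 2(2) by blast
  note H = p1(4)[THEN HomD] p2(4)[THEN HomD] 2(4)[THEN HomD]
    f[THEN HomD]
  \<comment> \<open>On \<open>K\<close> the maps \<open>z2 \<cdot> f1\<close> and
    \<open>l \<cdot> a\<close> agree, so the difference descends along \<open>q\<close>; the extra
    term passes through the trivial object \<open>I\<close> and is therefore harmless.\<close>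
  have "add (z2 \<cdot> f1) (neg (l \<cdot> a)) \<cdot> k = null K Z2"
    using H hq h2 p2(5)[symmetric] by simp
  then obtain g where g: "g \<in> Hom C Y Z2" "g \<cdot> q = add (z2 \<cdot> f1) (neg (l \<cdot> a))"
    using cfl_desc[OF *(3), of "add (z2 \<cdot> f1) (neg (l \<cdot> a))" Z2] H h2 by (auto simp: Hom_def)
  have e: "g \<cdot> w = add ((z2 \<cdot> z1) \<cdot> f) (neg ((l \<cdot> a) \<cdot> j))"
    unfolding *(5) using g(1) hj hq h1 h2 H by (simp add: Hom_def comp_reassoc[OF g(2)] p1(5))
  have ph: "phan (neg ((l \<cdot> a) \<cdot> j))"
    by (rule phan_neg, rule phan_comp_right[OF phanI[OF 2(3,4) p2(4)] comp_Hom[OF 2(4) p2(4)] hj(10)])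
  have "g \<cdot> w \<sim> (z2 \<cdot> z1) \<cdot> f"
    by (rule heqI[OF _ _ ph e, of X Z2]) (use hj h1 h2 H in \<open>simp_all add: Hom_def\<close>)
  \<comment> \<open>That denominators can be taken to be inflations matters later, when conflations
    are pushed out along them.\<close>
  moreover have "adm_mono conf (z2 \<cdot> z1)"
    by (rule Comp_adm_mono) (use h1 h2 in \<open>auto simp: adm_mono_def\<close>)
  moreover have "z2 \<cdot> z1 \<in> weq" using weq_Comp[OF z1 z2] h1 h2 by simp
  ultimately show ?thesis using g(1) comp_Hom[OF h1(10) h2(10)] by blast
qed

lemmas ore' = exact_model_structure.ore[OF exact_model_structure_op, unfolded heq_op op_cat_simps adm_op]

lemma weq_neg:
  assumes "w \<in> weq"
  shows "neg w \<in> weq"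
proof -
  have w: "w \<in> Arr C" using assms weq_Arr by auto
  have "neg (Id C (Cod C w)) \<in> weq"
    using iso_weq iso_arr_neg iso_arr_Id w by (metis Dom_Cod_Obj(2) Id_Hom)
  then have "neg (Id C (Cod C w)) \<cdot> w \<in> weq" using assms w by (intro weq_Comp) simp_all
  then show ?thesis using w by simp
qed


section \<open>Morphisms of conflations with trivial middle term\<close>

text \<open>The difference of \<open>b1\<close> and \<open>b2\<close> kills \<open>i\<close> and so
  is \<open>u \<cdot> p\<close>; then \<open>d1\<close> and \<open>d2\<close> differ by
  \<open>p' \<cdot> u\<close>, which passes through the trivial \<open>I\<close>.\<close>

lemma cfl_map_unique:
  assumes c: "cfl A i B p D" "cfl A' i' I p' S" "triv I"
    and b: "b1 \<in> Hom C B I" "b2 \<in> Hom C B I" "b1 \<cdot> i = b2 \<cdot> i"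
    and d: "d1 \<in> Hom C D S" "d2 \<in> Hom C D S" "d1 \<cdot> p = p' \<cdot> b1" "d2 \<cdot> p = p' \<cdot> b2"
  shows "d1 \<sim> d2"
proof -
  note h = cflD[OF c(1)] and h' = cflD[OF c(2)]
  note H = b(1,2)[THEN HomD] d(1,2)[THEN HomD]
  have "add b1 (neg b2) \<cdot> i = null A I" using H h h' b(3) by simp
  then obtain u where u: "u \<in> Hom C D I" "u \<cdot> p = add b1 (neg b2)"
    using cfl_desc[OF c(1), of "add b1 (neg b2)" I] H by (auto simp: Hom_def)
  have e: "d1 = add d2 (p' \<cdot> u)"
  proof (rule cfl_epi[OF c(1), of _ S])
    have "add d2 (p' \<cdot> u) \<cdot> p = add (p' \<cdot> b2) (p' \<cdot> add b1 (neg b2))"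
      using u H h h' by (simp add: Hom_def d(4) del: comp_add(2))
    also have "\<dots> = p' \<cdot> b1" using H h' by (simp add: add_left_commute[of "p' \<cdot> b2"])
    finally show "d1 \<cdot> p = add d2 (p' \<cdot> u) \<cdot> p" using d(3) by simp
  qed (use u H h' in \<open>simp_all add: Hom_def\<close>)
  show ?thesis
    by (rule heqI[OF d(2) _ phanI[OF c(3) u(1) h'(11)] e]) (use u h' in \<open>simp add: Hom_def\<close>)
qed

text \<open>Let \<open>Z\<close> be the pushout of \<open>i\<close> and \<open>i'\<close>. Its two
  projections \<open>w\<close> onto \<open>S\<close> and \<open>w'\<close> onto \<open>S'\<close>
  have trivial kernels. With the retraction \<open>v\<close> of \<open>l\<close> given by
  \<open>b\<close>, the sum of \<open>d \<cdot> w\<close> and \<open>w'\<close> is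
  \<open>p' \<cdot> v\<close>, a phantom map; so \<open>d \<cdot> w \<sim> neg w'\<close>, which is
  a weak equivalence.\<close>

lemma cfl_map_weq:
  assumes c: "cfl A i T p S" "triv T" "cfl A i' T' p' S'" "triv T'"
    and b: "b \<in> Hom C T T'" "b \<cdot> i = i'" and d: "d \<in> Hom C S S'" "d \<cdot> p = p' \<cdot> b"
  shows "d \<in> weq"
proof -
  note h = cflD[OF c(1)] and h' = cflD[OF c(3)]
  obtain Z l j w where po: "cfl T' l Z w S" "pushout C A T T' Z i i' l j" "w \<cdot> j = p"
    using ex_pushout[OF c(1) h'(10)] by blast
  obtain w' where po': "cfl T j Z w' S'" "w' \<cdot> l = p'"
    using pushout_conflation[OF c(3) pushout_sym[OF po(2)]] by blast
  note P = pushoutD[OF po(2)] and hl = cflD[OF po(1)] and hj = cflD[OF po'(1)]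
  have ww: "w \<in> weq" "w' \<in> weq" using adm_epi_weq_iff po po' c by blast+
  note H = b(1)[THEN HomD] d(1)[THEN HomD]
  have "Id C T' \<cdot> i' = b \<cdot> i" using h' b by simp
  then obtain v where v: "v \<in> Hom C Z T'" "v \<cdot> l = Id C T'" "v \<cdot> j = b"
    using P(6)[OF Id_Hom b(1)] h' by blast
  have e: "add (d \<cdot> w) w' = p' \<cdot> v"
    by (rule P(7)[of _ S']) (use v H h h' hl hj po(3) po'(2) d(2) in \<open>simp_all add: Hom_def\<close>)
  have "d \<cdot> w = add (neg w') (add (d \<cdot> w) w')"
    using H hl hj by (simp add: add_commute[of "d \<cdot> w" w'])
  then have e: "d \<cdot> w = add (neg w') (p' \<cdot> v)" unfolding e .
  have "d \<cdot> w \<sim> neg w'"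
    by (rule heqI[OF _ _ phanI[OF c(4) v(1) h'(11)] e, of Z S']) (use v hj h' in \<open>simp_all add: Hom_def\<close>)
  from heq_sym[OF this, of Z S'] have "neg w' \<sim> d \<cdot> w" using H hl hj by (simp add: Hom_def)
  then have "d \<cdot> w \<in> weq"
    by (rule heq_weq[OF _ _ weq_neg[OF ww(2)]]) (use H hl in \<open>simp add: Hom_def\<close>)
  then show ?thesis using weq_cancel_right[OF ww(1), of d] H hl by simp
qed

text \<open>The two conflations obtained from a pullback of two deflations have opposite connecting
  morphisms.\<close>

lemma pullback_anticommute:
  assumes c1: "cfl A i B p D" and c2: "cfl K k P q D" and pb: "pullback C D B P U p q v u"
    and kA: "cfl A kA U v P" "u \<cdot> kA = i" and kK: "cfl K kK U u B" "v \<cdot> kK = k"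
    and sA: "cfl A aA IA bA SA" and sK: "cfl K aK IK bK SK" and sU: "cfl U aU IU bU SU" "triv IU"
    and b: "b \<in> Hom C B IA" "d \<in> Hom C D SA" "b \<cdot> i = aA" "d \<cdot> p = bA \<cdot> b"
    and b': "b' \<in> Hom C P IK" "d' \<in> Hom C D SK" "b' \<cdot> k = aK" "d' \<cdot> q = bK \<cdot> b'"
    and e1: "e1 \<in> Hom C IA IU" "s1 \<in> Hom C SA SU" "e1 \<cdot> aA = aU \<cdot> kA" "s1 \<cdot> bA = bU \<cdot> e1"
    and e2: "e2 \<in> Hom C IK IU" "s2 \<in> Hom C SK SU" "e2 \<cdot> aK = aU \<cdot> kK" "s2 \<cdot> bK = bU \<cdot> e2"
  shows "phan (add (s1 \<cdot> d) (s2 \<cdot> d'))"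
proof -
  note h1 = cflD[OF c1] and h2 = cflD[OF c2] and hA = cflD[OF kA(1)] and hK = cflD[OF kK(1)]
    and hsA = cflD[OF sA] and hsK = cflD[OF sK] and hsU = cflD[OF sU(1)] and P = pullbackD[OF pb]
  note H = b(1,2)[THEN HomD] b'(1,2)[THEN HomD]
    e1(1,2)[THEN HomD] e2(1,2)[THEN HomD]
  \<comment> \<open>On each of the two kernels \<open>A\<close> and \<open>K\<close>,
    \<open>aU\<close> cancels one of the other terms and the remaining one vanishes. Hence
    \<open>t\<close> descends along \<open>v\<close> and then along \<open>q\<close> to a map
    \<open>r\<close> on \<open>D\<close>. As \<open>bU\<close> kills \<open>aU\<close>, composing
    with \<open>bU\<close> leaves exactly the sum in question.\<close>
  define t where "t = add (add (e1 \<cdot> (b \<cdot> u)) (e2 \<cdot> (b' \<cdot> v))) (neg aU)"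
  have t: "t \<in> Hom C U IU" unfolding t_def using H hA hK hsU by (simp add: Hom_def)
  have "t \<cdot> kA = null A IU"
    unfolding t_def using H hA hK hsU hsA h1 by (simp add: kA(2) b(3) e1(3))
  then obtain g where g: "g \<in> Hom C P IU" "g \<cdot> v = t" using cfl_desc[OF kA(1) t] by blast
  have "t \<cdot> kK = null K IU"
    unfolding t_def using H hA hK hsU hsA h2 by (simp add: kK(2) b'(3) e2(3))
  then have "g \<cdot> k = null K IU"
    using comp_reassoc[OF g(2), of kK] g(1) hA hK kK(2) by (simp add: Hom_def)
  then obtain r where r: "r \<in> Hom C D IU" "r \<cdot> q = g" using cfl_desc[OF c2 g(1)] by blast
  have 1: "bU \<cdot> t = add (s1 \<cdot> (d \<cdot> (p \<cdot> u))) (s2 \<cdot> (d' \<cdot> (q \<cdot> v)))"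
  proof -
    have "bU \<cdot> t = add ((bU \<cdot> e1) \<cdot> (b \<cdot> u)) ((bU \<cdot> e2) \<cdot> (b' \<cdot> v))"
      unfolding t_def using H hA hK hsU by simp
    also have "\<dots> = add (s1 \<cdot> ((bA \<cdot> b) \<cdot> u)) (s2 \<cdot> ((bK \<cdot> b') \<cdot> v))"
      unfolding e1(4)[symmetric] e2(4)[symmetric] using H hA hK hsA hsK by simp
    also have "\<dots> = add (s1 \<cdot> (d \<cdot> (p \<cdot> u))) (s2 \<cdot> (d' \<cdot> (q \<cdot> v)))"
      unfolding b(4)[symmetric] b'(4)[symmetric] using H hA hK h1 h2 by simp
    finally show ?thesis .
  qed
  have 2: "((bU \<cdot> r) \<cdot> q) \<cdot> v = bU \<cdot> t" using r g h2 hA hsU by (simp add: Hom_def)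
  have "((bU \<cdot> r) \<cdot> q) \<cdot> v = (add (s1 \<cdot> d) (s2 \<cdot> d') \<cdot> q) \<cdot> v"
    unfolding 2 1 using H h1 h2 hA hK P(5) by simp
  then have "(bU \<cdot> r) \<cdot> q = add (s1 \<cdot> d) (s2 \<cdot> d') \<cdot> q"
    by (rule cfl_epi[OF kA(1), rotated 2]) (use r g(1) H h2 hsU in \<open>simp_all add: Hom_def\<close>)
  then have "bU \<cdot> r = add (s1 \<cdot> d) (s2 \<cdot> d')"
    by (rule cfl_epi[OF c2, rotated 2]) (use r H h2 hsU in \<open>simp_all add: Hom_def\<close>)
  then show ?thesis using phanI[OF sU(2) r(1) hsU(11)] by simp
qed


section \<open>Suspension on the exact category\<close>

text \<open>One choice per object, with no compatibility between choices; functoriality of the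
  suspension can therefore only hold modulo phantom maps.\<close>

definition susp_seq where
  "susp_seq X = (SOME t. case t of (a, I, b, S) \<Rightarrow> cfl X a I b S \<and> tfib I \<and> cofb S)"

definition susp_mono where "susp_mono X = fst (susp_seq X)"
definition susp_mid where "susp_mid X = fst (snd (susp_seq X))"
definition susp_epi where "susp_epi X = fst (snd (snd (susp_seq X)))"
definition susp where "susp X = snd (snd (snd (susp_seq X)))"

lemma susp:
  assumes "X \<in> Obj C"
  shows "cfl X (susp_mono X) (susp_mid X) (susp_epi X) (susp X)" "tfib (susp_mid X)" "triv (susp_mid X)" "cofb (susp X)"
proof -
  have "\<exists>t. case t of (a, I, b, S) \<Rightarrow> cfl X a I b S \<and> tfib I \<and> cofb S"
    using ex_trivial_extension[OF assms] by simp
  from someI_ex[OF this] show "cfl X (susp_mono X) (susp_mid X) (susp_epi X) (susp X)" "tfib (susp_mid X)" "cofb (susp X)"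
    unfolding susp_mono_def susp_mid_def susp_epi_def susp_def susp_seq_def by (auto split: prod.splits)
  then show "triv (susp_mid X)" using tfib_iff by blast
qed

text \<open>\<open>d\<close> is the right-hand component of a morphism from the conflation
  \<open>(i, p)\<close> to the chosen one starting at \<open>A'\<close>, with \<open>f\<close> on
  the left. For \<open>f\<close> an identity it represents the connecting morphism, for a chosen
  conflation \<open>(i, p)\<close> the suspension of \<open>f\<close>.\<close>

definition cfl_to_susp where
  "cfl_to_susp i p A' f d \<longleftrightarrow> (\<exists>b \<in> Hom C (Cod C i) (susp_mid A'). b \<cdot> i = susp_mono A' \<cdot> f \<and>
     d \<in> Hom C (Cod C p) (susp A') \<and> d \<cdot> p = susp_epi A' \<cdot> b)"

lemma cfl_to_suspI:
  "cfl A i B p D \<Longrightarrow> b \<in> Hom C B (susp_mid A') \<Longrightarrow> b \<cdot> i = susp_mono A' \<cdot> f \<Longrightarrow>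
     d \<in> Hom C D (susp A') \<Longrightarrow> d \<cdot> p = susp_epi A' \<cdot> b \<Longrightarrow> cfl_to_susp i p A' f d"
  using cflD[of A i B p D] by (auto simp: cfl_to_susp_def)

lemma cfl_to_suspE:
  assumes "cfl_to_susp i p A' f d" "cfl A i B p D"
  obtains b where "b \<in> Hom C B (susp_mid A')" "b \<cdot> i = susp_mono A' \<cdot> f" "d \<in> Hom C D (susp A')" "d \<cdot> p = susp_epi A' \<cdot> b"
  using assms cflD[OF assms(2)] by (auto simp: cfl_to_susp_def)

lemma cfl_to_susp_unique:
  assumes "cfl_to_susp i p A' f d" "cfl_to_susp i p A' f d'" "cfl A i B p D" "A' \<in> Obj C"
  shows "d \<sim> d'"
proof -
  obtain b where b: "b \<in> Hom C B (susp_mid A')" "b \<cdot> i = susp_mono A' \<cdot> f" "d \<in> Hom C D (susp A')" "d \<cdot> p = susp_epi A' \<cdot> b"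
    using cfl_to_suspE[OF assms(1,3)] .
  obtain b' where b': "b' \<in> Hom C B (susp_mid A')" "b' \<cdot> i = susp_mono A' \<cdot> f" "d' \<in> Hom C D (susp A')" "d' \<cdot> p = susp_epi A' \<cdot> b'"
    using cfl_to_suspE[OF assms(2,3)] .
  show ?thesis
    by (rule cfl_map_unique[OF assms(3) susp(1,3)[OF assms(4)] b(1) b'(1) _ b(3) b'(3) b(4) b'(4)]) (simp add: b(2) b'(2))
qed

text \<open>Cofibrancy of \<open>D\<close> is what allows the extension over \<open>B\<close> into
  the trivially fibrant \<open>susp_mid A'\<close>.\<close>

lemma ex_cfl_to_susp:
  assumes c: "cfl A i B p D" "cofb D" and f: "f \<in> Hom C A A'"
  shows "\<exists>d. cfl_to_susp i p A' f d"
proof -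
  note h = cflD[OF c(1)] and o = Hom_objs[OF f]
  note hs = cflD[OF susp(1)[OF o(2)]]
  obtain b where b: "b \<in> Hom C B (susp_mid A')" "b \<cdot> i = susp_mono A' \<cdot> f"
    using tfib_extend[OF c susp(2)[OF o(2)] comp_Hom[OF f hs(10)]] by blast
  have "(susp_epi A' \<cdot> b) \<cdot> i = null A (susp A')"
    using b hs h f by (simp add: Hom_def)
  then obtain d where "d \<in> Hom C D (susp A')" "d \<cdot> p = susp_epi A' \<cdot> b"
    using cfl_desc[OF c(1) comp_Hom[OF b(1) hs(11)]] by blast
  with b cfl_to_suspI[OF c(1)] show ?thesis by blast
qed

lemma cfl_to_susp_Hom: "cfl_to_susp i p A' f d \<Longrightarrow> cfl A i B p D \<Longrightarrow> d \<in> Hom C D (susp A')"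
  by (auto elim: cfl_to_suspE)

lemma cfl_to_susp_pre:
  assumes "cfl_to_susp i p A' f d" "cfl A i B p D" "cfl A1 i1 B1 p1 D1" "f \<in> Hom C A A'"
    "g \<in> Hom C A1 A" "b1 \<in> Hom C B1 B" "d1 \<in> Hom C D1 D" "b1 \<cdot> i1 = i \<cdot> g" "d1 \<cdot> p1 = p \<cdot> b1"
  shows "cfl_to_susp i1 p1 A' (f \<cdot> g) (d \<cdot> d1)"
proof -
  obtain b where b: "b \<in> Hom C B (susp_mid A')" "b \<cdot> i = susp_mono A' \<cdot> f" "d \<in> Hom C D (susp A')" "d \<cdot> p = susp_epi A' \<cdot> b"
    using cfl_to_suspE[OF assms(1,2)] .
  note h = cflD[OF assms(2)] and h1 = cflD[OF assms(3)] and hs = cflD[OF susp(1)[OF Hom_objs(2)[OF assms(4)]]]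
  note H = b(1,3)[THEN HomD] assms(4-7)[THEN HomD]
  show ?thesis
  proof (rule cfl_to_suspI[OF assms(3), of "b \<cdot> b1"])
    show "(b \<cdot> b1) \<cdot> i1 = susp_mono A' \<cdot> f \<cdot> g"
      using H h h1 hs by (simp add: assms(8) comp_reassoc[OF b(2)])
    show "(d \<cdot> d1) \<cdot> p1 = susp_epi A' \<cdot> b \<cdot> b1"
      using H h h1 hs by (simp add: assms(9) comp_reassoc[OF b(4)])
  qed (use H in \<open>simp_all add: Hom_def\<close>)
qed

lemma cfl_to_susp_add:
  assumes "cfl_to_susp i p A' f d" "cfl_to_susp i p A' f' d'" "cfl A i B p D" "f \<in> Hom C A A'" "f' \<in> Hom C A A'"
  shows "cfl_to_susp i p A' (add f f') (add d d')"
proof -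
  obtain b where b: "b \<in> Hom C B (susp_mid A')" "b \<cdot> i = susp_mono A' \<cdot> f" "d \<in> Hom C D (susp A')" "d \<cdot> p = susp_epi A' \<cdot> b"
    using cfl_to_suspE[OF assms(1,3)] .
  obtain b' where b': "b' \<in> Hom C B (susp_mid A')" "b' \<cdot> i = susp_mono A' \<cdot> f'" "d' \<in> Hom C D (susp A')" "d' \<cdot> p = susp_epi A' \<cdot> b'"
    using cfl_to_suspE[OF assms(2,3)] .
  note h = cflD[OF assms(3)] and hs = cflD[OF susp(1)[OF Hom_objs(2)[OF assms(4)]]]
  show ?thesis
    by (rule cfl_to_suspI[OF assms(3), of "add b b'"])
      (use b b' h hs assms(4,5) in \<open>simp_all add: Hom_def\<close>)
qed

section \<open>The suspension of arrows\<close>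

definition susp_map where
  "susp_map f = (SOME d. cfl_to_susp (susp_mono (Dom C f)) (susp_epi (Dom C f)) (Cod C f) f d)"

lemma susp_map:
  assumes "f \<in> Hom C A B"
  shows "cfl_to_susp (susp_mono A) (susp_epi A) B f (susp_map f)"
proof -
  note o = Hom_objs[OF assms]
  from someI_ex[OF ex_cfl_to_susp[OF susp(1)[OF o(1)] susp(4)[OF o(1)] assms]] assms
  show ?thesis by (simp add: susp_map_def Hom_def)
qed

lemma susp_map_Hom: "f \<in> Hom C A B \<Longrightarrow> susp_map f \<in> Hom C (susp A) (susp B)"
  using cfl_to_susp_Hom[OF susp_map susp(1)] Hom_objs by blast

lemma susp_map_unique:
  "cfl_to_susp (susp_mono A) (susp_epi A) B f d \<Longrightarrow> f \<in> Hom C A B \<Longrightarrow> d \<sim> susp_map f"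
  using cfl_to_susp_unique[OF _ susp_map susp(1)] Hom_objs by blast

lemma cfl_to_susp_post:
  assumes "cfl_to_susp i p A' f d" "cfl A i B p D" "f \<in> Hom C A A'" "g \<in> Hom C A' A''"
  shows "cfl_to_susp i p A'' (g \<cdot> f) (susp_map g \<cdot> d)"
proof -
  obtain b where b: "b \<in> Hom C B (susp_mid A')" "b \<cdot> i = susp_mono A' \<cdot> f" "d \<in> Hom C D (susp A')" "d \<cdot> p = susp_epi A' \<cdot> b"
    using cfl_to_suspE[OF assms(1,2)] .
  show ?thesis
    using cfl_to_susp_pre[OF susp_map[OF assms(4)] susp(1)[OF Hom_objs(1)[OF assms(4)]] assms(2,4,3) b(1,3,2,4)] .
qed

lemma cfl_to_susp_Id:
  assumes "A \<in> Obj C"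
  shows "cfl_to_susp (susp_mono A) (susp_epi A) A (Id C A) (Id C (susp A))"
  using cfl_to_suspI[OF susp(1)[OF assms], of "Id C (susp_mid A)" A "Id C A" "Id C (susp A)"] cflD[OF susp(1)[OF assms]]
  by (simp add: Hom_def)

lemma susp_map_Id: "A \<in> Obj C \<Longrightarrow> susp_map (Id C A) \<sim> Id C (susp A)"
  using heq_sym[OF susp_map_unique[OF cfl_to_susp_Id Id_Hom], of A "susp A" "susp A"] susp_map_Hom[OF Id_Hom, of A]
    cflD[OF susp(1), of A] by (simp add: Hom_def)

lemma susp_map_comp:
  assumes "f \<in> Hom C A B" "g \<in> Hom C B D"
  shows "susp_map g \<cdot> susp_map f \<sim> susp_map (g \<cdot> f)"
  using susp_map_unique[OF cfl_to_susp_post[OF susp_map[OF assms(1)] susp(1) assms] comp_Hom[OF assms]]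
    Hom_objs[OF assms(1)] by blast

lemma susp_map_add:
  assumes "f \<in> Hom C A B" "g \<in> Hom C A B"
  shows "add (susp_map f) (susp_map g) \<sim> susp_map (add f g)"
  using susp_map_unique[OF cfl_to_susp_add[OF susp_map[OF assms(1)] susp_map[OF assms(2)] susp(1) assms]
     add_Hom[OF assms]] Hom_objs[OF assms(1)] by blast

lemma triv_susp: "triv M \<Longrightarrow> triv (susp M)"
  using triv_two_of_three(1)[OF susp(1) ] susp(3) triv_Obj by blast

text \<open>The suspension of a trivial object is trivial, so \<open>susp_map f\<close> agrees up to
  a phantom map with a composite through a trivial object.\<close>

lemma susp_map_phan:
  assumes "phan f" "f \<in> Hom C A B"
  shows "phan (susp_map f)"
proof -
  obtain M x y where m: "triv M" "x \<in> Hom C A M" "y \<in> Hom C M B" "f = y \<cdot> x" using phanE[OF assms] .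
  note sx = susp_map_Hom[OF m(2)] and sy = susp_map_Hom[OF m(3)] and sf = susp_map_Hom[OF assms(2)]
  have c: "susp_map y \<cdot> susp_map x \<sim> susp_map f" using susp_map_comp[OF m(2,3)] m(4) by simp
  have "phan (susp_map y \<cdot> susp_map x)" by (rule phanI[OF triv_susp[OF m(1)] sx sy])
  moreover have "phan (add (susp_map f) (neg (susp_map y \<cdot> susp_map x)))"
    using heq_sym[OF c comp_Hom[OF sx sy] sf] heq_iff[OF sf comp_Hom[OF sx sy]] by blast
  ultimately have "phan (add (susp_map y \<cdot> susp_map x) (add (susp_map f) (neg (susp_map y \<cdot> susp_map x))))"
    using sx sy sf by - (rule phan_add, simp_all add: Hom_def)
  then show ?thesis using sx sy sf
    by (simp add: Hom_def add_commute[of "susp_map f" "neg _"])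
qed

lemma susp_map_heq:
  assumes "f \<sim> g" "f \<in> Hom C A B" "g \<in> Hom C A B"
  shows "susp_map f \<sim> susp_map g"
proof -
  obtain h where h: "h \<in> Hom C A B" "phan h" "f = add g h" using assms by (auto simp: heq_def Hom_def)
  note s = susp_map_Hom[OF h(1)] susp_map_Hom[OF assms(2)] susp_map_Hom[OF assms(3)]
  have 1: "add (susp_map g) (susp_map h) \<sim> susp_map f" using susp_map_add[OF assms(3) h(1)] h(3) by simp
  have 2: "add (susp_map g) (susp_map h) \<sim> susp_map g"
    by (rule heqI[OF s(3,1) susp_map_phan[OF h(2,1)]]) simp
  from heq_trans[OF heq_sym[OF 1] 2] s add_Hom show ?thesis by blast
qed

text \<open>For an inflation the suspension of a weak equivalence is compared with the pushout conflation;
  a general weak equivalence is reduced to inflations by the Ore condition, as a map with a left and a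
  right inverse is invertible.\<close>

lemma susp_map_weq_adm_mono:
  assumes c: "cfl A f B p N" and w: "f \<in> weq"
  shows "susp_map f \<in> weq"
proof -
  note h = cflD[OF c]
  note sA = susp[OF h(7)] and sB = susp[OF h(8)]
  note hA = cflD[OF sA(1)]
  obtain P i' f' p' where po: "cfl B i' P p' (susp A)" "pushout C A (susp_mid A) B P (susp_mono A) f i' f'"
    "p' \<cdot> f' = susp_epi A" using ex_pushout[OF sA(1) h(10)] by blast
  note Po = pushoutD[OF po(2)]
  obtain q where q: "cfl (susp_mid A) f' P q N" using pushout_conflation[OF c pushout_sym[OF po(2)]] by blast
  \<comment> \<open>\<open>P\<close> is an extension of the trivial \<open>N\<close> by the trivial
    \<open>susp_mid A\<close>. So \<open>B \<rightarrow> P \<rightarrow> susp A\<close> could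
    equally serve to suspend \<open>B\<close>, and \<open>d\<close> below compares it with the
    chosen conflation.\<close>
  have tP: "triv P" using triv_two_of_three(1)[OF q sA(3)] adm_mono_weq_iff[OF c] w by blast
  obtain d where d: "cfl_to_susp i' p' B (Id C B) d" using ex_cfl_to_susp[OF po(1) sA(4) Id_Hom[OF h(8)]] by blast
  obtain b where b: "b \<in> Hom C P (susp_mid B)" "b \<cdot> i' = susp_mono B \<cdot> Id C B" "d \<in> Hom C (susp A) (susp B)" "d \<cdot> p' = susp_epi B \<cdot> b"
    using cfl_to_suspE[OF d po(1)] .
  have dw: "d \<in> weq"
    by (rule cfl_map_weq[OF po(1) tP sB(1,3) b(1) _ b(3,4)]) (use b cflD[OF sB(1)] in simp)
  have "cfl_to_susp (susp_mono A) (susp_epi A) B (Id C B \<cdot> f) (d \<cdot> Id C (susp A))"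
    by (rule cfl_to_susp_pre[OF d po(1) sA(1) Id_Hom[OF h(8)] h(10) Po(4) _ Po(5)]) (use hA po(3) in \<open>simp_all add: Hom_def\<close>)
  then have "cfl_to_susp (susp_mono A) (susp_epi A) B f d" using h b hA by (simp add: Hom_def)
  from heq_weq[OF susp_map_unique[OF this h(10)] susp_map_Hom[OF h(10)] dw] show ?thesis .
qed

end


section \<open>Fractions\<close>

text \<open>Otherwise identities of the localization would unfold to empty zigzags and the rules of
  category theory would no longer match.\<close>

declare localization_simps(4) [simp del]

sublocale exact_model_structure \<subseteq> L: category "localization C weq"
  by (rule category_localization[OF category_axioms])

context exact_model_structure
begin

abbreviation L where "L \<equiv> localization C weq"
abbreviation Q where "Q \<equiv> loc_arr C weq"
abbreviation compL (infixr "\<bullet>" 70) where "g \<bullet> f \<equiv> Comp L g f"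

lemma Q_Hom: "f \<in> Hom C A B \<Longrightarrow> Q f \<in> Hom L A B"
  using localization_functor[OF category_axioms, of weq] by (auto simp: is_functor_def Hom_def)

lemma Q_simps [simp]: "f \<in> Arr C \<Longrightarrow> Q f \<in> Arr L" "f \<in> Arr C \<Longrightarrow> Dom L (Q f) = Dom C f" "f \<in> Arr C \<Longrightarrow> Cod L (Q f) = Cod C f"
  using Q_Hom[of f "Dom C f" "Cod C f"] by (simp_all add: Hom_def)

lemma Q_comp: "f \<in> Arr C \<Longrightarrow> g \<in> Arr C \<Longrightarrow> Cod C f = Dom C g \<Longrightarrow> Q (g \<cdot> f) = Q g \<bullet> Q f"
  using localization_functor[OF category_axioms, of weq] by (auto simp: is_functor_def)

lemma Q_Id: "A \<in> Obj C \<Longrightarrow> Q (Id C A) = Id L A"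
  using localization_functor[OF category_axioms, of weq] by (auto simp: is_functor_def)

lemma Q_iso: "w \<in> weq \<Longrightarrow> iso_arr L (Q w)"
  using localization_inverts[OF category_axioms, of w weq] weq_Arr by auto

lemma Q_heq:
  assumes "f \<sim> g" "g \<in> Hom C X Y"
  shows "Q f = Q g"
proof -
  obtain P w s t h where *: "w \<in> weq" "w \<in> Hom C P X" "s \<in> Hom C X P" "t \<in> Hom C X P" "w \<cdot> s = Id C X" "w \<cdot> t = Id C X"
    "h \<in> Hom C P Y" "f = h \<cdot> s" "g = h \<cdot> t" using heq_sections[OF assms] .
  note H = *(2-4,7)[THEN HomD]
  have "Q w \<bullet> Q s = Q w \<bullet> Q t" using H *(5,6) Q_comp[of s w] Q_comp[of t w] by simp
  then have "Q s = Q t" by (rule L.iso_cancel_left[OF Q_iso[OF *(1)] Q_Hom[OF *(2)] Q_Hom[OF *(3)] Q_Hom[OF *(4)]])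
  then show ?thesis unfolding *(8,9) using H by (simp add: Q_comp)
qed

lemma loc_eqI:
  assumes "w \<in> weq" "w \<in> Hom C Y Z" "f \<in> Hom L X Y" "g \<in> Hom L X Y" "Q w \<bullet> f = Q w \<bullet> g"
  shows "f = g"
  using L.iso_cancel_left[OF Q_iso[OF assms(1)] Q_Hom[OF assms(2)] assms(3-5)] .

lemma loc_eqI':
  assumes "w \<in> weq" "w \<in> Hom C Z X" "f \<in> Hom L X Y" "g \<in> Hom L X Y" "f \<bullet> Q w = g \<bullet> Q w"
  shows "f = g"
  using L.iso_cancel_right[OF Q_iso[OF assms(1)] Q_Hom[OF assms(2)] assms(3-5)] .

lemma ex_loc_left:
  assumes "w \<in> weq" "w \<in> Hom C Y Z" "f \<in> Hom L X Z"
  shows "\<exists>g \<in> Hom L X Y. Q w \<bullet> g = f"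
proof -
  obtain v where v: "v \<in> Hom L Z Y" "v \<bullet> Q w = Id L Y" "Q w \<bullet> v = Id L Z"
    using L.iso_arrE[OF Q_iso[OF assms(1)] Q_Hom[OF assms(2)]] .
  have "Q w \<bullet> (v \<bullet> f) = f"
    using v assms(2,3) by (simp add: Hom_def L.comp_reassoc[OF v(3)])
  then show ?thesis using L.comp_Hom[OF assms(3) v(1)] by blast
qed

lemma ex_loc_right:
  assumes "w \<in> weq" "w \<in> Hom C Z X" "f \<in> Hom L Z Y"
  shows "\<exists>g \<in> Hom L X Y. g \<bullet> Q w = f"
proof -
  obtain v where v: "v \<in> Hom L X Z" "v \<bullet> Q w = Id L Z" "Q w \<bullet> v = Id L X"
    using L.iso_arrE[OF Q_iso[OF assms(1)] Q_Hom[OF assms(2)]] .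
  have "(f \<bullet> v) \<bullet> Q w = f"
    using v assms(2,3) by (simp add: Hom_def)
  then show ?thesis using L.comp_Hom[OF v(1) assms(3)] by blast
qed

text \<open>Induction on the last step. A forward step is moved past the denominator
  \<open>t\<close> by an Ore square; a backward step \<open>w\<close> makes
  \<open>t \<cdot> w\<close> the new denominator.\<close>

lemma left_fraction_zigzag:
  "zigzag C weq X s Y \<Longrightarrow> \<exists>Z f t. f \<in> Hom C X Z \<and> t \<in> Hom C Y Z \<and> t \<in> weq \<and> adm_mono conf t \<and>
     Q t \<bullet> zigzag_class C weq X s Y = Q f"
proof (induction s arbitrary: Y rule: rev_induct)
  case Nil
  then have "X \<in> Obj C" "X = Y" by auto
  then show ?case
    using weq_Id Id_adm_mono Q_Id[of X] Id_Hom[of X] L.comp_id(1)[of "Id L X" X] L.id_simps[of X]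
    by (intro exI[of _ X] exI[of _ "Id C X"]) (auto simp: localization_simps(4))
next
  case (snoc x s)
  then obtain Y' where z: "zigzag C weq X s Y'" "zigzag C weq Y' [x] Y" using zigzag_append[OF category_axioms] by blast
  let ?s = "zigzag_class C weq X s Y'" and ?x = "zigzag_class C weq Y' [x] Y"
  have eq: "zigzag_class C weq X (s @ [x]) Y = ?x \<bullet> ?s" using localization_Comp[OF category_axioms z] by simp
  have S: "?s \<in> Arr L" "Dom L ?s = X" "Cod L ?s = Y'" "?x \<in> Arr L" "Dom L ?x = Y'" "Cod L ?x = Y"
    using zigzag_class_Arr[OF z(1)] zigzag_class_Arr[OF z(2)] by simp_all
  obtain Z f t where t: "f \<in> Hom C X Z" "t \<in> Hom C Y' Z" "t \<in> weq" "Q t \<bullet> ?s = Q f"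
    using snoc.IH[OF z(1)] by blast
  note H = t(1,2)[THEN HomD]
  show ?case
  proof (cases x)
    case (Fwd g)
    then have g: "g \<in> Hom C Y' Y" using z by (auto simp: Hom_def)
    have xg: "?x = Q g" using Fwd g by (simp add: loc_arr_def Hom_def)
    obtain Z' z' h where o: "z' \<in> Hom C Y Z'" "z' \<in> weq" "adm_mono conf z'" "h \<in> Hom C Z Z'" "h \<cdot> t \<sim> z' \<cdot> g"
      using ore[OF t(3,2) g] by blast
    note O = o(1,4)[THEN HomD] g[THEN HomD]
    have "Q (h \<cdot> t) = Q (z' \<cdot> g)" using Q_heq[OF o(5) comp_Hom[OF g o(1)]] .
    then have e: "Q z' \<bullet> Q g = Q h \<bullet> Q t" using O H by (simp add: Q_comp)
    have "Q z' \<bullet> (?x \<bullet> ?s) = Q h \<bullet> (Q t \<bullet> ?s)" unfolding xg using O H S L.comp_reassoc[OF e, of ?s] by simp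
    also have "\<dots> = Q (h \<cdot> f)" using t(4) H O by (simp add: Q_comp)
    finally show ?thesis unfolding eq using o(1-3) comp_Hom[OF t(1) o(4)] by blast
  next
    case (Bwd w)
    then have w: "w \<in> Hom C Y Y'" "w \<in> weq" using z by (auto simp: Hom_def)
    have xw: "Q w \<bullet> ?x = Id L Y'"
      using localization_inverse(3)[OF category_axioms, of w weq] Bwd w by (simp add: Hom_def)
    have tw: "t \<cdot> w \<in> weq" using weq_Comp[OF w(2) t(3)] w t by (simp add: Hom_def)
    \<comment> \<open>The new denominator need not be an inflation; the Ore condition against an
      identity composes it into one, up to a phantom map.\<close>
    obtain Z' z' h where o: "z' \<in> Hom C Y Z'" "z' \<in> weq" "adm_mono conf z'" "h \<in> Hom C Z Z'" "h \<cdot> (t \<cdot> w) \<sim> z' \<cdot> Id C Y"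
      using ore[OF tw comp_Hom[OF w(1) t(2)] Id_Hom[OF Hom_objs(1)[OF w(1)]]] by blast
    note O = o(1,4)[THEN HomD] w(1)[THEN HomD]
    have "Q (h \<cdot> (t \<cdot> w)) = Q z'" using Q_heq[OF o(5), of Y Z'] O Hom_objs[OF w(1)] by (simp add: Hom_def)
    then have e: "Q z' = Q h \<bullet> (Q t \<bullet> Q w)" using O H by (simp add: Q_comp)
    have "Q z' \<bullet> (?x \<bullet> ?s) = Q h \<bullet> (Q t \<bullet> ?s)"
      unfolding e using O H S by (simp add: L.comp_reassoc[OF xw])
    also have "\<dots> = Q (h \<cdot> f)" using t(4) H O by (simp add: Q_comp)
    finally show ?thesis unfolding eq using o(1-3) comp_Hom[OF t(1) o(4)] by blast
  qed
qed

lemma left_fraction: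
  assumes "u \<in> Hom L X Y"
  obtains Z f t where "f \<in> Hom C X Z" "t \<in> Hom C Y Z" "t \<in> weq" "adm_mono conf t" "Q t \<bullet> u = Q f"
proof -
  obtain s where "u = zigzag_class C weq X s Y" "zigzag C weq X s Y"
    using assms by (auto simp: Hom_def elim!: localization_ArrE)
  with left_fraction_zigzag[of X s Y] that show thesis by blast
qed

lemma right_fraction:
  assumes "u \<in> Hom L X Y"
  obtains Z f t where "f \<in> Hom C Z Y" "t \<in> Hom C Z X" "t \<in> weq" "adm_epi conf t" "u \<bullet> Q t = Q f"
proof -
  obtain Z f t where t: "f \<in> Hom C X Z" "t \<in> Hom C Y Z" "t \<in> weq" "Q t \<bullet> u = Q f" using left_fraction[OF assms] .
  \<comment> \<open>The dual Ore condition exchanges the denominator \<open>t\<close> on the left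
    for \<open>z\<close> on the right; afterwards \<open>Q t\<close> is cancelled.\<close>
  obtain V z g where z: "z \<in> Hom C V X" "z \<in> weq" "adm_epi conf z" "g \<in> Hom C V Y" "t \<cdot> g \<sim> f \<cdot> z"
    using ore'[OF t(3,2,1)] by blast
  note H = t(1,2)[THEN HomD] z(1,4)[THEN HomD] assms[THEN HomD]
  have "Q (t \<cdot> g) = Q (f \<cdot> z)" using Q_heq[OF z(5) comp_Hom[OF z(1) t(1)]] .
  then have "Q t \<bullet> (u \<bullet> Q z) = Q t \<bullet> Q g" using H by (simp add: Q_comp L.comp_reassoc[OF t(4)])
  then have "u \<bullet> Q z = Q g"
    by (rule loc_eqI[OF t(3,2), rotated 2]) (use H in \<open>simp_all add: Hom_def\<close>)
  with that[OF z(4,1-3)] show thesis by blast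
qed

text \<open>A cocone on a zigzag, commuting up to phantom maps. Passing to an equivalent zigzag only requires
  enlarging the vertex along a weak equivalence; as weak equivalences are monomorphisms up to phantom
  maps, morphisms that become equal in the localization differ by a phantom map.\<close>

primrec zigzag_cone where
  "zigzag_cone [] Z m m' \<longleftrightarrow> m \<sim> m'"
| "zigzag_cone (x # s) Z m m' \<longleftrightarrow> (case x of
     Fwd f \<Rightarrow> \<exists>n \<in> Hom C (Cod C f) Z. m \<sim> n \<cdot> f \<and> zigzag_cone s Z n m'
   | Bwd w \<Rightarrow> \<exists>n \<in> Hom C (Dom C w) Z. n \<sim> m \<cdot> w \<and> zigzag_cone s Z n m')"

lemma zigzag_cone_cong:
  assumes "zigzag C weq X s Y" "m \<in> Hom C X Z" "n \<in> Hom C X Z" "m' \<in> Hom C Y Z" "m \<sim> n" "zigzag_cone s Z n m'"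
  shows "zigzag_cone s Z m m'"
proof (cases s)
  case Nil
  then show ?thesis using assms heq_trans[of m n m' X Z] by auto
next
  case (Cons x s')
  show ?thesis
  proof (cases x)
    case (Fwd f)
    then obtain k where k: "k \<in> Hom C (Cod C f) Z" "n \<sim> k \<cdot> f" "zigzag_cone s' Z k m'" using assms Cons by auto
    have f: "f \<in> Hom C X (Cod C f)" using assms Cons Fwd by (auto simp: Hom_def)
    show ?thesis using heq_trans[OF assms(5) k(2) assms(2,3) comp_Hom[OF f k(1)]] k Cons Fwd by auto
  next
    case (Bwd w)
    then obtain k where k: "k \<in> Hom C (Dom C w) Z" "k \<sim> n \<cdot> w" "zigzag_cone s' Z k m'" using assms Cons by auto
    have w: "w \<in> Hom C (Dom C w) X" using assms Cons Bwd by (auto simp: Hom_def)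
    have "n \<cdot> w \<sim> m \<cdot> w" using heq_comp_right[OF heq_sym[OF assms(5,2,3)] assms(3,2) w] .
    then have "k \<sim> m \<cdot> w" using heq_trans[OF k(2) _ k(1)] comp_Hom[OF w] assms by blast
    then show ?thesis using k Cons Bwd by auto
  qed
qed

lemma zigzag_cone_append:
  "zigzag C weq X s Y \<Longrightarrow> zigzag C weq Y t V \<Longrightarrow> m \<in> Hom C X Z \<Longrightarrow> m' \<in> Hom C V Z \<Longrightarrow>
     zigzag_cone (s @ t) Z m m' \<longleftrightarrow> (\<exists>n \<in> Hom C Y Z. zigzag_cone s Z m n \<and> zigzag_cone t Z n m')"
proof (induction s arbitrary: X m)
  case Nil
  then have [simp]: "X = Y" by simp
  have "m \<sim> m" using heq_refl[of m] Nil.prems by (simp add: Hom_def)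
  then show ?case using zigzag_cone_cong[OF Nil.prems(2)] Nil.prems by auto
next
  case (Cons x s)
  show ?case
  proof (cases x)
    case (Fwd f)
    then have z: "zigzag C weq (Cod C f) s Y" using Cons.prems by simp
    show ?thesis using Cons.IH[OF z Cons.prems(2) _ Cons.prems(4)] Fwd by auto
  next
    case (Bwd w)
    then have z: "zigzag C weq (Dom C w) s Y" using Cons.prems by simp
    show ?thesis using Cons.IH[OF z Cons.prems(2) _ Cons.prems(4)] Bwd by auto
  qed
qed

lemma zigzag_cone_post:
  "zigzag C weq X s Y \<Longrightarrow> m \<in> Hom C X Z \<Longrightarrow> m' \<in> Hom C Y Z \<Longrightarrow> z \<in> Hom C Z Z' \<Longrightarrow> zigzag_cone s Z m m' \<Longrightarrow>
     zigzag_cone s Z' (z \<cdot> m) (z \<cdot> m')"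
proof (induction s arbitrary: X m)
  case Nil
  then show ?case using heq_comp_left[of m m' X Z z Z'] by auto
next
  case (Cons x s)
  show ?case
  proof (cases x)
    case (Fwd f)
    then obtain n where n: "n \<in> Hom C (Cod C f) Z" "m \<sim> n \<cdot> f" "zigzag_cone s Z n m'" using Cons.prems by auto
    have f: "f \<in> Hom C X (Cod C f)" "zigzag C weq (Cod C f) s Y" using Cons.prems Fwd by (auto simp: Hom_def)
    have "z \<cdot> m \<sim> (z \<cdot> n) \<cdot> f"
      using heq_comp_left[OF n(2) Cons.prems(2) comp_Hom[OF f(1) n(1)] Cons.prems(4)] f n(1) Cons.prems(4)
      by (simp add: Hom_def)
    then show ?thesis using Cons.IH[OF f(2) n(1) Cons.prems(3,4) n(3)] comp_Hom[OF n(1) Cons.prems(4)] Fwd by auto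
  next
    case (Bwd w)
    then obtain n where n: "n \<in> Hom C (Dom C w) Z" "n \<sim> m \<cdot> w" "zigzag_cone s Z n m'" using Cons.prems by auto
    have w: "w \<in> Hom C (Dom C w) X" "zigzag C weq (Dom C w) s Y" using Cons.prems Bwd by (auto simp: Hom_def)
    have "z \<cdot> n \<sim> (z \<cdot> m) \<cdot> w"
      using heq_comp_left[OF n(2,1) comp_Hom[OF w(1) Cons.prems(2)] Cons.prems(4)] w Cons.prems(2,4)
      by (simp add: Hom_def)
    then show ?thesis using Cons.IH[OF w(2) n(1) Cons.prems(3,4) n(3)] comp_Hom[OF n(1) Cons.prems(4)] Bwd by auto
  qed
qed

text \<open>The vertex has to be enlarged for one elementary move only, the insertion of
  \<open>[Fwd w, Bwd w]\<close>; in the other moves it can stay.\<close>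

definition cone_transfer where
  "cone_transfer X Y s t \<longleftrightarrow> (\<forall>Z m m'. m \<in> Hom C X Z \<and> m' \<in> Hom C Y Z \<and> zigzag_cone s Z m m' \<longrightarrow>
     (\<exists>Z' z. z \<in> Hom C Z Z' \<and> z \<in> weq \<and> zigzag_cone t Z' (z \<cdot> m) (z \<cdot> m')))"

lemma cone_transferI:
  assumes "\<And>Z m m'. m \<in> Hom C X Z \<Longrightarrow> m' \<in> Hom C Y Z \<Longrightarrow> zigzag_cone s Z m m' \<Longrightarrow> zigzag_cone t Z m m'"
  shows "cone_transfer X Y s t"
  unfolding cone_transfer_def
proof (intro allI impI; elim conjE)
  fix Z m m' assume m: "m \<in> Hom C X Z" "m' \<in> Hom C Y Z" "zigzag_cone s Z m m'"
  then have "zigzag_cone t Z (Id C Z \<cdot> m) (Id C Z \<cdot> m')"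
    using assms[OF m] m(1,2) by (simp add: Hom_def)
  then show "\<exists>Z' z. z \<in> Hom C Z Z' \<and> z \<in> weq \<and> zigzag_cone t Z' (z \<cdot> m) (z \<cdot> m')"
    using Hom_objs[OF m(1)] weq_Id Id_Hom by blast
qed

lemma cone_transfer_red:
  "zigzag_red C weq u v \<Longrightarrow> zigzag C weq X u Y \<Longrightarrow> zigzag C weq X v Y \<Longrightarrow>
     cone_transfer X Y u v \<and> cone_transfer X Y v u"
proof (induction rule: zigzag_red.induct)
  case (1 f g)
  then have H: "f \<in> Hom C X (Cod C f)" "g \<in> Hom C (Cod C f) Y" by (auto simp: Hom_def)
  have "zigzag_cone [Fwd (g \<cdot> f)] Z m m'"
    if m: "m \<in> Hom C X Z" "m' \<in> Hom C Y Z" "zigzag_cone [Fwd f, Fwd g] Z m m'" for Z m m'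
  proof -
    obtain n n' where n: "n \<in> Hom C (Cod C f) Z" "m \<sim> n \<cdot> f" "n' \<in> Hom C Y Z" "n \<sim> n' \<cdot> g" "n' \<sim> m'"
      using m H by (auto simp: Hom_def)
    have "n \<cdot> f \<sim> n' \<cdot> (g \<cdot> f)"
      using heq_comp_right[OF n(4,1) comp_Hom[OF H(2) n(3)] H(1)] H n(3) by (simp add: Hom_def)
    then have "m \<sim> n' \<cdot> (g \<cdot> f)"
      by (rule heq_trans[OF n(2), of _ X Z]) (use m H n in \<open>simp_all add: Hom_def\<close>)
    then show ?thesis using n H by (auto simp: Hom_def)
  qed
  moreover have "zigzag_cone [Fwd f, Fwd g] Z m m'"
    if m: "m \<in> Hom C X Z" "m' \<in> Hom C Y Z" "zigzag_cone [Fwd (g \<cdot> f)] Z m m'" for Z m m'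
  proof -
    obtain n where n: "n \<in> Hom C Y Z" "m \<sim> n \<cdot> (g \<cdot> f)" "n \<sim> m'" using m H by (auto simp: Hom_def)
    have "m \<sim> (n \<cdot> g) \<cdot> f" "n \<cdot> g \<sim> n \<cdot> g" using n H heq_refl[of "n \<cdot> g"] by (simp_all add: Hom_def)
    moreover have "n \<cdot> g \<in> Hom C (Cod C f) Z" using comp_Hom[OF H(2) n(1)] .
    moreover have "n \<in> Hom C (Cod C g) Z" using n(1) H by (simp add: Hom_def)
    ultimately show ?thesis using n(3) by auto
  qed
  ultimately show ?case by (blast intro: cone_transferI)
next
  case (2 A)
  then have o: "A = X" "X = Y" "X \<in> Obj C" by auto
  have "zigzag_cone [] Z m m'"
    if m: "m \<in> Hom C X Z" "m' \<in> Hom C Y Z" "zigzag_cone [Fwd (Id C X)] Z m m'" for Z m m'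
    using m o heq_trans[of m _ m' X Z] by (auto simp: Hom_def)
  moreover have "zigzag_cone [Fwd (Id C X)] Z m m'"
    if m: "m \<in> Hom C X Z" "m' \<in> Hom C Y Z" "zigzag_cone [] Z m m'" for Z m m'
    using m o heq_refl[of m] by (auto simp: Hom_def)
  ultimately show ?case unfolding o(1) by (blast intro: cone_transferI)
next
  case (3 w)
  then have o: "Dom C w = X" "X = Y" "w \<in> weq" and w: "w \<in> Hom C X (Cod C w)" by (auto simp: Hom_def)
  have "zigzag_cone [] Z m m'"
    if m: "m \<in> Hom C X Z" "m' \<in> Hom C Y Z" "zigzag_cone [Fwd w, Bwd w] Z m m'" for Z m m'
  proof -
    obtain n n' where n: "n \<in> Hom C (Cod C w) Z" "m \<sim> n \<cdot> w" "n' \<in> Hom C X Z" "n' \<sim> n \<cdot> w" "n' \<sim> m'"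
      using m o by auto
    note nw = comp_Hom[OF w n(1)]
    have "m \<sim> n'" using heq_trans[OF n(2) heq_sym[OF n(4,3) nw]] m(1) nw n(3) by blast
    then show ?thesis using heq_trans[OF _ n(5)] m n(3) o by auto
  qed
  moreover have "cone_transfer X Y [] [Fwd w, Bwd w]"
    unfolding cone_transfer_def
  proof (intro allI impI; elim conjE)
    fix Z m m' assume m: "m \<in> Hom C X Z" "m' \<in> Hom C Y Z" "zigzag_cone [] Z m m'"
    \<comment> \<open>The leg \<open>m\<close> has to be extended along \<open>w\<close>, which is
      possible only after composing with \<open>z\<close>.\<close>
    obtain Z' z g where z: "z \<in> Hom C Z Z'" "z \<in> weq" "g \<in> Hom C (Cod C w) Z'" "g \<cdot> w \<sim> z \<cdot> m"
      using ore[OF o(3) w m(1)] by blast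
    note H = comp_Hom[OF m(1) z(1)] comp_Hom[OF m(2)[folded o(2)] z(1)] comp_Hom[OF w z(3)]
    have 1: "z \<cdot> m \<sim> g \<cdot> w" using heq_sym[OF z(4) H(3,1)] .
    have "z \<cdot> m' \<sim> z \<cdot> m"
      using heq_comp_left[OF heq_sym[OF _ m(1) m(2)[folded o(2)]] m(2)[folded o(2)] m(1) z(1)] m(3) by simp
    then have "z \<cdot> m' \<sim> g \<cdot> w" using heq_trans[OF _ 1 H(2,1,3)] by blast
    moreover have "z \<cdot> m' \<sim> z \<cdot> m'" using heq_refl[of "z \<cdot> m'"] H by (simp add: Hom_def)
    ultimately have "zigzag_cone [Fwd w, Bwd w] Z' (z \<cdot> m) (z \<cdot> m')" using 1 z(3) H o by auto
    with z show "\<exists>Z' z. z \<in> Hom C Z Z' \<and> z \<in> weq \<and> zigzag_cone [Fwd w, Bwd w] Z' (z \<cdot> m) (z \<cdot> m')" by blast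
  qed
  ultimately show ?case by (blast intro: cone_transferI)
next
  case (4 w)
  then have o: "Cod C w = X" "X = Y" "w \<in> weq" and w: "w \<in> Hom C (Dom C w) X" by (auto simp: Hom_def)
  have "zigzag_cone [] Z m m'"
    if m: "m \<in> Hom C X Z" "m' \<in> Hom C Y Z" "zigzag_cone [Bwd w, Fwd w] Z m m'" for Z m m'
  proof -
    obtain n n' where n: "n \<in> Hom C (Dom C w) Z" "n \<sim> m \<cdot> w" "n' \<in> Hom C X Z" "n \<sim> n' \<cdot> w" "n' \<sim> m'"
      using m o by auto
    have "m \<cdot> w \<sim> n' \<cdot> w"
      using heq_trans[OF heq_sym[OF n(2,1)] n(4) _ n(1)] comp_Hom[OF w m(1)] comp_Hom[OF w n(3)] by blast
    \<comment> \<open>Here weak equivalences have to be epic modulo phantom maps.\<close>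
    then have "m \<sim> n'" using heq_cancel_right[OF o(3) w m(1) n(3)] by blast
    then show ?thesis using heq_trans[OF _ n(5)] m n(3) o by auto
  qed
  moreover have "zigzag_cone [Bwd w, Fwd w] Z m m'"
    if m: "m \<in> Hom C X Z" "m' \<in> Hom C Y Z" "zigzag_cone [] Z m m'" for Z m m'
  proof -
    have "m \<cdot> w \<sim> m' \<cdot> w" using m o heq_comp_right[of m m' X Z w "Dom C w"] w by simp
    moreover have "m \<cdot> w \<sim> m \<cdot> w" "m' \<sim> m'" using heq_refl m w o by (simp_all add: Hom_def)
    ultimately show ?thesis using comp_Hom[OF w m(1)] m o by auto
  qed
  ultimately show ?case by (blast intro: cone_transferI)
qed

text \<open>A cone on the whole zigzag splits at the two junctions; the middle piece is transferred,
  and the outer ones are composed with the same enlargement \<open>z\<close>.\<close>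

lemma cone_transfer_context:
  assumes "cone_transfer A B u v" "zigzag C weq X a A" "zigzag C weq A u B" "zigzag C weq A v B" "zigzag C weq B b Y"
  shows "cone_transfer X Y (a @ u @ b) (a @ v @ b)"
  unfolding cone_transfer_def
proof (intro allI impI; elim conjE)
  fix Z m m' assume m: "m \<in> Hom C X Z" "m' \<in> Hom C Y Z" "zigzag_cone (a @ u @ b) Z m m'"
  note app = zigzag_append[OF category_axioms]
  have ub: "zigzag C weq A (u @ b) Y" "zigzag C weq A (v @ b) Y" using assms app by blast+
  obtain n where n: "n \<in> Hom C A Z" "zigzag_cone a Z m n" "zigzag_cone (u @ b) Z n m'"
    using m zigzag_cone_append[OF assms(2) ub(1) m(1,2)] by blast
  obtain k where k: "k \<in> Hom C B Z" "zigzag_cone u Z n k" "zigzag_cone b Z k m'"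
    using n zigzag_cone_append[OF assms(3,5) n(1) m(2)] by blast
  obtain Z' z where z: "z \<in> Hom C Z Z'" "z \<in> weq" "zigzag_cone v Z' (z \<cdot> n) (z \<cdot> k)"
    using assms(1) n(1) k(1,2) unfolding cone_transfer_def by blast
  note H = comp_Hom[OF m(1) z(1)] comp_Hom[OF m(2) z(1)] comp_Hom[OF n(1) z(1)] comp_Hom[OF k(1) z(1)]
  have "zigzag_cone (v @ b) Z' (z \<cdot> n) (z \<cdot> m')"
    using zigzag_cone_append[OF assms(4,5) H(3,2)] z(3) zigzag_cone_post[OF assms(5) k(1) m(2) z(1) k(3)] H(4) by blast
  then have "zigzag_cone (a @ v @ b) Z' (z \<cdot> m) (z \<cdot> m')"
    using zigzag_cone_append[OF assms(2) ub(2) H(1,2)] zigzag_cone_post[OF assms(2) m(1) n(1) z(1) n(2)] H(3) by blast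
  with z show "\<exists>Z' z. z \<in> Hom C Z Z' \<and> z \<in> weq \<and> zigzag_cone (a @ v @ b) Z' (z \<cdot> m) (z \<cdot> m')" by blast
qed

lemma cone_transfer_trans:
  assumes "cone_transfer X Y s t" "cone_transfer X Y t r"
  shows "cone_transfer X Y s r"
  unfolding cone_transfer_def
proof (intro allI impI; elim conjE)
  fix Z m m' assume m: "m \<in> Hom C X Z" "m' \<in> Hom C Y Z" "zigzag_cone s Z m m'"
  obtain Z' z where z: "z \<in> Hom C Z Z'" "z \<in> weq" "zigzag_cone t Z' (z \<cdot> m) (z \<cdot> m')"
    using assms(1) m unfolding cone_transfer_def by blast
  obtain Z'' z' where z': "z' \<in> Hom C Z' Z''" "z' \<in> weq" "zigzag_cone r Z'' (z' \<cdot> (z \<cdot> m)) (z' \<cdot> (z \<cdot> m'))"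
    using assms(2) comp_Hom[OF m(1) z(1)] comp_Hom[OF m(2) z(1)] z(3) unfolding cone_transfer_def by blast
  have "zigzag_cone r Z'' ((z' \<cdot> z) \<cdot> m) ((z' \<cdot> z) \<cdot> m')" using z z' m by (simp add: Hom_def)
  moreover have "z' \<cdot> z \<in> weq" using weq_Comp z z' by (simp add: Hom_def)
  ultimately show "\<exists>Z' z. z \<in> Hom C Z Z' \<and> z \<in> weq \<and> zigzag_cone r Z' (z \<cdot> m) (z \<cdot> m')"
    using comp_Hom[OF z(1) z'(1)] by blast
qed

lemma zigzag_eq_cone_transfer:
  "zigzag_eq C weq X Y s t \<Longrightarrow> cone_transfer X Y s t \<and> cone_transfer X Y t s"
proof (induction rule: zigzag_eq.induct)
  case (red u v a b)
  note app = zigzag_append[OF category_axioms]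
  obtain A B where 1: "zigzag C weq X a A" "zigzag C weq A u B" "zigzag C weq B b Y"
    using red(2) app by metis
  obtain A' B' where 2: "zigzag C weq X a A'" "zigzag C weq A' v B'" "zigzag C weq B' b Y"
    using red(3) app by metis
  \<comment> \<open>The context of \<open>zigzag_target\<close> and \<open>zigzag_red_ends\<close>
    asks for a functor inverting the weak equivalences; the localization functor is taken.\<close>
  note loc = category_axioms L.category_axioms localization_functor[OF category_axioms]
    localization_inverts[OF category_axioms]
  have A: "A' = A" using zigzag_target[OF loc 2(1) 1(1)] by blast
  have B: "B' = B" using zigzag_red_ends[OF loc red(1) 1(2) 2(2)[unfolded A]] by blast
  note 3 = 2[unfolded A B]
  have "cone_transfer A B u v \<and> cone_transfer A B v u" by (rule cone_transfer_red[OF red(1) 1(2) 3(2)])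
  then show ?case using cone_transfer_context[OF _ 1(1,2) 3(2) 1(3)] cone_transfer_context[OF _ 1(1) 3(2) 1(2,3)] by blast
next
  case (refl s)
  then show ?case by (auto intro: cone_transferI)
qed (blast intro: cone_transfer_trans)+

lemma Q_faithful:
  assumes "f \<in> Hom C X Y" "g \<in> Hom C X Y" "Q f = Q g"
  shows "f \<sim> g"
proof -
  note o = Hom_objs[OF assms(1)]
  have z: "zigzag C weq X [Fwd f] Y" using assms(1) o by (simp add: Hom_def)
  have "zigzag_class C weq X [Fwd f] Y = zigzag_class C weq X [Fwd g] Y"
    using assms by (simp add: loc_arr_def Hom_def)
  then have "zigzag_eq C weq X Y [Fwd f] [Fwd g]" using zigzag_class_eq_iff[OF z] by blast
  then have t: "cone_transfer X Y [Fwd f] [Fwd g]" using zigzag_eq_cone_transfer by blast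
  \<comment> \<open>The tautological cone on \<open>f\<close>. Transferred to \<open>g\<close> it
    yields \<open>z \<cdot> f \<sim> z \<cdot> g\<close> for a weak equivalence \<open>z\<close>,
    which is monic modulo phantom maps.\<close>
  have "zigzag_cone [Fwd f] Y f (Id C Y)"
    unfolding zigzag_cone.simps step.case
    by (rule bexI[of _ "Id C Y"]) (use assms(1) o heq_refl[of f] heq_refl[of "Id C Y"] in \<open>simp_all add: Hom_def\<close>)
  then obtain Z z where z: "z \<in> Hom C Y Z" "z \<in> weq" "zigzag_cone [Fwd g] Z (z \<cdot> f) (z \<cdot> Id C Y)"
    using t assms(1) Id_Hom[OF o(2)] unfolding cone_transfer_def by blast
  obtain n where n: "n \<in> Hom C Y Z" "z \<cdot> f \<sim> n \<cdot> g" "n \<sim> z"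
    using z(1,3) assms(2) o by (auto simp: Hom_def)
  have "z \<cdot> f \<sim> z \<cdot> g"
    using heq_trans[OF n(2) heq_comp_right[OF n(3,1) z(1) assms(2)]] comp_Hom assms(1,2) z(1) n(1) by blast
  then show ?thesis using heq_cancel_left[OF z(2,1) assms(1,2)] by blast
qed

lemma Q_eq_iff: "f \<in> Hom C X Y \<Longrightarrow> g \<in> Hom C X Y \<Longrightarrow> Q f = Q g \<longleftrightarrow> f \<sim> g"
  using Q_faithful Q_heq by blast


section \<open>The additive structure of the localization\<close>

text \<open>Addition over a common denominator \<open>s\<close>, first as a relation, so that
  independence of the representation becomes a single uniqueness statement.\<close>

definition loc_add_rel where
  "loc_add_rel u v x \<longleftrightarrow> (\<exists>X Y Z s f g. u \<in> Hom L X Y \<and> v \<in> Hom L X Y \<and> x \<in> Hom L X Y \<and> s \<in> Hom C Y Z \<and> s \<in> weq \<and>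
     f \<in> Hom C X Z \<and> g \<in> Hom C X Z \<and> Q s \<bullet> u = Q f \<and> Q s \<bullet> v = Q g \<and> Q s \<bullet> x = Q (add f g))"

definition loc_add where "loc_add u v = (THE x. loc_add_rel u v x)"
definition loc_null where "loc_null A B = Q (null A B)"

text \<open>An Ore square makes the two denominators equal modulo phantom maps. The numerators are
  then equal in the localization, hence congruent by \<open>Q_eq_iff\<close>, and
  \<open>\<sim>\<close> respects sums.\<close>

lemma loc_add_rel_unique:
  assumes "loc_add_rel u v x" "loc_add_rel u v x'"
  shows "x = x'"
proof -
  obtain X Y Z s f g where 1: "u \<in> Hom L X Y" "v \<in> Hom L X Y" "x \<in> Hom L X Y" "s \<in> Hom C Y Z" "s \<in> weq"
     "f \<in> Hom C X Z" "g \<in> Hom C X Z" "Q s \<bullet> u = Q f" "Q s \<bullet> v = Q g" "Q s \<bullet> x = Q (add f g)"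
    using assms(1) unfolding loc_add_rel_def by metis
  obtain X' Y' Z' s' f' g' where 2: "u \<in> Hom L X' Y'" "v \<in> Hom L X' Y'" "x' \<in> Hom L X' Y'" "s' \<in> Hom C Y' Z'" "s' \<in> weq"
     "f' \<in> Hom C X' Z'" "g' \<in> Hom C X' Z'" "Q s' \<bullet> u = Q f'" "Q s' \<bullet> v = Q g'" "Q s' \<bullet> x' = Q (add f' g')"
    using assms(2) unfolding loc_add_rel_def by metis
  have XY: "X' = X" "Y' = Y" using 1(1) 2(1) by (simp_all add: Hom_def)
  note 2 = 2[unfolded XY]
  obtain V t t' where t: "t \<in> Hom C Z V" "t \<in> weq" "t' \<in> Hom C Z' V" "t' \<cdot> s' \<sim> t \<cdot> s"
    using ore[OF 2(5,4) 1(4)] by blast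
  note H = 1(4,6,7)[THEN HomD] 2(4,6,7)[THEN HomD] t(1,3)[THEN HomD]
    1(1-3)[THEN HomD] 2(1-3)[THEN HomD]
  have e: "Q t' \<bullet> Q s' = Q t \<bullet> Q s" using Q_heq[OF t(4) comp_Hom[OF 1(4) t(1)]] H by (simp add: Q_comp)
  have 3: "Q t \<bullet> (Q s \<bullet> y) = Q t' \<bullet> (Q s' \<bullet> y)" if "y \<in> Hom L X Y" for y
    using L.comp_reassoc[OF e, of y] that H by (simp add: Hom_def)
  have "Q (t \<cdot> f) = Q (t' \<cdot> f')" "Q (t \<cdot> g) = Q (t' \<cdot> g')"
    using 3[OF 1(1)] 3[OF 1(2)] 1(8,9) 2(8,9) H by (simp_all add: Q_comp)
  then have "t \<cdot> f \<sim> t' \<cdot> f'" "t \<cdot> g \<sim> t' \<cdot> g'"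
    using H by (simp_all add: Q_eq_iff[of _ X V] Hom_def)
  then have "add (t \<cdot> f) (t \<cdot> g) \<sim> add (t' \<cdot> f') (t' \<cdot> g')"
    by (rule heq_add[of _ _ _ _ X V]) (use H in \<open>simp_all add: Hom_def\<close>)
  then have "Q (t \<cdot> add f g) = Q (t' \<cdot> add f' g')"
    by (subst Q_eq_iff[of _ X V]) (use H in \<open>simp_all add: Hom_def\<close>)
  then have "Q t \<bullet> (Q s \<bullet> x) = Q t' \<bullet> (Q s' \<bullet> x')" using 1(10) 2(10) H by (simp add: Q_comp del: comp_add)
  then have "Q t \<bullet> (Q s \<bullet> x) = Q t \<bullet> (Q s \<bullet> x')" using 3[OF 2(3)] by simp
  then have "Q s \<bullet> x = Q s \<bullet> x'"
    by (rule loc_eqI[OF t(2,1), rotated 2]) (use H in \<open>simp_all add: Hom_def\<close>)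
  then show ?thesis by (rule loc_eqI[OF 1(5,4,3) 2(3)])
qed

lemma loc_add:
  assumes "u \<in> Hom L X Y" "v \<in> Hom L X Y" "s \<in> Hom C Y Z" "s \<in> weq" "f \<in> Hom C X Z" "g \<in> Hom C X Z"
    "Q s \<bullet> u = Q f" "Q s \<bullet> v = Q g"
  shows "loc_add u v \<in> Hom L X Y" "Q s \<bullet> loc_add u v = Q (add f g)"
proof -
  obtain x where x: "x \<in> Hom L X Y" "Q s \<bullet> x = Q (add f g)"
    using ex_loc_left[OF assms(4,3) Q_Hom[OF add_Hom[OF assms(5,6)]]] by blast
  then have r: "loc_add_rel u v x" unfolding loc_add_rel_def using assms by blast
  then have "loc_add u v = x" unfolding loc_add_def using loc_add_rel_unique by blast
  with x show "loc_add u v \<in> Hom L X Y" "Q s \<bullet> loc_add u v = Q (add f g)" by auto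
qed

lemma common_denominator:
  assumes "u \<in> Hom L X Y" "v \<in> Hom L X' Y"
  obtains Z s f g where "s \<in> Hom C Y Z" "s \<in> weq" "f \<in> Hom C X Z" "g \<in> Hom C X' Z" "Q s \<bullet> u = Q f" "Q s \<bullet> v = Q g"
proof -
  obtain Z f s where 1: "f \<in> Hom C X Z" "s \<in> Hom C Y Z" "s \<in> weq" "Q s \<bullet> u = Q f" using left_fraction[OF assms(1)] .
  obtain Z' g t where 2: "g \<in> Hom C X' Z'" "t \<in> Hom C Z Z'" "t \<in> weq" "Q t \<bullet> (Q s \<bullet> v) = Q g"
    using left_fraction[OF L.comp_Hom[OF assms(2) Q_Hom[OF 1(2)]]] .
  note H = 1(1,2)[THEN HomD] 2(1,2)[THEN HomD]
     assms[THEN HomD]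
  show thesis
    by (rule that[of "t \<cdot> s" Z' "t \<cdot> f" g])
      (use H 1 2 weq_Comp[of s t] in \<open>simp_all add: Hom_def Q_comp\<close>)
qed

lemma loc_add_Hom: "u \<in> Hom L X Y \<Longrightarrow> v \<in> Hom L X Y \<Longrightarrow> loc_add u v \<in> Hom L X Y"
  using common_denominator[of u X Y v X] loc_add(1)[of u X Y v] by metis

lemma Q_add:
  assumes "f \<in> Hom C X Y" "g \<in> Hom C X Y"
  shows "Q (add f g) = loc_add (Q f) (Q g)"
proof -
  note o = Hom_objs[OF assms(1)]
  have I: "Q (Id C Y) \<bullet> u = u" if "u \<in> Hom L X Y" for u using that o by (simp add: Q_Id Hom_def)
  have "Q (Id C Y) \<bullet> loc_add (Q f) (Q g) = Q (add f g)"
    by (rule loc_add(2)[OF Q_Hom[OF assms(1)] Q_Hom[OF assms(2)] Id_Hom[OF o(2)] weq_Id[OF o(2)] assms])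
      (use I[OF Q_Hom] assms in auto)
  then show ?thesis using I[OF loc_add_Hom[OF Q_Hom[OF assms(1)] Q_Hom[OF assms(2)]]] by simp
qed

lemma loc_null_Hom: "A \<in> Obj C \<Longrightarrow> B \<in> Obj C \<Longrightarrow> loc_null A B \<in> Hom L A B"
  unfolding loc_null_def by (rule Q_Hom, rule null_Hom)

text \<open>Write \<open>x\<close> as \<open>r \<bullet> Q s\<close> and \<open>r\<close> as a left
  fraction over \<open>t\<close>: then all terms are left fractions over \<open>t\<close>.\<close>

lemma loc_add_comp_left:
  assumes "u \<in> Hom L X Y" "v \<in> Hom L X Y" "x \<in> Hom L Y W"
  shows "x \<bullet> loc_add u v = loc_add (x \<bullet> u) (x \<bullet> v)"
proof -
  obtain Z s f g where 1: "s \<in> Hom C Y Z" "s \<in> weq" "f \<in> Hom C X Z" "g \<in> Hom C X Z" "Q s \<bullet> u = Q f" "Q s \<bullet> v = Q g"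
    using common_denominator[OF assms(1,2)] .
  obtain r where r: "r \<in> Hom L Z W" "r \<bullet> Q s = x" using ex_loc_right[OF 1(2,1) assms(3)] by blast
  obtain V h t where t: "h \<in> Hom C Z V" "t \<in> Hom C W V" "t \<in> weq" "Q t \<bullet> r = Q h" using left_fraction[OF r(1)] .
  note a = loc_add_Hom[OF assms(1,2)]
  note H = 1(1,3,4)[THEN HomD] r(1)[THEN HomD] t(1,2)[THEN HomD]
    assms[THEN HomD] a[THEN HomD]
  have 2: "Q t \<bullet> (x \<bullet> y) = Q h \<bullet> (Q s \<bullet> y)" if "y \<in> Hom L X Y" for y
    using that H r(2)[symmetric] by (simp add: Hom_def L.comp_reassoc[OF t(4)])
  have "Q t \<bullet> loc_add (x \<bullet> u) (x \<bullet> v) = Q (add (h \<cdot> f) (h \<cdot> g))"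
    by (rule loc_add(2)[of _ X W]) (use H t(3) 2[OF assms(1)] 2[OF assms(2)] 1(5,6) in \<open>simp_all add: Hom_def Q_comp\<close>)
  also have "\<dots> = Q (h \<cdot> add f g)" using H by simp
  also have "\<dots> = Q h \<bullet> (Q s \<bullet> loc_add u v)" using loc_add(2)[OF assms(1,2) 1] H by (simp add: Q_comp del: comp_add)
  also have "\<dots> = Q t \<bullet> (x \<bullet> loc_add u v)" using 2[OF a] by simp
  finally have "Q t \<bullet> loc_add (x \<bullet> u) (x \<bullet> v) = Q t \<bullet> (x \<bullet> loc_add u v)" .
  from loc_eqI[OF t(3,2) loc_add_Hom[OF L.comp_Hom[OF assms(1,3)] L.comp_Hom[OF assms(2,3)]] L.comp_Hom[OF a assms(3)] this]
  show ?thesis by simp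
qed

lemma loc_add_comp_Q:
  assumes "u \<in> Hom L X Y" "v \<in> Hom L X Y" "t \<in> Hom C W X"
  shows "loc_add u v \<bullet> Q t = loc_add (u \<bullet> Q t) (v \<bullet> Q t)"
proof -
  obtain Z s f g where 1: "s \<in> Hom C Y Z" "s \<in> weq" "f \<in> Hom C X Z" "g \<in> Hom C X Z" "Q s \<bullet> u = Q f" "Q s \<bullet> v = Q g"
    using common_denominator[OF assms(1,2)] .
  note a = loc_add_Hom[OF assms(1,2)]
  note H = 1(1,3,4)[THEN HomD] assms[THEN HomD] a[THEN HomD]
  have "Q s \<bullet> loc_add (u \<bullet> Q t) (v \<bullet> Q t) = Q (add (f \<cdot> t) (g \<cdot> t))"
    by (rule loc_add(2)[of _ W Y])
      (use H 1(2) in \<open>simp_all add: Hom_def Q_comp L.comp_reassoc[OF 1(5)] L.comp_reassoc[OF 1(6)]\<close>)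
  also have "\<dots> = Q (add f g \<cdot> t)" using H by simp
  also have "\<dots> = Q s \<bullet> (loc_add u v \<bullet> Q t)"
    using L.comp_reassoc[OF loc_add(2)[OF assms(1,2) 1], of "Q t"] H by (simp add: Q_comp del: comp_add)
  finally have e: "Q s \<bullet> loc_add (u \<bullet> Q t) (v \<bullet> Q t) = Q s \<bullet> (loc_add u v \<bullet> Q t)" .
  note T = Q_Hom[OF assms(3)]
  from loc_eqI[OF 1(2,1) loc_add_Hom[OF L.comp_Hom[OF T assms(1)] L.comp_Hom[OF T assms(2)]] L.comp_Hom[OF T a] e]
  show ?thesis by simp
qed

text \<open>Sums are defined by left fractions, so \<open>x\<close> is written as a right fraction:
  its denominator can be cancelled on the right, and precomposition with \<open>Q h\<close> leaves
  the left denominators alone.\<close>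

lemma loc_add_comp_right:
  assumes "u \<in> Hom L X Y" "v \<in> Hom L X Y" "x \<in> Hom L W X"
  shows "loc_add u v \<bullet> x = loc_add (u \<bullet> x) (v \<bullet> x)"
proof -
  obtain V h t where t: "h \<in> Hom C V X" "t \<in> Hom C V W" "t \<in> weq" "x \<bullet> Q t = Q h" using right_fraction[OF assms(3)] .
  note a = loc_add_Hom[OF assms(1,2)] and b = L.comp_Hom[OF assms(3,1)] L.comp_Hom[OF assms(3,2)]
  note H = t(1,2)[THEN HomD]
    assms[THEN HomD] a[THEN HomD]
  have "loc_add (u \<bullet> x) (v \<bullet> x) \<bullet> Q t = loc_add ((u \<bullet> x) \<bullet> Q t) ((v \<bullet> x) \<bullet> Q t)"
    by (rule loc_add_comp_Q[OF b t(2)])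
  also have "\<dots> = loc_add (u \<bullet> Q h) (v \<bullet> Q h)" using H t(4) by simp
  also have "\<dots> = (loc_add u v \<bullet> x) \<bullet> Q t" using loc_add_comp_Q[OF assms(1,2) t(1)] H t(4) by simp
  finally have e: "loc_add (u \<bullet> x) (v \<bullet> x) \<bullet> Q t = (loc_add u v \<bullet> x) \<bullet> Q t" .
  from loc_eqI'[OF t(3,2) loc_add_Hom[OF b] L.comp_Hom[OF assms(3) a] e]
  show ?thesis by simp
qed

lemma loc_comm_group:
  assumes "A \<in> Obj C" "B \<in> Obj C"
  shows "comm_group (hom_group L loc_add loc_null A B)"
proof (rule comm_groupI)
  have c: "carrier (hom_group L loc_add loc_null A B) = Hom L A B" "mult (hom_group L loc_add loc_null A B) = loc_add"
    "one (hom_group L loc_add loc_null A B) = loc_null A B" by (simp_all add: hom_group_def)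
  let ?G = "hom_group L loc_add loc_null A B"
  \<comment> \<open>The zero arrow has a zero numerator over every denominator.\<close>
  have repN: "Q s \<bullet> loc_null A B = Q (null A Z)" if "s \<in> Hom C B Z" for s Z
    unfolding loc_null_def using that assms Q_comp[of "null A B" s] by (simp add: Hom_def)
  show "x \<otimes>\<^bsub>?G\<^esub> y \<in> carrier ?G" if "x \<in> carrier ?G" "y \<in> carrier ?G" for x y
    using that loc_add_Hom unfolding c by blast
  show "\<one>\<^bsub>?G\<^esub> \<in> carrier ?G" unfolding c using loc_null_Hom assms by blast
  show "x \<otimes>\<^bsub>?G\<^esub> y \<otimes>\<^bsub>?G\<^esub> z = x \<otimes>\<^bsub>?G\<^esub> (y \<otimes>\<^bsub>?G\<^esub> z)"
    if "x \<in> carrier ?G" "y \<in> carrier ?G" "z \<in> carrier ?G" for x y z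
  proof -
    note X = that[unfolded c]
    obtain Z s f g where 1: "s \<in> Hom C B Z" "s \<in> weq" "f \<in> Hom C A Z" "g \<in> Hom C A Z" "Q s \<bullet> x = Q f" "Q s \<bullet> y = Q g"
      using common_denominator[OF X(1,2)] .
    obtain V t h k where 2: "t \<in> Hom C Z V" "t \<in> weq" "h \<in> Hom C A V" "Q t \<bullet> (Q s \<bullet> z) = Q h"
      using left_fraction[OF L.comp_Hom[OF X(3) Q_Hom[OF 1(1)]]] by metis
    note H = 1(1,3,4)[THEN HomD] 2(1,3)[THEN HomD] X[THEN HomD]
    have 3: "t \<cdot> s \<in> Hom C B V" "t \<cdot> s \<in> weq" "t \<cdot> f \<in> Hom C A V" "t \<cdot> g \<in> Hom C A V"
      "Q (t \<cdot> s) \<bullet> x = Q (t \<cdot> f)" "Q (t \<cdot> s) \<bullet> y = Q (t \<cdot> g)" "Q (t \<cdot> s) \<bullet> z = Q h"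
      using H 1(2,5,6) 2(2,4) weq_Comp[of s t] by (simp_all add: Hom_def Q_comp)
    note xy = loc_add[OF X(1,2) 3(1-6)] and yz = loc_add[OF X(2,3) 3(1,2,4) 2(3) 3(6,7)]
    note xyz = loc_add[OF xy(1) X(3) 3(1,2) add_Hom[OF 3(3,4)] 2(3) xy(2) 3(7)]
    note xyz' = loc_add[OF X(1) yz(1) 3(1,2,3) add_Hom[OF 3(4) 2(3)] 3(5) yz(2)]
    have "add (add (t \<cdot> f) (t \<cdot> g)) h = add (t \<cdot> f) (add (t \<cdot> g) h)"
      using 3(3,4) 2(3) by (intro add_assoc) (simp_all add: Hom_def)
    then show ?thesis unfolding c using loc_eqI[OF 3(2,1) xyz(1) xyz'(1)] xyz(2) xyz'(2) by simp
  qed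
  show "x \<otimes>\<^bsub>?G\<^esub> y = y \<otimes>\<^bsub>?G\<^esub> x" if "x \<in> carrier ?G" "y \<in> carrier ?G" for x y
  proof -
    note X = that[unfolded c]
    obtain Z s f g where 1: "s \<in> Hom C B Z" "s \<in> weq" "f \<in> Hom C A Z" "g \<in> Hom C A Z" "Q s \<bullet> x = Q f" "Q s \<bullet> y = Q g"
      using common_denominator[OF X(1,2)] .
    have "add f g = add g f" using 1 by (intro add_commute) (simp_all add: Hom_def)
    then show ?thesis unfolding c
      using loc_eqI[OF 1(2,1) loc_add_Hom[OF X] loc_add_Hom[OF X(2,1)]] loc_add(2)[OF X 1] loc_add(2)[OF X(2,1) 1(1,2,4,3,6,5)]
      by simp
  qed
  show "\<one>\<^bsub>?G\<^esub> \<otimes>\<^bsub>?G\<^esub> x = x" if "x \<in> carrier ?G" for x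
  proof -
    note X = that[unfolded c] and N = loc_null_Hom[OF assms]
    obtain Z f s where 1: "f \<in> Hom C A Z" "s \<in> Hom C B Z" "s \<in> weq" "Q s \<bullet> x = Q f" using left_fraction[OF X] .
    note n = null_Hom[OF assms(1) Hom_objs(2)[OF 1(2)]]
    have "add (null A Z) f = f" using 1(1) by (simp add: Hom_def)
    then show ?thesis unfolding c
      using loc_eqI[OF 1(3,2) loc_add_Hom[OF N X] X] loc_add(2)[OF N X 1(2,3) n 1(1) repN[OF 1(2)] 1(4)] 1(4) by simp
  qed
  show "\<exists>y\<in>carrier ?G. y \<otimes>\<^bsub>?G\<^esub> x = \<one>\<^bsub>?G\<^esub>" if "x \<in> carrier ?G" for x
  proof -
    note X = that[unfolded c] and N = loc_null_Hom[OF assms]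
    obtain Z f s where 1: "f \<in> Hom C A Z" "s \<in> Hom C B Z" "s \<in> weq" "Q s \<bullet> x = Q f" using left_fraction[OF X] .
    obtain y where y: "y \<in> Hom L A B" "Q s \<bullet> y = Q (neg f)"
      using ex_loc_left[OF 1(3,2) Q_Hom[OF neg_Hom[OF 1(1)]]] by blast
    have "add (neg f) f = null A Z" using 1(1) by (simp add: Hom_def)
    then have "loc_add y x = loc_null A B"
      using loc_eqI[OF 1(3,2) loc_add_Hom[OF y(1) X] N] loc_add(2)[OF y(1) X 1(2,3) neg_Hom[OF 1(1)] 1(1) y(2) 1(4)]
        repN[OF 1(2)] by simp
    then show ?thesis unfolding c using y(1) by blast
  qed
qed

end

sublocale exact_model_structure \<subseteq> L: preadditive_category "localization C weq" loc_add loc_null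
  by (intro preadditive_category.intro L.category_axioms preadditive_category_axioms.intro)
    (simp_all add: loc_comm_group loc_add_comp_left loc_add_comp_right)

context exact_model_structure
begin

lemma zero_object_loc:
  assumes "zero_object C Z"
  shows "zero_object L Z"
proof (rule L.zero_objectI)
  show "Z \<in> Obj L" using zero_ObjD[OF assms] by simp
  show "Id L Z = loc_null Z Z" using zero_ObjD[OF assms] zero_Id[OF assms] Q_Id[of Z] by (simp add: loc_null_def)
qed

lemma is_biproduct_loc:
  assumes "is_biproduct C add null A B P i j p q"
  shows "is_biproduct L loc_add loc_null A B P (Q i) (Q j) (Q p) (Q q)"
proof -
  have b: "i \<in> Hom C A P" "j \<in> Hom C B P" "p \<in> Hom C P A" "q \<in> Hom C P B" "p \<cdot> i = Id C A" "q \<cdot> j = Id C B"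
    "p \<cdot> j = null B A" "q \<cdot> i = null A B" "add (i \<cdot> p) (j \<cdot> q) = Id C P"
    using assms by (auto simp: is_biproduct_def)
  note H = b(1-4)[THEN HomD] and o = Hom_objs[OF b(1)] Hom_objs[OF b(2)]
  have "Q p \<bullet> Q i = Id L A" "Q q \<bullet> Q j = Id L B" "Q p \<bullet> Q j = loc_null B A" "Q q \<bullet> Q i = loc_null A B"
    unfolding loc_null_def Q_Id[OF o(1), symmetric] Q_Id[OF o(3), symmetric] b(5-8)[symmetric]
    using H by (simp_all add: Q_comp)
  moreover have "loc_add (Q i \<bullet> Q p) (Q j \<bullet> Q q) = Id L P"
    using Q_add[of "i \<cdot> p" P P "j \<cdot> q"] H b(9) o by (simp add: Q_comp Q_Id Hom_def)
  ultimately show ?thesis unfolding is_biproduct_def using Q_Hom b by blast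
qed

end

sublocale exact_model_structure \<subseteq> L: additive_category "localization C weq" loc_add loc_null
proof
  show "\<exists>Z. zero_object L Z" using ex_zero_object zero_object_loc by blast
  show "\<exists>P\<in>Obj L. \<exists>i j p q. is_biproduct L loc_add loc_null A B P i j p q" if "A \<in> Obj L" "B \<in> Obj L" for A B
  proof -
    from that have "A \<in> Obj C" "B \<in> Obj C" by simp_all
    then obtain P i j p q where "P \<in> Obj C" "is_biproduct C add null A B P i j p q" using ex_biproduct by blast
    then show ?thesis unfolding localization_simps using is_biproduct_loc by blast
  qed
qed


section \<open>The suspension functor\<close>

text \<open>An instance of two-out-of-six. The inverse \<open>k\<close> of
  \<open>g \<cdot> f\<close> gives the left inverse \<open>k \<cdot> g\<close> of \<open>f\<close>.
  It is also a right inverse, since \<open>g\<close> does not distinguish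
  \<open>f \<cdot> (k \<cdot> g)\<close> from the identity and is monic because
  \<open>h \<cdot> g\<close> is invertible.\<close>

lemma (in category) iso_of_one_sided:
  assumes f: "f \<in> Hom C A B" and g: "g \<in> Hom C B D" and h: "h \<in> Hom C D E"
    and gf: "iso_arr C (g \<cdot> f)" and hg: "iso_arr C (h \<cdot> g)"
  shows "iso_arr C f"
proof -
  obtain k where k: "k \<in> Hom C D A" "k \<cdot> (g \<cdot> f) = Id C A" "(g \<cdot> f) \<cdot> k = Id C D"
    using iso_arrE[OF gf comp_Hom[OF f g]] .
  note H = f[THEN HomD] g[THEN HomD] h[THEN HomD]
    k(1)[THEN HomD]
  have "f \<cdot> (k \<cdot> g) = Id C B"
  proof (rule iso_cancel_left[OF hg comp_Hom[OF g h]])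
    have "g \<cdot> (f \<cdot> (k \<cdot> g)) = g" using H k(3) comp_reassoc[OF k(3), of g] by simp
    then show "(h \<cdot> g) \<cdot> (f \<cdot> (k \<cdot> g)) = (h \<cdot> g) \<cdot> Id C B" using H by simp
  qed (use H Hom_objs[OF g] in \<open>simp_all add: Hom_def\<close>)
  then show ?thesis using H k(2) by (intro iso_arrI[OF f, of "k \<cdot> g"]) (simp_all add: Hom_def)
qed

lemma (in category) equivalence_of_fully_faithful:
  assumes F: "is_functor C C Fo Fm"
    and faithful: "\<And>A B f g. f \<in> Hom C A B \<Longrightarrow> g \<in> Hom C A B \<Longrightarrow> Fm f = Fm g \<Longrightarrow> f = g"
    and full: "\<And>A B h. A \<in> Obj C \<Longrightarrow> B \<in> Obj C \<Longrightarrow> h \<in> Hom C (Fo A) (Fo B) \<Longrightarrow> \<exists>f \<in> Hom C A B. Fm f = h"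
    and surj: "\<And>X. X \<in> Obj C \<Longrightarrow> \<exists>K \<in> Obj C. \<exists>e \<in> Hom C (Fo K) X. iso_arr C e"
  shows "is_equivalence C C Fo Fm"
proof -
  \<comment> \<open>Preimage, isomorphism and inverse are chosen together as one triple.\<close>
  have "\<forall>X \<in> Obj C. \<exists>t. fst t \<in> Obj C \<and> fst (snd t) \<in> Hom C (Fo (fst t)) X \<and> snd (snd t) \<in> Hom C X (Fo (fst t)) \<and>
      snd (snd t) \<cdot> fst (snd t) = Id C (Fo (fst t)) \<and> fst (snd t) \<cdot> snd (snd t) = Id C X"
  proof
    fix X assume "X \<in> Obj C"
    then obtain K e where K: "K \<in> Obj C" "e \<in> Hom C (Fo K) X" "iso_arr C e" using surj by blast
    obtain e' where "e' \<in> Hom C X (Fo K)" "e' \<cdot> e = Id C (Fo K)" "e \<cdot> e' = Id C X" using iso_arrE[OF K(3,2)] .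
    with K show "\<exists>t. fst t \<in> Obj C \<and> fst (snd t) \<in> Hom C (Fo (fst t)) X \<and> snd (snd t) \<in> Hom C X (Fo (fst t)) \<and>
      snd (snd t) \<cdot> fst (snd t) = Id C (Fo (fst t)) \<and> fst (snd t) \<cdot> snd (snd t) = Id C X"
      by (intro exI[of _ "(K, e, e')"]) simp
  qed
  then obtain t where t: "\<forall>X \<in> Obj C. fst (t X) \<in> Obj C \<and> fst (snd (t X)) \<in> Hom C (Fo (fst (t X))) X \<and>
      snd (snd (t X)) \<in> Hom C X (Fo (fst (t X))) \<and>
      snd (snd (t X)) \<cdot> fst (snd (t X)) = Id C (Fo (fst (t X))) \<and> fst (snd (t X)) \<cdot> snd (snd (t X)) = Id C X"
    unfolding bchoice_iff by blast
  define G e e' where "G X = fst (t X)" and "e X = fst (snd (t X))" and "e' X = snd (snd (t X))" for X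
  have G: "G X \<in> Obj C" and e: "e X \<in> Hom C (Fo (G X)) X" and e': "e' X \<in> Hom C X (Fo (G X))"
    and e'e: "e' X \<cdot> e X = Id C (Fo (G X))" and ee': "e X \<cdot> e' X = Id C X" if "X \<in> Obj C" for X
    using t that by (auto simp: G_def e_def e'_def)
  have eA: "e X \<in> Arr C" "Dom C (e X) = Fo (G X)" "Cod C (e X) = X" "e' X \<in> Arr C" "Dom C (e' X) = X" "Cod C (e' X) = Fo (G X)"
    if "X \<in> Obj C" for X using e[OF that] e'[OF that] by (simp_all add: Hom_def)
  have FO: "Fo A \<in> Obj C" if "A \<in> Obj C" for A using F that by (simp add: is_functor_def)
  have FH: "Fm f \<in> Hom C (Fo A) (Fo B)" if "f \<in> Hom C A B" for f A B using F that by (auto simp: is_functor_def Hom_def)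
  have FA: "Fm f \<in> Arr C" "Dom C (Fm f) = Fo (Dom C f)" "Cod C (Fm f) = Fo (Cod C f)" if "f \<in> Arr C" for f
    using FH[of f "Dom C f" "Cod C f"] that by (simp_all add: Hom_def)
  have FI: "Fm (Id C A) = Id C (Fo A)" if "A \<in> Obj C" for A using F that by (simp add: is_functor_def)
  have FC: "Fm (g \<cdot> f) = Fm g \<cdot> Fm f" if "f \<in> Arr C" "g \<in> Arr C" "Cod C f = Dom C g" for f g
    using F that by (simp add: is_functor_def)
  have "\<forall>f \<in> Arr C. \<exists>h. h \<in> Hom C (G (Dom C f)) (G (Cod C f)) \<and> Fm h = e' (Cod C f) \<cdot> (f \<cdot> e (Dom C f))"
  proof
    fix f assume f: "f \<in> Arr C"
    then have "e' (Cod C f) \<cdot> (f \<cdot> e (Dom C f)) \<in> Hom C (Fo (G (Dom C f))) (Fo (G (Cod C f)))"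
      using eA[of "Dom C f"] eA[of "Cod C f"] by (simp add: Hom_def)
    with full[OF G G] f show "\<exists>h. h \<in> Hom C (G (Dom C f)) (G (Cod C f)) \<and> Fm h = e' (Cod C f) \<cdot> (f \<cdot> e (Dom C f))"
      by (metis Dom_Cod_Obj)
  qed
  then obtain Gm where "\<forall>f \<in> Arr C. Gm f \<in> Hom C (G (Dom C f)) (G (Cod C f)) \<and> Fm (Gm f) = e' (Cod C f) \<cdot> (f \<cdot> e (Dom C f))"
    unfolding bchoice_iff by blast
  then have Gm: "Gm f \<in> Hom C (G A) (G B)" "Fm (Gm f) = e' B \<cdot> (f \<cdot> e A)" if "f \<in> Hom C A B" for f A B
    using that by (auto simp: Hom_def)
  have fGm: "is_functor C C G Gm"
    unfolding is_functor_def
  proof (intro conjI ballI impI)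
    show "Gm (Id C A) = Id C (G A)" if A: "A \<in> Obj C" for A
    proof (rule faithful[OF Gm(1)[OF Id_Hom[OF A]] Id_Hom[OF G[OF A]]])
      show "Fm (Gm (Id C A)) = Fm (Id C (G A))"
        using Gm(2)[OF Id_Hom[OF A]] FI[OF G[OF A]] e'e[OF A] eA[OF A] A by simp
    qed
    show "Gm (g \<cdot> f) = Gm g \<cdot> Gm f" if fg: "f \<in> Arr C" "g \<in> Arr C" "Cod C f = Dom C g" for f g
    proof -
      let ?A = "Dom C f" and ?B = "Dom C g" and ?D = "Cod C g"
      have H: "f \<in> Hom C ?A ?B" "g \<in> Hom C ?B ?D" "g \<cdot> f \<in> Hom C ?A ?D" using fg by (simp_all add: Hom_def)
      have o: "?A \<in> Obj C" "?B \<in> Obj C" "?D \<in> Obj C" using fg by simp_all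
      show ?thesis
      proof (rule faithful[OF Gm(1)[OF H(3)] comp_Hom[OF Gm(1)[OF H(1)] Gm(1)[OF H(2)]]])
        have "Fm (Gm g \<cdot> Gm f) = (e' ?D \<cdot> (g \<cdot> e ?B)) \<cdot> (e' ?B \<cdot> (f \<cdot> e ?A))"
          using FC[of "Gm f" "Gm g"] Gm[OF H(1)] Gm[OF H(2)] by (simp add: Hom_def)
        also have "\<dots> = e' ?D \<cdot> (g \<cdot> (f \<cdot> e ?A))"
          using fg eA[OF o(1)] eA[OF o(2)] eA[OF o(3)] by (simp add: comp_reassoc[OF ee'[OF o(2)]])
        finally show "Fm (Gm (g \<cdot> f)) = Fm (Gm g \<cdot> Gm f)" using Gm(2)[OF H(3)] fg eA[OF o(1)] by simp
      qed
    qed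
  qed (use G Gm(1) in \<open>auto simp: Hom_def\<close>)
  have eps: "nat_iso C C (Fo \<circ> G) (Fm \<circ> Gm) id id e"
    unfolding nat_iso_def
  proof (intro conjI ballI)
    show "e A \<in> Hom C ((Fo \<circ> G) A) (id A)" "iso_arr C (e A)" if "A \<in> Obj C" for A
      using e[OF that] iso_arrI[OF e[OF that] e'[OF that] e'e[OF that] ee'[OF that]] by auto
    show "e (Cod C f) \<cdot> (Fm \<circ> Gm) f = id f \<cdot> e (Dom C f)" if f: "f \<in> Arr C" for f
      using Gm(2)[of f "Dom C f" "Cod C f"] f eA[of "Dom C f"] eA[of "Cod C f"]
      by (simp add: Hom_def comp_reassoc[OF ee'])
  qed
  \<comment> \<open>The unit at \<open>A\<close> is the preimage of the inverse counit at
    \<open>Fo A\<close>; naturality is then checked after applying \<open>Fm\<close>.\<close>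
  have "\<forall>A \<in> Obj C. \<exists>h. h \<in> Hom C A (G (Fo A)) \<and> Fm h = e' (Fo A)"
    using full[OF _ G[OF FO] e'[OF FO]] by blast
  then obtain n where n: "\<And>A. A \<in> Obj C \<Longrightarrow> n A \<in> Hom C A (G (Fo A))" "\<And>A. A \<in> Obj C \<Longrightarrow> Fm (n A) = e' (Fo A)"
    unfolding bchoice_iff by blast
  have eta: "nat_iso C C id id (G \<circ> Fo) (Gm \<circ> Fm) n"
    unfolding nat_iso_def
  proof (intro conjI ballI)
    fix A assume A: "A \<in> Obj C"
    show "n A \<in> Hom C (id A) ((G \<circ> Fo) A)" using n(1)[OF A] by simp
    obtain m where m: "m \<in> Hom C (G (Fo A)) A" "Fm m = e (Fo A)" using full[OF G[OF FO[OF A]] A e[OF FO[OF A]]] by blast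
    have "m \<cdot> n A = Id C A"
    proof (rule faithful[OF comp_Hom[OF n(1)[OF A] m(1)] Id_Hom[OF A]])
      show "Fm (m \<cdot> n A) = Fm (Id C A)"
        using FC[of "n A" m] n[OF A] m ee'[OF FO[OF A]] FI[OF A] by (simp add: Hom_def)
    qed
    moreover have "n A \<cdot> m = Id C (G (Fo A))"
    proof (rule faithful[OF comp_Hom[OF m(1) n(1)[OF A]] Id_Hom[OF G[OF FO[OF A]]]])
      show "Fm (n A \<cdot> m) = Fm (Id C (G (Fo A)))"
        using FC[of m "n A"] n[OF A] m e'e[OF FO[OF A]] FI[OF G[OF FO[OF A]]] by (simp add: Hom_def)
    qed
    ultimately show "iso_arr C (n A)" using iso_arrI[OF n(1)[OF A] m(1)] by blast
  next
    fix f assume f: "f \<in> Arr C"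
    let ?A = "Dom C f" and ?B = "Cod C f"
    have fH: "f \<in> Hom C ?A ?B" using f by (simp add: Hom_def)
    have o: "?A \<in> Obj C" "?B \<in> Obj C" using f by simp_all
    note g = Gm[OF FH[OF fH]]
    have "n ?B \<cdot> f = Gm (Fm f) \<cdot> n ?A"
    proof (rule faithful[OF comp_Hom[OF fH n(1)[OF o(2)]] comp_Hom[OF n(1)[OF o(1)] g(1)]])
      have "Fm (n ?B \<cdot> f) = e' (Fo ?B) \<cdot> Fm f"
        using FC[of f "n ?B"] n[OF o(2)] f by (simp add: Hom_def)
      moreover have "Fm (Gm (Fm f) \<cdot> n ?A) = (e' (Fo ?B) \<cdot> (Fm f \<cdot> e (Fo ?A))) \<cdot> e' (Fo ?A)"
        using FC[of "n ?A" "Gm (Fm f)"] n[OF o(1)] g by (simp add: Hom_def)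
      moreover have "\<dots> = e' (Fo ?B) \<cdot> Fm f"
        using FA[OF f] eA[OF FO[OF o(1)]] eA[OF FO[OF o(2)]] ee'[OF FO[OF o(1)]] by simp
      ultimately show "Fm (n ?B \<cdot> f) = Fm (Gm (Fm f) \<cdot> n ?A)" by simp
    qed
    then show "n (Cod C f) \<cdot> id f = (Gm \<circ> Fm) f \<cdot> n (Dom C f)" by simp
  qed
  show ?thesis unfolding is_equivalence_def using F fGm eps eta by blast
qed

context exact_model_structure
begin

lemma Q_neg: "f \<in> Arr C \<Longrightarrow> Q (neg f) = L.neg (Q f)"
  using L.neg_unique[of "Q f" "Dom C f" "Cod C f" "Q (neg f)"] Q_add[of f "Dom C f" "Cod C f" "neg f"]
  by (simp add: Hom_def loc_null_def)

lemma Q_susp_map_comp: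
  assumes "f \<in> Hom C A B" "g \<in> Hom C B D"
  shows "Q (susp_map (g \<cdot> f)) = Q (susp_map g) \<bullet> Q (susp_map f)"
  using Q_heq[OF susp_map_comp[OF assms] susp_map_Hom[OF comp_Hom[OF assms]]]
    susp_map_Hom[OF assms(1)] susp_map_Hom[OF assms(2)] by (simp add: Hom_def Q_comp)

lemma Q_susp_map_Id: "A \<in> Obj C \<Longrightarrow> Q (susp_map (Id C A)) = Id L (susp A)"
  using Q_heq[OF susp_map_Id[of A], of "susp A" "susp A"] cflD[OF susp(1), of A] by (simp add: Q_Id Id_Hom)

lemma Q_susp_map_heq: "f \<sim> g \<Longrightarrow> f \<in> Hom C A B \<Longrightarrow> g \<in> Hom C A B \<Longrightarrow> Q (susp_map f) = Q (susp_map g)"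
  using Q_heq[OF susp_map_heq susp_map_Hom] by blast

text \<open>The Ore condition for \<open>f\<close> against an identity gives \<open>g\<close> with
  \<open>g \<cdot> f\<close> congruent to an inflation. Applied first to \<open>f\<close> and then
  to the \<open>g\<close> so found, this prepares \<open>iso_of_one_sided\<close>.\<close>

lemma weq_extend_adm_mono:
  assumes "f \<in> weq" "f \<in> Hom C A B"
  shows "\<exists>Z g. g \<in> Hom C B Z \<and> g \<in> weq \<and> iso_arr L (Q (susp_map g) \<bullet> Q (susp_map f))"
proof -
  note o = Hom_objs[OF assms(2)]
  obtain Z z g where z: "z \<in> Hom C A Z" "z \<in> weq" "adm_mono conf z" "g \<in> Hom C B Z" "g \<cdot> f \<sim> z \<cdot> Id C A"
    using ore[OF assms Id_Hom[OF o(1)]] by blast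
  have e: "z \<cdot> Id C A = z" using z(1) o by (simp add: Hom_def)
  note gf = comp_Hom[OF assms(2) z(4)]
  have "g \<cdot> f \<in> weq" using heq_weq[OF heq_sym[OF _ gf z(1)] gf z(2)] z(5) e by simp
  then have g: "g \<in> weq" using weq_cancel_right[OF assms(1), of g] assms z(4) by (simp add: Hom_def)
  obtain c where "(z, c) \<in> conf" using z(3) by (auto simp: adm_mono_def)
  then obtain N where c: "cfl A z Z c N" using cflI[of z c] z(1) by (auto simp: conflation_def Hom_def)
  have "iso_arr L (Q (susp_map z))" using Q_iso[OF susp_map_weq_adm_mono[OF c z(2)]] .
  moreover have "Q (susp_map g) \<bullet> Q (susp_map f) = Q (susp_map z)"
    using Q_susp_map_comp[OF assms(2) z(4)] Q_susp_map_heq[OF _ gf z(1)] z(5) e by simp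
  ultimately have "iso_arr L (Q (susp_map g) \<bullet> Q (susp_map f))" by simp
  then show ?thesis using z(4) g by blast
qed

lemma susp_map_weq_iso:
  assumes "f \<in> weq" "f \<in> Hom C A B"
  shows "iso_arr L (Q (susp_map f))"
proof -
  obtain Z g where g: "g \<in> Hom C B Z" "g \<in> weq" "iso_arr L (Q (susp_map g) \<bullet> Q (susp_map f))"
    using weq_extend_adm_mono[OF assms] by blast
  obtain Y h where h: "h \<in> Hom C Z Y" "iso_arr L (Q (susp_map h) \<bullet> Q (susp_map g))"
    using weq_extend_adm_mono[OF g(2,1)] by blast
  show ?thesis
    using L.iso_of_one_sided[OF Q_Hom[OF susp_map_Hom[OF assms(2)]] Q_Hom[OF susp_map_Hom[OF g(1)]]
        Q_Hom[OF susp_map_Hom[OF h(1)]] g(3) h(2)] .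
qed

lemma susp_Obj [simp]: "A \<in> Obj C \<Longrightarrow> susp A \<in> Obj C"
  by (rule cflD(9)[OF susp(1)])

definition susp_loc where
  "susp_loc = (SOME G. is_functor L L susp G \<and> (\<forall>f \<in> Arr C. G (Q f) = Q (susp_map f)))"

lemma susp_loc:
  "is_functor L L susp susp_loc" "f \<in> Arr C \<Longrightarrow> susp_loc (Q f) = Q (susp_map f)"
proof -
  have "is_functor C L susp (\<lambda>f. Q (susp_map f))"
    unfolding is_functor_def
  proof (intro conjI ballI impI)
    show "Q (susp_map f) \<in> Hom L (susp (Dom C f)) (susp (Cod C f))" if "f \<in> Arr C" for f
      using Q_Hom[OF susp_map_Hom] that by (simp add: Hom_def)
    show "Q (susp_map (g \<cdot> f)) = Q (susp_map g) \<bullet> Q (susp_map f)"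
      if "f \<in> Arr C" "g \<in> Arr C" "Cod C f = Dom C g" for f g
      using that by (intro Q_susp_map_comp) (auto simp: Hom_def)
  qed (use Q_susp_map_Id in auto)
  moreover have "iso_arr L (Q (susp_map w))" if "w \<in> Arr C \<inter> weq" for w
    using susp_map_weq_iso[of w "Dom C w" "Cod C w"] that by (simp add: Hom_def)
  ultimately obtain Go Gm where G: "is_functor L L Go Gm" "\<forall>A \<in> Obj C. Go A = susp A" "\<forall>f \<in> Arr C. Gm (Q f) = Q (susp_map f)"
    using localization_universal_aux[OF category_axioms L.category_axioms, of susp "\<lambda>f. Q (susp_map f)" weq] by blast
  have "Dom L f \<in> Obj C" "Cod L f \<in> Obj C" if "f \<in> Arr L" for f
    using L.Dom_Cod_Obj[OF that] by simp_all
  \<comment> \<open>The universal property yields an object map that agrees with \<open>susp\<close>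
    only on objects of the category; it is exchanged for \<open>susp\<close> itself.\<close>
  then have "is_functor L L susp Gm" using G(1,2) unfolding is_functor_def by simp
  then have "\<exists>G. is_functor L L susp G \<and> (\<forall>f \<in> Arr C. G (Q f) = Q (susp_map f))" using G(3) by blast
  from someI_ex[OF this] show "is_functor L L susp susp_loc" "f \<in> Arr C \<Longrightarrow> susp_loc (Q f) = Q (susp_map f)"
    unfolding susp_loc_def by blast+
qed

lemma susp_loc_Hom: "u \<in> Hom L A B \<Longrightarrow> susp_loc u \<in> Hom L (susp A) (susp B)"
  using susp_loc(1) by (auto simp: is_functor_def Hom_def)

lemma susp_loc_simps [simp]:
  "u \<in> Arr L \<Longrightarrow> susp_loc u \<in> Arr L" "u \<in> Arr L \<Longrightarrow> Dom L (susp_loc u) = susp (Dom L u)"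
  "u \<in> Arr L \<Longrightarrow> Cod L (susp_loc u) = susp (Cod L u)"
  using susp_loc_Hom[of u "Dom L u" "Cod L u"] by (simp_all add: Hom_def)

lemma susp_loc_Id [simp]: "A \<in> Obj C \<Longrightarrow> susp_loc (Id L A) = Id L (susp A)"
  using susp_loc(1) by (simp add: is_functor_def)

lemma susp_loc_comp: "u \<in> Arr L \<Longrightarrow> v \<in> Arr L \<Longrightarrow> Cod L u = Dom L v \<Longrightarrow> susp_loc (v \<bullet> u) = susp_loc v \<bullet> susp_loc u"
  using susp_loc(1) by (simp add: is_functor_def)

lemma susp_loc_iso:
  assumes "iso_arr L u" "u \<in> Hom L A B"
  shows "iso_arr L (susp_loc u)"
proof -
  obtain v where v: "v \<in> Hom L B A" "v \<bullet> u = Id L A" "u \<bullet> v = Id L B" using L.iso_arrE[OF assms] .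
  have "susp_loc v \<bullet> susp_loc u = Id L (susp A)" "susp_loc u \<bullet> susp_loc v = Id L (susp B)"
    using v assms(2) L.Hom_objs[OF assms(2)] by (simp_all add: Hom_def flip: susp_loc_comp)
  then show ?thesis using L.iso_arrI susp_loc_Hom assms(2) v(1) by blast
qed

lemma susp_loc_add:
  assumes "u \<in> Hom L X Y" "v \<in> Hom L X Y"
  shows "susp_loc (loc_add u v) = loc_add (susp_loc u) (susp_loc v)"
proof -
  obtain Z s f g where 1: "s \<in> Hom C Y Z" "s \<in> weq" "f \<in> Hom C X Z" "g \<in> Hom C X Z" "Q s \<bullet> u = Q f" "Q s \<bullet> v = Q g"
    using common_denominator[OF assms] .
  note H = 1(1,3,4)[THEN HomD] assms[THEN HomD]
  have "susp_loc (Q s) \<bullet> susp_loc (loc_add u v) = susp_loc (Q (add f g))"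
    using loc_add(2)[OF assms 1] H by (simp flip: susp_loc_comp)
  also have "\<dots> = loc_add (Q (susp_map f)) (Q (susp_map g))"
    using Q_heq[OF susp_map_add[OF 1(3,4)] susp_map_Hom[OF add_Hom[OF 1(3,4)]]]
      Q_add[OF susp_map_Hom[OF 1(3)] susp_map_Hom[OF 1(4)]] H by (simp add: susp_loc(2))
  also have "\<dots> = loc_add (susp_loc (Q s \<bullet> u)) (susp_loc (Q s \<bullet> v))"
    unfolding 1(5,6) using H by (simp add: susp_loc(2))
  also have "\<dots> = susp_loc (Q s) \<bullet> loc_add (susp_loc u) (susp_loc v)"
    using H by (simp add: susp_loc_comp)
  finally have e: "susp_loc (Q s) \<bullet> susp_loc (loc_add u v) = susp_loc (Q s) \<bullet> loc_add (susp_loc u) (susp_loc v)" .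
  have "iso_arr L (susp_loc (Q s))" by (rule susp_loc_iso[OF Q_iso[OF 1(2)] Q_Hom[OF 1(1)]])
  then show ?thesis
    by (rule L.iso_cancel_left[OF _ susp_loc_Hom[OF Q_Hom[OF 1(1)]] susp_loc_Hom[OF loc_add_Hom[OF assms]]
        loc_add_Hom[OF susp_loc_Hom[OF assms(1)] susp_loc_Hom[OF assms(2)]] e])
qed

lemma susp_loc_null: "A \<in> Obj C \<Longrightarrow> B \<in> Obj C \<Longrightarrow> susp_loc (loc_null A B) = loc_null (susp A) (susp B)"
proof -
  assume o: "A \<in> Obj C" "B \<in> Obj C"
  note n = loc_null_Hom[OF o] and m = susp_loc_Hom[OF loc_null_Hom[OF o]]
  have "loc_add (susp_loc (loc_null A B)) (susp_loc (loc_null A B)) = loc_add (susp_loc (loc_null A B)) (loc_null (susp A) (susp B))"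
    using susp_loc_add[OF n n] o m n by (simp add: Hom_def)
  then show ?thesis by (rule L.add_cancel[rotated 7]) (use o m in \<open>simp_all add: Hom_def\<close>)
qed

lemma susp_loc_neg:
  assumes "u \<in> Hom L A B"
  shows "susp_loc (L.neg u) = L.neg (susp_loc u)"
proof (rule L.neg_unique[OF susp_loc_Hom[OF assms] susp_loc_Hom[OF L.neg_Hom[OF assms]]])
  show "loc_add (susp_loc u) (susp_loc (L.neg u)) = loc_null (susp A) (susp B)"
    using susp_loc_add[OF assms L.neg_Hom[OF assms]] susp_loc_null L.Hom_objs[OF assms] assms by (simp add: Hom_def)
qed


section \<open>The connecting morphism of a conflation\<close>

text \<open>The relation records all choices. \<open>c\<close> is an honest map for the pulled back
  conflation, whose quotient \<open>D'\<close> is cofibrant, and \<open>d\<close> is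
  \<open>c\<close> divided by \<open>w\<close>.\<close>

definition conn_rel where
  "conn_rel i p d \<longleftrightarrow> (\<exists>A B D D' B' w w' i' p' c. cfl A i B p D \<and> w \<in> fib \<inter> weq \<and> w \<in> Hom C D' D \<and> cofb D' \<and>
     pullback C D B D' B' p w p' w' \<and> cfl A i' B' p' D' \<and> w' \<cdot> i' = i \<and> cfl_to_susp i' p' A (Id C A) c \<and>
     d \<in> Hom L D (susp A) \<and> d \<bullet> Q w = Q c)"

lemma ex_conn:
  assumes "cfl A i B p D"
  shows "\<exists>d. conn_rel i p d"
proof -
  obtain D' w where w: "w \<in> fib \<inter> weq" "w \<in> Hom C D' D" "cofb D'"
    using ex_cofibrant_replacement[OF cflD(9)[OF assms]] by blast
  obtain B' p' w' i' where pb: "pullback C D B D' B' p w p' w'" "cfl A i' B' p' D'" "w' \<cdot> i' = i"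
    using ex_pullback[OF assms w(2)] by blast
  obtain c where c: "cfl_to_susp i' p' A (Id C A) c"
    using ex_cfl_to_susp[OF pb(2) w(3) Id_Hom[OF cflD(7)[OF pb(2)]]] by blast
  obtain d where "d \<in> Hom L D (susp A)" "d \<bullet> Q w = Q c"
    using ex_loc_right[OF _ w(2) Q_Hom[OF cfl_to_susp_Hom[OF c pb(2)]]] w(1) by blast
  then show ?thesis unfolding conn_rel_def using assms w pb c by blast
qed

text \<open>Cofibrancy lifts \<open>g\<close> to the replacements, and the pullback property then
  lifts \<open>b\<close>. Both \<open>c2 \<cdot> g'\<close> and \<open>susp_map a \<cdot> c1\<close>
  now belong to \<open>a\<close> in the sense of \<open>cfl_to_susp\<close>, so they are congruent.
  For identity maps this is independence of the choices.\<close>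

lemma conn_rel_natural:
  assumes r: "conn_rel i1 p1 d1" "conn_rel i2 p2 d2" and c: "cfl A1 i1 B1 p1 D1" "cfl A2 i2 B2 p2 D2"
    and m: "a \<in> Hom C A1 A2" "b \<in> Hom C B1 B2" "g \<in> Hom C D1 D2" "b \<cdot> i1 = i2 \<cdot> a" "g \<cdot> p1 = p2 \<cdot> b"
  shows "susp_loc (Q a) \<bullet> d1 = d2 \<bullet> Q g"
proof -
  have same: "A' = A \<and> B' = B \<and> D' = D" if "cfl A i B p D" "cfl A' i B' p D'" for A i B p D A' B' D'
    using cflD[OF that(1)] cflD[OF that(2)] by simp
  obtain X1 Y1 w1 v1 j1 q1 c1 where 1: "w1 \<in> fib \<inter> weq" "w1 \<in> Hom C X1 D1" "cofb X1"
     "pullback C D1 B1 X1 Y1 p1 w1 q1 v1" "cfl A1 j1 Y1 q1 X1" "v1 \<cdot> j1 = i1" "cfl_to_susp j1 q1 A1 (Id C A1) c1"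
     "d1 \<in> Hom L D1 (susp A1)" "d1 \<bullet> Q w1 = Q c1"
    using r(1) same[OF c(1)] unfolding conn_rel_def by metis
  obtain X2 Y2 w2 v2 j2 q2 c2 where 2: "w2 \<in> fib \<inter> weq" "w2 \<in> Hom C X2 D2" "cofb X2"
     "pullback C D2 B2 X2 Y2 p2 w2 q2 v2" "cfl A2 j2 Y2 q2 X2" "v2 \<cdot> j2 = i2" "cfl_to_susp j2 q2 A2 (Id C A2) c2"
     "d2 \<in> Hom L D2 (susp A2)" "d2 \<bullet> Q w2 = Q c2"
    using r(2) same[OF c(2)] unfolding conn_rel_def by metis
  note P1 = pullbackD[OF 1(4)] and P2 = pullbackD[OF 2(4)]
  note h = cflD[OF c(1)] cflD[OF c(2)] cflD[OF 1(5)] cflD[OF 2(5)]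
  obtain g' where g': "g' \<in> Hom C X1 X2" "w2 \<cdot> g' = g \<cdot> w1"
    using cofb_lift[OF 1(3) 2(1,2) comp_Hom[OF 1(2) m(3)]] by blast
  note H = P1(3,4)[THEN HomD] P2(3,4)[THEN HomD] m(1-3)[THEN HomD]
    g'(1)[THEN HomD] 1(2)[THEN HomD] 2(2)[THEN HomD]
  have "w2 \<cdot> (g' \<cdot> q1) = (g \<cdot> w1) \<cdot> q1" using H h by (simp add: comp_reassoc[OF g'(2)])
  also have "\<dots> = (g \<cdot> p1) \<cdot> v1" using H h P1(5)[symmetric] by simp
  also have "\<dots> = p2 \<cdot> (b \<cdot> v1)" unfolding m(5) using H h by simp
  finally obtain b' where b': "b' \<in> Hom C Y1 Y2" "q2 \<cdot> b' = g' \<cdot> q1" "v2 \<cdot> b' = b \<cdot> v1"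
    using P2(6)[of "g' \<cdot> q1" Y1 "b \<cdot> v1"] H h by (auto simp: Hom_def)
  have bj: "b' \<cdot> j1 = j2 \<cdot> a"
  proof (rule P2(7)[of _ A1])
    show "q2 \<cdot> (b' \<cdot> j1) = q2 \<cdot> (j2 \<cdot> a)" using H h b'(1) by (simp add: Hom_def comp_reassoc[OF b'(2)])
    show "v2 \<cdot> (b' \<cdot> j1) = v2 \<cdot> (j2 \<cdot> a)"
      using H h b'(1) by (simp add: Hom_def comp_reassoc[OF b'(3)] comp_reassoc[OF 2(6)] 1(6) m(4))
  qed (use H h b'(1) in \<open>simp_all add: Hom_def\<close>)
  have "cfl_to_susp j1 q1 A2 (Id C A2 \<cdot> a) (c2 \<cdot> g')"
    by (rule cfl_to_susp_pre[OF 2(7,5) 1(5) Id_Hom m(1) b'(1) g'(1) bj b'(2)[symmetric]]) (use h in simp)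
  moreover have "cfl_to_susp j1 q1 A2 (a \<cdot> Id C A1) (susp_map a \<cdot> c1)"
    by (rule cfl_to_susp_post[OF 1(7,5) Id_Hom m(1)]) (use h in simp)
  ultimately have eq: "c2 \<cdot> g' \<sim> susp_map a \<cdot> c1"
    using cfl_to_susp_unique[OF _ _ 1(5), of A2 a] H h by simp
  note C = cfl_to_susp_Hom[OF 1(7,5)] cfl_to_susp_Hom[OF 2(7,5)] susp_map_Hom[OF m(1)]
  note CC = C[THEN HomD] and dd = 1(8)[THEN HomD] 2(8)[THEN HomD]
  have e2: "Q w2 \<bullet> Q g' = Q g \<bullet> Q w1" using H g'(2) Q_comp[of g' w2] Q_comp[of w1 g] by simp
  have "(d2 \<bullet> Q g) \<bullet> Q w1 = (d2 \<bullet> Q w2) \<bullet> Q g'" using dd H e2 by simp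
  also have "\<dots> = Q (c2 \<cdot> g')" using 2(9) CC H by (simp add: Q_comp)
  also have "\<dots> = Q (susp_map a \<cdot> c1)" using Q_heq[OF eq comp_Hom[OF C(1,3)]] .
  also have "\<dots> = (susp_loc (Q a) \<bullet> d1) \<bullet> Q w1" using 1(9) CC H dd by (simp add: Q_comp susp_loc(2))
  finally have e: "(d2 \<bullet> Q g) \<bullet> Q w1 = (susp_loc (Q a) \<bullet> d1) \<bullet> Q w1" .
  have "w1 \<in> weq" using 1(1) by simp
  from loc_eqI'[OF this 1(2) L.comp_Hom[OF Q_Hom[OF m(3)] 2(8)] L.comp_Hom[OF 1(8) susp_loc_Hom[OF Q_Hom[OF m(1)]]] e]
  show ?thesis by simp
qed

definition conn where "conn i p = (SOME d. conn_rel i p d)"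

lemma conn_rel: "cfl A i B p D \<Longrightarrow> conn_rel i p (conn i p)"
  unfolding conn_def using someI_ex[OF ex_conn] .

lemma conn_natural:
  assumes "cfl A1 i1 B1 p1 D1" "cfl A2 i2 B2 p2 D2"
    "a \<in> Hom C A1 A2" "b \<in> Hom C B1 B2" "g \<in> Hom C D1 D2" "b \<cdot> i1 = i2 \<cdot> a" "g \<cdot> p1 = p2 \<cdot> b"
  shows "susp_loc (Q a) \<bullet> conn i1 p1 = conn i2 p2 \<bullet> Q g"
  using conn_rel_natural[OF conn_rel[OF assms(1)] conn_rel[OF assms(2)] assms] .

lemma conn_Hom:
  assumes "cfl A i B p D"
  shows "conn i p \<in> Hom L D (susp A)"
proof -
  obtain A' B' D' where "cfl A' i B' p D'" "conn i p \<in> Hom L D' (susp A')"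
    using conn_rel[OF assms] unfolding conn_rel_def by blast
  then show ?thesis using cflD[OF assms] cflD[of A' i B' p D'] by simp
qed

text \<open>Whenever an honest map \<open>k\<close> exists, with \<open>D\<close> cofibrant or not,
  its restriction along the replacement of \<open>D\<close> is again induced by the identity of
  \<open>A\<close>, so uniqueness modulo phantom maps applies.\<close>

lemma conn_eq:
  assumes c: "cfl A i B p D" and k: "cfl_to_susp i p A (Id C A) k"
  shows "conn i p = Q k"
proof -
  note h = cflD[OF c]
  have same: "A' = A \<and> B' = B \<and> D' = D" if "cfl A' i B' p D'" for A' B' D'
    using h cflD[OF that] by simp
  obtain X1 Y1 w1 v1 j1 q1 c1 where 1: "w1 \<in> fib \<inter> weq" "w1 \<in> Hom C X1 D" "cofb X1"
     "pullback C D B X1 Y1 p w1 q1 v1" "cfl A j1 Y1 q1 X1" "v1 \<cdot> j1 = i" "cfl_to_susp j1 q1 A (Id C A) c1"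
     "conn i p \<bullet> Q w1 = Q c1"
    using conn_rel[OF c] same unfolding conn_rel_def by metis
  note P = pullbackD[OF 1(4)]
  have I: "Id C A \<in> Hom C A A" using h by (simp add: Id_Hom)
  have "cfl_to_susp j1 q1 A (Id C A \<cdot> Id C A) (k \<cdot> w1)"
    by (rule cfl_to_susp_pre[OF k c 1(5) I I P(4) 1(2)]) (use h 1(6) P(5) in simp_all)
  then have "k \<cdot> w1 \<sim> c1" using cfl_to_susp_unique[OF _ 1(7,5)] h by simp
  note C = cfl_to_susp_Hom[OF k c] cfl_to_susp_Hom[OF 1(7,5)]
  have "Q (k \<cdot> w1) = Q c1" using Q_heq[OF \<open>k \<cdot> w1 \<sim> c1\<close> C(2)] .
  then have e: "conn i p \<bullet> Q w1 = Q k \<bullet> Q w1" using 1(2,8) C by (simp add: Q_comp Hom_def)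
  have "w1 \<in> weq" using 1(1) by simp
  from loc_eqI'[OF this 1(2) conn_Hom[OF c] Q_Hom[OF C(1)] e] show ?thesis .
qed

lemma conn_susp: "A \<in> Obj C \<Longrightarrow> conn (susp_mono A) (susp_epi A) = Id L (susp A)"
  using conn_eq[OF susp(1) cfl_to_susp_Id] Q_Id by simp

lemma conn_cofibrant:
  assumes "cfl A i B p D" "cofb D"
  obtains b k where "b \<in> Hom C B (susp_mid A)" "k \<in> Hom C D (susp A)" "b \<cdot> i = susp_mono A" "k \<cdot> p = susp_epi A \<cdot> b"
    "conn i p = Q k"
proof -
  note h = cflD[OF assms(1)]
  have o: "A \<in> Obj C" using h by simp
  obtain k where k: "cfl_to_susp i p A (Id C A) k" using ex_cfl_to_susp[OF assms Id_Hom[OF o]] by blast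
  obtain b where b: "b \<in> Hom C B (susp_mid A)" "b \<cdot> i = susp_mono A \<cdot> Id C A" "k \<in> Hom C D (susp A)" "k \<cdot> p = susp_epi A \<cdot> b"
    using cfl_to_suspE[OF k assms(1)] .
  have "b \<cdot> i = susp_mono A" using b(2) cflD[OF susp(1)[OF o]] by simp
  with that b conn_eq[OF assms(1) k] show thesis by blast
qed

text \<open>The connecting morphism is represented by a map between two conflations that start at
  \<open>A\<close> and have trivial middle terms.\<close>

lemma conn_iso:
  assumes "cfl A i B p D" "cofb D" "triv B"
  shows "iso_arr L (conn i p)"
proof -
  obtain b k where b: "b \<in> Hom C B (susp_mid A)" "k \<in> Hom C D (susp A)" "b \<cdot> i = susp_mono A" "k \<cdot> p = susp_epi A \<cdot> b"
    "conn i p = Q k" using conn_cofibrant[OF assms(1,2)] .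
  have o: "A \<in> Obj C" using cflD[OF assms(1)] by simp
  show ?thesis using Q_iso[OF cfl_map_weq[OF assms(1,3) susp(1,3)[OF o] b(1,3,2,4)]] b(5) by simp
qed

lemma conn_anticommute:
  assumes c1: "cfl A i B p D" and c2: "cfl K k P q D" and D: "cofb D" and pb: "pullback C D B P U p q v u"
    and kA: "cfl A kA U v P" "u \<cdot> kA = i" and kK: "cfl K kK U u B" "v \<cdot> kK = k"
  shows "loc_add (susp_loc (Q kA) \<bullet> conn i p) (susp_loc (Q kK) \<bullet> conn k q) = loc_null D (susp U)"
proof -
  obtain b d where b: "b \<in> Hom C B (susp_mid A)" "d \<in> Hom C D (susp A)" "b \<cdot> i = susp_mono A" "d \<cdot> p = susp_epi A \<cdot> b"
    "conn i p = Q d" using conn_cofibrant[OF c1 D] .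
  obtain b' d' where b': "b' \<in> Hom C P (susp_mid K)" "d' \<in> Hom C D (susp K)" "b' \<cdot> k = susp_mono K" "d' \<cdot> q = susp_epi K \<cdot> b'"
    "conn k q = Q d'" using conn_cofibrant[OF c2 D] .
  have o: "A \<in> Obj C" "K \<in> Obj C" "U \<in> Obj C" "D \<in> Obj C" using cflD[OF kA(1)] cflD[OF c2] by simp_all
  note H = cflD(10)[OF kA(1)] cflD(10)[OF kK(1)]
  obtain e1 where e1: "e1 \<in> Hom C (susp_mid A) (susp_mid U)" "e1 \<cdot> susp_mono A = susp_mono U \<cdot> kA"
    "susp_map kA \<in> Hom C (susp A) (susp U)" "susp_map kA \<cdot> susp_epi A = susp_epi U \<cdot> e1"
    using cfl_to_suspE[OF susp_map[OF H(1)] susp(1)[OF o(1)]] .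
  obtain e2 where e2: "e2 \<in> Hom C (susp_mid K) (susp_mid U)" "e2 \<cdot> susp_mono K = susp_mono U \<cdot> kK"
    "susp_map kK \<in> Hom C (susp K) (susp U)" "susp_map kK \<cdot> susp_epi K = susp_epi U \<cdot> e2"
    using cfl_to_suspE[OF susp_map[OF H(2)] susp(1)[OF o(2)]] .
  have "phan (add (susp_map kA \<cdot> d) (susp_map kK \<cdot> d'))"
    using pullback_anticommute[OF c1 c2 pb kA kK susp(1)[OF o(1)] susp(1)[OF o(2)] susp(1,3)[OF o(3)]
        b(1-4) b'(1-4) e1(1,3,2,4) e2(1,3,2,4)] .
  note J = comp_Hom[OF b(2) e1(3)] comp_Hom[OF b'(2) e2(3)]
  have "add (susp_map kA \<cdot> d) (susp_map kK \<cdot> d') \<sim> null D (susp U)"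
    by (rule heqI[OF null_Hom add_Hom[OF J] \<open>phan _\<close>]) (use o J in \<open>simp_all add: Hom_def\<close>)
  then have "Q (add (susp_map kA \<cdot> d) (susp_map kK \<cdot> d')) = Q (null D (susp U))"
    by (rule Q_heq[OF _ null_Hom]) (use o in simp_all)
  then show ?thesis
    unfolding b(5) b'(5) using Q_add[OF J] H b(2) b'(2) e1(3) e2(3)
    by (simp add: loc_null_def susp_loc(2) Hom_def Q_comp)
qed


section \<open>The suspension is an equivalence\<close>

text \<open>Replace the trivial object \<open>M\<close> by a trivially cofibrant \<open>P\<close>:
  the map \<open>x\<close> lifts to \<open>P\<close> as \<open>susp A\<close> is cofibrant, and
  \<open>y \<cdot> w\<close> lifts to \<open>susp_mid B\<close> as the kernel \<open>B\<close> is
  fibrant. Subtracting the resulting composite from \<open>b\<close> leaves a map into the kernel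
  \<open>B\<close>. It extends \<open>f\<close> over \<open>susp_mid A\<close>, so \<open>f\<close>
  is phantom.\<close>

lemma susp_map_faithful:
  assumes f: "f \<in> Hom C A B" "fibr B" and s: "phan (susp_map f)"
  shows "phan f"
proof -
  note o = Hom_objs[OF f(1)]
  note sA = susp[OF o(1)] and sB = susp[OF o(2)]
  note hA = cflD[OF sA(1)] and hB = cflD[OF sB(1)]
  obtain b where b: "b \<in> Hom C (susp_mid A) (susp_mid B)" "b \<cdot> susp_mono A = susp_mono B \<cdot> f"
    "susp_map f \<in> Hom C (susp A) (susp B)" "susp_map f \<cdot> susp_epi A = susp_epi B \<cdot> b"
    using cfl_to_suspE[OF susp_map[OF f(1)] sA(1)] .
  obtain M x y where m: "triv M" "x \<in> Hom C (susp A) M" "y \<in> Hom C M (susp B)" "susp_map f = y \<cdot> x"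
    using phanE[OF s b(3)] .
  obtain P w where w: "w \<in> fib \<inter> weq" "w \<in> Hom C P M" "cofb P" using ex_cofibrant_replacement[OF triv_Obj[OF m(1)]] by blast
  have P: "tcof P" using weq_triv[of w P M] w m(1) tcof_iff by blast
  obtain x' where x': "x' \<in> Hom C (susp A) P" "w \<cdot> x' = x" using cofb_lift[OF sA(4) w(1,2) m(2)] by blast
  obtain y' where y': "y' \<in> Hom C P (susp_mid B)" "susp_epi B \<cdot> y' = y \<cdot> w"
    using tcof_lift[OF sB(1) f(2) P comp_Hom[OF w(2) m(3)]] by blast
  note H = b(1)[THEN HomD] b(3)[THEN HomD] m(2,3)[THEN HomD]
    w(2)[THEN HomD] x'(1)[THEN HomD] y'(1)[THEN HomD]
    f(1)[THEN HomD]
  let ?r = "add b (neg (y' \<cdot> (x' \<cdot> susp_epi A)))"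
  have r: "?r \<in> Hom C (susp_mid A) (susp_mid B)" using H hA by (simp add: Hom_def)
  have "susp_epi B \<cdot> (y' \<cdot> (x' \<cdot> susp_epi A)) = susp_epi B \<cdot> b"
    using H hA hB m(4) by (simp add: comp_reassoc[OF y'(2)] comp_reassoc[OF x'(2)] b(4)[symmetric])
  then have "susp_epi B \<cdot> ?r = null (susp_mid A) (susp B)" using H hA hB by simp
  then obtain t where t: "t \<in> Hom C (susp_mid A) B" "susp_mono B \<cdot> t = ?r" using cfl_lift[OF sB(1) r] by blast
  have "t \<cdot> susp_mono A = f"
  proof (rule cfl_mono[OF sB(1) _ f(1)])
    show "susp_mono B \<cdot> (t \<cdot> susp_mono A) = susp_mono B \<cdot> f"
      using t(1) H hA hB b(2) by (simp add: Hom_def comp_reassoc[OF t(2)])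
  qed (use t(1) hA in \<open>simp add: Hom_def\<close>)
  then show ?thesis using phanI[OF sA(3) hA(10) t(1)] by simp
qed

text \<open>The difference of \<open>u\<close> and \<open>v\<close> is written as a left fraction
  whose target is then enlarged to the fibrant \<open>R\<close>, as \<open>susp_map_faithful\<close>
  demands.\<close>

lemma susp_loc_faithful:
  assumes "u \<in> Hom L A B" "v \<in> Hom L A B" "susp_loc u = susp_loc v"
  shows "u = v"
proof -
  let ?u = "loc_add u (L.neg v)"
  have d: "?u \<in> Hom L A B" using loc_add_Hom[OF assms(1) L.neg_Hom[OF assms(2)]] .
  have o: "A \<in> Obj C" "B \<in> Obj C" using L.Hom_objs[OF assms(1)] by simp_all
  have z: "susp_loc ?u = loc_null (susp A) (susp B)"
    using susp_loc_add[OF assms(1) L.neg_Hom[OF assms(2)]] susp_loc_neg[OF assms(2)] assms by (simp add: Hom_def)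
  obtain Z f s where 1: "f \<in> Hom C A Z" "s \<in> Hom C B Z" "s \<in> weq" "Q s \<bullet> ?u = Q f" using left_fraction[OF d] .
  obtain R r where r: "r \<in> cof \<inter> weq" "r \<in> Hom C Z R" "fibr R"
    using ex_fibrant_replacement[OF Hom_objs(2)[OF 1(1)]] by blast
  note rf = comp_Hom[OF 1(1) r(2)] and rs = comp_Hom[OF 1(2) r(2)]
  note H = 1(1,2)[THEN HomD] r(2)[THEN HomD] d[THEN HomD]
  have rsu: "Q (r \<cdot> s) \<bullet> ?u = Q (r \<cdot> f)" using H 1(4) by (simp add: Q_comp del: L.add_simps L.comp_add)
  have "Q (susp_map (r \<cdot> f)) = susp_loc (Q (r \<cdot> s) \<bullet> ?u)" unfolding rsu using H by (simp add: susp_loc(2))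
  also have "\<dots> = susp_loc (Q (r \<cdot> s)) \<bullet> loc_null (susp A) (susp B)"
    using susp_loc_comp[of ?u "Q (r \<cdot> s)"] z H by simp
  also have "\<dots> = loc_null (susp A) (susp R)" using H o by simp
  finally have "Q (susp_map (r \<cdot> f)) = Q (null (susp A) (susp R))" by (simp add: loc_null_def)
  then have "susp_map (r \<cdot> f) \<sim> null (susp A) (susp R)"
    using Q_faithful[OF susp_map_Hom[OF rf] null_Hom] o Hom_objs[OF r(2)] by simp
  then have "phan (susp_map (r \<cdot> f))"
    using heq_iff[OF susp_map_Hom[OF rf] null_Hom] o Hom_objs[OF r(2)] susp_map_Hom[OF rf] by (simp add: Hom_def)
  then have "phan (r \<cdot> f)" by (rule susp_map_faithful[OF rf r(3)])
  then have "r \<cdot> f \<sim> null A R"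
    using heq_iff[OF rf null_Hom] o Hom_objs[OF r(2)] rf by (simp add: Hom_def)
  then have "Q (r \<cdot> f) = loc_null A R"
    unfolding loc_null_def by (rule Q_heq[OF _ null_Hom]) (use o Hom_objs[OF r(2)] in simp_all)
  then have "Q (r \<cdot> s) \<bullet> ?u = Q (r \<cdot> s) \<bullet> loc_null A B" using rsu H o Hom_objs[OF r(2)] by simp
  moreover have "r \<cdot> s \<in> weq" using weq_Comp[OF 1(3), of r] r H by simp
  ultimately have "?u = loc_null A B" using loc_eqI[OF _ rs d loc_null_Hom[OF o]] by blast
  then show ?thesis using L.diff_eq_null[OF assms(1,2)] by simp
qed

text \<open>Write \<open>u\<close> as a right fraction of \<open>f\<close> by \<open>t\<close> with
  cofibrant source \<open>Z\<close>. Pulling back the suspension conflations of \<open>A\<close>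
  along \<open>t\<close> and of \<open>B\<close> along \<open>f\<close> gives conflations ending in
  \<open>Z\<close> with connecting morphisms \<open>t\<close> and \<open>f\<close>. By
  anticommutation over the common pullback \<open>U\<close>, the suspension of \<open>kB\<close>
  after \<open>f\<close> is minus that of \<open>kA\<close> after \<open>t\<close>; since
  \<open>kB\<close> is a weak equivalence, \<open>u\<close> is the suspension of minus
  \<open>kA\<close> divided by \<open>kB\<close>.\<close>

lemma susp_loc_full:
  assumes o: "A \<in> Obj C" "B \<in> Obj C" and u: "u \<in> Hom L (susp A) (susp B)"
  shows "\<exists>v \<in> Hom L A B. susp_loc v = u"
proof -
  obtain Z0 f0 t0 where 0: "f0 \<in> Hom C Z0 (susp B)" "t0 \<in> Hom C Z0 (susp A)" "t0 \<in> weq" "adm_epi conf t0" "u \<bullet> Q t0 = Q f0"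
    using right_fraction[OF u] .
  obtain Z w where w: "w \<in> fib \<inter> weq" "w \<in> Hom C Z Z0" "cofb Z"
    using ex_cofibrant_replacement[OF Hom_objs(1)[OF 0(1)]] by blast
  define f t where "f = f0 \<cdot> w" and "t = t0 \<cdot> w"
  have f: "f \<in> Hom C Z (susp B)" and t: "t \<in> Hom C Z (susp A)" "t \<in> weq"
    unfolding f_def t_def using comp_Hom[OF w(2) 0(1)] comp_Hom[OF w(2) 0(2)] weq_Comp[of w t0] w 0(2,3)
    by (simp_all add: Hom_def)
  have ut: "u \<bullet> Q t = Q f"
    unfolding f_def t_def using 0 w(2) u by (simp add: Q_comp Hom_def L.comp_reassoc[OF 0(5)])
  obtain K0 k0 where "cfl K0 k0 Z0 t0 (susp A)"
    using cflI 0(2,4) by (fastforce simp: adm_epi_def conflation_def Hom_def)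
  obtain k K where wc: "cfl K k Z w Z0" "tfib K" using fib_weqE[OF w(1,2)] .
  have ad: "adm_epi conf t" unfolding t_def
    by (rule Comp_adm_epi) (use 0(4) 0(2) w(2) cflD(12)[OF wc(1)] in \<open>auto simp: adm_epi_def Hom_def\<close>)
  then obtain k1 where "(k1, t) \<in> conf" by (auto simp: adm_epi_def)
  then obtain K1 where k1: "cfl K1 k1 Z t (susp A)" using cflI[of k1 t] t(1) by (auto simp: conflation_def Hom_def)
  obtain J pJ tJ aJ where J: "pullback C (susp A) (susp_mid A) Z J (susp_epi A) t pJ tJ" "cfl A aJ J pJ Z" "tJ \<cdot> aJ = susp_mono A"
    using ex_pullback[OF susp(1)[OF o(1)] t(1)] by blast
  note PJ = pullbackD[OF J(1)]
  obtain k2 where "cfl K1 k2 J tJ (susp_mid A)" using pullback_conflation[OF k1 pullback_sym[OF J(1)]] by blast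
  \<comment> \<open>\<open>tJ\<close> and the weak equivalence \<open>t\<close> have the same kernel
    \<open>K1\<close>.\<close>
  then have "tJ \<in> weq" using adm_epi_weq_iff adm_epi_weq_iff[OF k1] t(2) by blast
  then have tJ: "triv J" using weq_triv[OF _ PJ(4)] susp(3)[OF o(1)] by blast
  obtain T pT tT aT where T: "pullback C (susp B) (susp_mid B) Z T (susp_epi B) f pT tT" "cfl B aT T pT Z" "tT \<cdot> aT = susp_mono B"
    using ex_pullback[OF susp(1)[OF o(2)] f] by blast
  note PT = pullbackD[OF T(1)]
  have cJ: "conn aJ pJ = Q t"
    by (rule conn_eq[OF J(2) cfl_to_suspI[OF J(2) PJ(4) _ t(1) PJ(5)[symmetric]]])
      (use J(3) cflD[OF susp(1)[OF o(1)]] in simp)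
  have cT: "conn aT pT = Q f"
    by (rule conn_eq[OF T(2) cfl_to_suspI[OF T(2) PT(4) _ f PT(5)[symmetric]]])
      (use T(3) cflD[OF susp(1)[OF o(2)]] in simp)
  obtain U v x kB where U: "pullback C Z T J U pT pJ v x" "cfl B kB U v J" "x \<cdot> kB = aT"
    using ex_pullback[OF T(2) cflD(11)[OF J(2)]] by blast
  obtain kA where kA: "cfl A kA U x T" "v \<cdot> kA = aJ" using pullback_conflation[OF J(2) pullback_sym[OF U(1)]] by blast
  note hB = cflD[OF U(2)] and hA = cflD[OF kA(1)]
  have anti: "loc_add (susp_loc (Q kB) \<bullet> Q f) (susp_loc (Q kA) \<bullet> Q t) = loc_null Z (susp U)"
    using conn_anticommute[OF T(2) J(2) w(3) U kA] cJ cT by simp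
  have kBw: "kB \<in> weq" using adm_mono_weq_iff[OF U(2)] tJ by blast
  obtain y where y: "y \<in> Hom L A B" "Q kB \<bullet> y = L.neg (Q kA)"
    using ex_loc_left[OF kBw hB(10) L.neg_Hom[OF Q_Hom[OF hA(10)]]] by blast
  note H = y(1)[THEN HomD] f[THEN HomD] t(1)[THEN HomD] u[THEN HomD]
  note SA = susp_loc_Hom[OF Q_Hom[OF hA(10)]] and SB = susp_loc_Hom[OF Q_Hom[OF hB(10)]]
  have "susp_loc (Q kA) \<bullet> Q t = L.neg (susp_loc (Q kB) \<bullet> Q f)"
    by (rule L.neg_unique[OF L.comp_Hom[OF Q_Hom[OF f] SB] L.comp_Hom[OF Q_Hom[OF t(1)] SA] anti])
  then have e: "L.neg (susp_loc (Q kA) \<bullet> Q t) = susp_loc (Q kB) \<bullet> Q f"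
    using L.comp_Hom[OF Q_Hom[OF f] SB] by (simp add: Hom_def)
  have "susp_loc (Q kB) \<bullet> (susp_loc y \<bullet> Q t) = susp_loc (Q kB \<bullet> y) \<bullet> Q t"
    using H hB hA by (simp add: susp_loc_comp)
  also have "\<dots> = susp_loc (Q kB) \<bullet> (u \<bullet> Q t)"
    unfolding y(2) ut using e H hA hB by (simp add: susp_loc_neg[OF Q_Hom[OF hA(10)]])
  finally have "susp_loc y \<bullet> Q t = u \<bullet> Q t"
    by (rule L.iso_cancel_left[OF susp_loc_iso[OF Q_iso[OF kBw] Q_Hom[OF hB(10)]] SB, rotated 2])
      (use H in \<open>simp_all add: Hom_def\<close>)
  then have "susp_loc y = u" by (rule loc_eqI'[OF t(2,1) susp_loc_Hom[OF y(1)] u])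
  with y(1) show ?thesis by blast
qed

text \<open>For a trivial cover of a cofibrant replacement of \<open>X\<close>, the connecting
  morphism to the suspension of the kernel is invertible.\<close>

lemma susp_loc_surj:
  assumes "X \<in> Obj C"
  shows "\<exists>K \<in> Obj C. \<exists>e \<in> Hom L (susp K) X. iso_arr L e"
proof -
  obtain X' w where w: "w \<in> fib \<inter> weq" "w \<in> Hom C X' X" "cofb X'" using ex_cofibrant_replacement[OF assms] by blast
  obtain k P q K where c: "cfl K k P q X'" "tcof P" using ex_trivial_cover[OF Hom_objs(1)[OF w(2)]] by blast
  have "iso_arr L (conn k q)" using conn_iso[OF c(1) w(3)] c(2) tcof_iff by blast
  from L.iso_arrE[OF this conn_Hom[OF c(1)]] obtain e where e: "e \<in> Hom L (susp K) X'" "iso_arr L e" by metis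
  have "iso_arr L (Q w \<bullet> e)" using L.iso_arr_comp[OF e(2) Q_iso e(1) Q_Hom[OF w(2)]] w(1) by blast
  then show ?thesis using L.comp_Hom[OF e(1) Q_Hom[OF w(2)]] cflD(7)[OF c(1)] by blast
qed

lemma susp_loc_equivalence: "is_equivalence L L susp susp_loc"
  by (rule L.equivalence_of_fully_faithful[OF susp_loc(1)])
    (use susp_loc_faithful susp_loc_full susp_loc_surj in auto)

end


section \<open>Distinguished triangles\<close>

context exact_model_structure
begin

text \<open>Take \<open>V\<close> as the pushout of \<open>j\<close> along \<open>p\<close>. A map
  on \<open>T\<close> killing \<open>j \<cdot> i\<close> is a map on \<open>T\<close> together with
  a compatible one on \<open>D\<close>, that is, a map on \<open>V\<close>.\<close>

lemma noether:
  assumes c1: "cfl A i B p D" and c2: "cfl B j T q E"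
  shows "\<exists>V r u v. cfl A (j \<cdot> i) T r V \<and> cfl D u V v E \<and> r \<cdot> j = u \<cdot> p \<and> v \<cdot> r = q"
proof -
  note h1 = cflD[OF c1] and h2 = cflD[OF c2]
  obtain V u r v where po: "cfl D u V v E" "pushout C B T D V j p u r" "v \<cdot> r = q"
    using ex_pushout[OF c2 h1(11)] by blast
  note P = pushoutD[OF po(2)] and h = cflD[OF po(1)]
  have R: "r \<in> Arr C" "Dom C r = T" "Cod C r = V" using P(4) by (simp_all add: Hom_def)
  have am: "adm_mono conf (j \<cdot> i)"
    by (rule Comp_adm_mono) (use h1 h2 in \<open>auto simp: adm_mono_def\<close>)
  have "cfl A (j \<cdot> i) T r V"
  proof (rule conflation_of_cokernel[OF am comp_Hom[OF h1(10) h2(10)] P(4)])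
    show "r \<cdot> (j \<cdot> i) = null A V" using R h1 h2 h by (simp add: comp_reassoc[OF P(5)])
  next
    fix X g assume g: "g \<in> Hom C T X" "g \<cdot> (j \<cdot> i) = null A X"
    have "(g \<cdot> j) \<cdot> i = null A X" using g h1 h2 by (simp add: Hom_def)
    then obtain y where y: "y \<in> Hom C D X" "y \<cdot> p = g \<cdot> j" using cfl_desc[OF c1 comp_Hom[OF h2(10) g(1)]] by blast
    show "\<exists>u\<in>Hom C V X. u \<cdot> r = g" using P(6)[OF y(1) g(1) y(2)] by blast
  next
    fix X w w' assume w: "w \<in> Hom C V X" "w' \<in> Hom C V X" "w \<cdot> r = w' \<cdot> r"
    have "(w \<cdot> u) \<cdot> p = (w \<cdot> r) \<cdot> j" using w(1) R h h1 h2 by (simp add: Hom_def P(5))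
    also have "\<dots> = (w' \<cdot> u) \<cdot> p" unfolding w(3) using w(2) R h h1 h2 by (simp add: Hom_def P(5))
    finally have "w \<cdot> u = w' \<cdot> u"
      by (rule cfl_epi[OF c1, rotated 2]) (use w h in \<open>simp_all add: Hom_def\<close>)
    then show "w = w'" using P(7)[OF w(1,2) _ w(3)] by blast
  qed
  then show ?thesis using po P(5) by blast
qed

text \<open>The middle term of the conflation ending in the pushout of \<open>i\<close> along \<open>x\<close> is the pullback \<open>U\<close>
  of \<open>p\<close>; it plays the role of \<open>B \<oplus> M\<close>, and \<open>x\<close> extends to it up to sign.\<close>

lemma ex_roof:
  assumes c: "cfl A i B p D" and x: "x \<in> Hom C A M"
  obtains V l w z U q u y i' k where "cfl M l V w D" "pushout C A B M V i x l z" "w \<cdot> z = p"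
    "cfl A i' U q V" "u \<in> Hom C U B" "u \<cdot> i' = i" "w \<cdot> q = p \<cdot> u" "cfl M k U u B"
    "y \<in> Hom C U M" "y \<cdot> i' = neg x" "l \<cdot> y = add q (neg (z \<cdot> u))"
proof -
  obtain V l z w where V: "cfl M l V w D" "pushout C A B M V i x l z" "w \<cdot> z = p" using ex_pushout[OF c x] by blast
  note h = cflD[OF c] and hV = cflD[OF V(1)] and P = pushoutD[OF V(2)]
  obtain U q u i' where U: "pullback C D B V U p w q u" "cfl A i' U q V" "u \<cdot> i' = i" using ex_pullback[OF c hV(11)] by blast
  note PB = pullbackD[OF U(1)] and hU = cflD[OF U(2)]
  obtain k where k: "cfl M k U u B" using pullback_conflation[OF V(1) pullback_sym[OF U(1)]] by blast
  note H = P(4)[THEN HomD] PB(4)[THEN HomD] x[THEN HomD]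
  have "w \<cdot> add q (neg (z \<cdot> u)) = null U D" using H hU hV h PB(5) by (simp add: comp_reassoc[OF V(3)])
  then obtain y where y: "y \<in> Hom C U M" "l \<cdot> y = add q (neg (z \<cdot> u))"
    using cfl_lift[OF V(1), of "add q (neg (z \<cdot> u))" U] H hU by (auto simp: Hom_def)
  have "y \<cdot> i' = neg x"
    by (rule cfl_mono[OF V(1), of _ A])
      (use y(1) H hU hV h P(5) U(3) in \<open>simp_all add: Hom_def comp_reassoc[OF y(2)]\<close>)
  with that V U k y PB(4,5) show thesis by metis
qed

text \<open>The arrows \<open>a\<close> and \<open>b\<close> are first represented by honest maps
  \<open>f\<close> and \<open>g\<close> into a conflation weakly equivalent to the second one. They
  commute with the inflations only up to a phantom map \<open>n\<close>; over the roof
  \<open>U\<close> of \<open>B\<close> the error is subtracted, and the corrected map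
  \<open>g'\<close> induces \<open>d0\<close> on cokernels.\<close>

lemma conflation_fill:
  assumes c: "cfl A i B p D" "cfl A' i' B' p' D'"
    and m: "a \<in> Hom L A A'" "b \<in> Hom L B B'" "b \<bullet> Q i = Q i' \<bullet> a"
  shows "\<exists>d \<in> Hom L D D'. d \<bullet> Q p = Q p' \<bullet> b \<and> susp_loc a \<bullet> conn i p = conn i' p' \<bullet> d"
proof -
  note h = cflD[OF c(1)] and h' = cflD[OF c(2)]
  obtain A1 f s where s: "f \<in> Hom C A A1" "s \<in> Hom C A' A1" "s \<in> weq" "adm_mono conf s" "Q s \<bullet> a = Q f"
    using left_fraction[OF m(1)] .
  \<comment> \<open>Clearing the denominator \<open>s\<close> of \<open>a\<close>: the pushout along
    the inflation \<open>s\<close> keeps the quotient \<open>D'\<close> and makes \<open>s1\<close>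
    an inflation with the trivial cokernel of \<open>s\<close>.\<close>
  obtain B1 i1 s1 p1 where 1: "cfl A1 i1 B1 p1 D'" "pushout C A' B' A1 B1 i' s i1 s1" "p1 \<cdot> s1 = p'"
    using ex_pushout[OF c(2) s(2)] by blast
  note P1 = pushoutD[OF 1(2)] and h1 = cflD[OF 1(1)]
  obtain t where "(s, t) \<in> conf" using s(4) by (auto simp: adm_mono_def)
  then obtain N where t: "cfl A' s A1 t N" using cflI[of s t] s(2) by (auto simp: conflation_def Hom_def)
  obtain t1 where t1: "cfl B' s1 B1 t1 N" using pushout_conflation[OF t pushout_sym[OF 1(2)]] by blast
  have s1: "s1 \<in> weq" using adm_mono_weq_iff[OF t] adm_mono_weq_iff[OF t1] s(3) by blast
  obtain B2 g r where g: "g \<in> Hom C B B2" "r \<in> Hom C B1 B2" "r \<in> weq" "adm_mono conf r" "Q r \<bullet> (Q s1 \<bullet> b) = Q g"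
    using left_fraction[OF L.comp_Hom[OF m(2) Q_Hom[OF P1(4)]]] .
  obtain r' where "(r, r') \<in> conf" using g(4) by (auto simp: adm_mono_def)
  then obtain N' where r': "cfl B1 r B2 r' N'" using cflI[of r r'] g(2) by (auto simp: conflation_def Hom_def)
  \<comment> \<open>Clearing the denominator \<open>r\<close> of \<open>b\<close> enlarges the
    middle term; by Noether the quotient changes only by the weak equivalence
    \<open>e\<close>.\<close>
  obtain D2 p2 e e' where 2: "cfl A1 (r \<cdot> i1) B2 p2 D2" "cfl D' e D2 e' N'" "p2 \<cdot> r = e \<cdot> p1"
    using noether[OF 1(1) r'] by blast
  have e: "e \<in> weq" using adm_mono_weq_iff[OF r'] adm_mono_weq_iff[OF 2(2)] g(3) by blast
  note h2 = cflD[OF 2(1)] and he = cflD[OF 2(2)]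
  note H = s(1,2)[THEN HomD] g(1,2)[THEN HomD] P1(4)[THEN HomD]
    m(1,2)[THEN HomD]
  have i1s: "Q i1 \<bullet> Q s = Q s1 \<bullet> Q i'"
    using P1(5) H h1 h' Q_comp[of i' s1] Q_comp[of s i1] by simp
  have "Q (g \<cdot> i) = Q r \<bullet> (Q s1 \<bullet> (b \<bullet> Q i))" using H h g(5)[symmetric] by (simp add: Q_comp)
  also have "\<dots> = Q r \<bullet> ((Q s1 \<bullet> Q i') \<bullet> a)" unfolding m(3) using H h' by simp
  also have "\<dots> = Q ((r \<cdot> i1) \<cdot> f)" unfolding i1s[symmetric] using H h1 s(5) by (simp add: Q_comp)
  finally have qe: "Q (g \<cdot> i) = Q ((r \<cdot> i1) \<cdot> f)" .
  have "g \<cdot> i \<sim> (r \<cdot> i1) \<cdot> f"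
    by (rule Q_faithful[of _ A B2, OF _ _ qe]) (use H h h1 in \<open>simp_all add: Hom_def\<close>)
  then obtain n where n: "n \<in> Hom C A B2" "phan n" "g \<cdot> i = add ((r \<cdot> i1) \<cdot> f) n"
    using H h1 by (auto simp: heq_def Hom_def)
  obtain M x y where xy: "triv M" "x \<in> Hom C A M" "y \<in> Hom C M B2" "n = y \<cdot> x" using phanE[OF n(2,1)] .
  \<comment> \<open>Since \<open>v \<cdot> j\<close> is minus \<open>x\<close>, adding
    \<open>y \<cdot> v\<close> to \<open>g \<cdot> u\<close> removes exactly the error
    \<open>y \<cdot> x\<close>. Both \<open>u\<close> and \<open>w\<close> have the trivial kernel
    \<open>M\<close>, so the roof is weakly equivalent to the given conflation.\<close>
  obtain V l w z U q u v j k where R: "cfl M l V w D" "pushout C A B M V i x l z" "w \<cdot> z = p"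
    "cfl A j U q V" "u \<in> Hom C U B" "u \<cdot> j = i" "w \<cdot> q = p \<cdot> u" "cfl M k U u B"
    "v \<in> Hom C U M" "v \<cdot> j = neg x" "l \<cdot> v = add q (neg (z \<cdot> u))"
    using ex_roof[OF c(1) xy(2)] .
  have w: "w \<in> weq" and u: "u \<in> weq" using adm_epi_weq_iff R(1,8) xy(1) by blast+
  note hR = cflD[OF R(4)] and hw = cflD[OF R(1)]
  note K = R(5,9)[THEN HomD] xy(2,3)[THEN HomD]
  define g' where "g' = add (g \<cdot> u) (y \<cdot> v)"
  have g': "g' \<in> Hom C U B2" unfolding g'_def using H K by (simp add: Hom_def)
  have g'j: "g' \<cdot> j = (r \<cdot> i1) \<cdot> f"
  proof -
    have "g' \<cdot> j = add (g \<cdot> i) (neg n)" unfolding g'_def xy(4) using H K hR by (simp add: R(6,10))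
    also have "\<dots> = add n (add ((r \<cdot> i1) \<cdot> f) (neg n))"
      unfolding n(3) using n(1) H h1 by (simp add: Hom_def add_ac)
    also have "\<dots> = (r \<cdot> i1) \<cdot> f"
      using n(1) H h1 by (simp add: Hom_def add_commute[of "r \<cdot> _" "neg n"])
    finally show ?thesis .
  qed
  have Qg': "Q g' = Q g \<bullet> Q u"
  proof -
    have "g' \<sim> g \<cdot> u"
      by (rule heqI[OF comp_Hom[OF R(5) g(1)] comp_Hom[OF R(9) xy(3)] phanI[OF xy(1) R(9) xy(3)]]) (simp add: g'_def)
    from Q_heq[OF this comp_Hom[OF R(5) g(1)]] show ?thesis using H K by (simp add: Q_comp)
  qed
  note G' = g'[THEN HomD]
  have "(p2 \<cdot> g') \<cdot> j = null A D2"
    using G' h2 hR H h1 by (simp add: g'j comp_reassoc[OF h2(13)])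
  then obtain d0 where d0: "d0 \<in> Hom C V D2" "d0 \<cdot> q = p2 \<cdot> g'" using cfl_desc[OF R(4) comp_Hom[OF g' h2(11)]] by blast
  obtain d1 where d1: "d1 \<in> Hom L D D2" "d1 \<bullet> Q w = Q d0" using ex_loc_right[OF w hw(11) Q_Hom[OF d0(1)]] by blast
  obtain d where d: "d \<in> Hom L D D'" "Q e \<bullet> d = d1" using ex_loc_left[OF e he(10) d1(1)] by blast
  note DD = d0(1)[THEN HomD] d1(1)[THEN HomD] d(1)[THEN HomD]
  have Qe: "Q p2 \<bullet> Q r = Q e \<bullet> Q p1" using 2(3) h2 H he h1 Q_comp[of r p2] Q_comp[of p1 e] by simp
  have Qp': "Q p1 \<bullet> Q s1 = Q p'" using 1(3) h1 H Q_comp[of s1 p1] by simp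
  have QR: "Q w \<bullet> Q q = Q p \<bullet> Q u" using R(7) hw hR h K Q_comp[of q w] Q_comp[of u p] by simp
  have "Q e \<bullet> ((d \<bullet> Q p) \<bullet> Q u) = d1 \<bullet> (Q w \<bullet> Q q)"
    unfolding QR using DD K h he by (simp add: L.comp_reassoc[OF d(2)])
  also have "\<dots> = Q (d0 \<cdot> q)" using DD hw hR by (simp add: L.comp_reassoc[OF d1(2)] Q_comp)
  also have "\<dots> = Q p2 \<bullet> ((Q r \<bullet> (Q s1 \<bullet> b)) \<bullet> Q u)"
    unfolding d0(2) g(5) using G' h2 Qg' by (simp add: Q_comp)
  also have "\<dots> = Q e \<bullet> ((Q p1 \<bullet> Q s1) \<bullet> (b \<bullet> Q u))"
    using H K h2 he h1 by (simp add: L.comp_reassoc[OF Qe])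
  also have "\<dots> = Q e \<bullet> ((Q p' \<bullet> b) \<bullet> Q u)" unfolding Qp' using H K h' by simp
  finally have E1: "(d \<bullet> Q p) \<bullet> Q u = (Q p' \<bullet> b) \<bullet> Q u"
    by (rule loc_eqI[OF e he(10), rotated 2]) (use DD K h h' H in \<open>simp_all add: Hom_def\<close>)
  have 3: "d \<bullet> Q p = Q p' \<bullet> b"
    by (rule loc_eqI'[OF u R(5) _ _ E1]) (use DD K h h' H in \<open>simp_all add: Hom_def\<close>)
  note I = Id_Hom[OF h(7)]
  have n1: "susp_loc (Q (Id C A)) \<bullet> conn j q = conn i p \<bullet> Q w"
    by (rule conn_natural[OF R(4) c(1) I R(5) hw(11) _ R(7)]) (use R(6) h in simp)
  have n2: "susp_loc (Q f) \<bullet> conn j q = conn (r \<cdot> i1) p2 \<bullet> Q d0"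
    by (rule conn_natural[OF R(4) 2(1) s(1) g' d0(1) g'j d0(2)])
  have n3: "susp_loc (Q s) \<bullet> conn i' p' = conn (r \<cdot> i1) p2 \<bullet> Q e"
  proof (rule conn_natural[OF c(2) 2(1) s(2) comp_Hom[OF P1(4) g(2)] he(10)])
    show "(r \<cdot> s1) \<cdot> i' = (r \<cdot> i1) \<cdot> s" using H h' h1 P1(5) by simp
    show "e \<cdot> p' = p2 \<cdot> (r \<cdot> s1)" unfolding 1(3)[symmetric] using H h1 h2 he by (simp add: comp_reassoc[OF 2(3)])
  qed
  note C = conn_Hom[OF R(4)] conn_Hom[OF c(1)] conn_Hom[OF c(2)] conn_Hom[OF 2(1)]
  note CC = C[THEN HomD]
  have "susp_loc (Q s) \<bullet> ((susp_loc a \<bullet> conn i p) \<bullet> Q w) = susp_loc (Q s \<bullet> a) \<bullet> (susp_loc (Q (Id C A)) \<bullet> conn j q)"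
    unfolding n1 using H CC hw by (simp add: susp_loc_comp)
  also have "\<dots> = conn (r \<cdot> i1) p2 \<bullet> Q d0"
    unfolding s(5) using n2 CC h H by (simp add: Q_Id)
  also have "\<dots> = (conn (r \<cdot> i1) p2 \<bullet> Q e) \<bullet> (d \<bullet> Q w)"
    using CC DD he hw d1(2) by (simp add: L.comp_reassoc[OF d(2)])
  also have "\<dots> = susp_loc (Q s) \<bullet> ((conn i' p' \<bullet> d) \<bullet> Q w)"
    unfolding n3[symmetric] using CC DD H hw by simp
  finally have "(susp_loc a \<bullet> conn i p) \<bullet> Q w = (conn i' p' \<bullet> d) \<bullet> Q w"
    by (rule L.iso_cancel_left[OF susp_loc_iso[OF Q_iso[OF s(3)] Q_Hom[OF s(2)]] susp_loc_Hom[OF Q_Hom[OF s(2)]], rotated 2])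
      (use CC DD H hw in \<open>simp_all add: Hom_def\<close>)
  then have "susp_loc a \<bullet> conn i p = conn i' p' \<bullet> d"
    by (rule loc_eqI'[OF w hw(11), rotated 2]) (use CC DD H in \<open>simp_all add: Hom_def\<close>)
  with 3 d(1) show ?thesis by blast
qed

text \<open>A cofibrant quotient can always be arranged (\<open>conflation_distinguished\<close>),
  and \<open>conn_anticommute\<close> and \<open>conn_iso\<close> ask for it in
  \<open>distinguished_unrotate\<close>.\<close>

definition distinguished where
  "distinguished X Y Z f g h \<longleftrightarrow> f \<in> Hom L X Y \<and> g \<in> Hom L Y Z \<and> h \<in> Hom L Z (susp X) \<and>
     (\<exists>A i B p D a b c. cfl A i B p D \<and> cofb D \<and> a \<in> Hom L A X \<and> b \<in> Hom L B Y \<and> c \<in> Hom L D Z \<and>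
        iso_arr L a \<and> iso_arr L b \<and> iso_arr L c \<and>
        b \<bullet> Q i = f \<bullet> a \<and> c \<bullet> Q p = g \<bullet> b \<and> susp_loc a \<bullet> conn i p = h \<bullet> c)"

lemma distinguishedE:
  assumes "distinguished X Y Z f g h"
  obtains A i B p D a b c where "cfl A i B p D" "cofb D" "a \<in> Hom L A X" "b \<in> Hom L B Y" "c \<in> Hom L D Z"
     "iso_arr L a" "iso_arr L b" "iso_arr L c" "b \<bullet> Q i = f \<bullet> a" "c \<bullet> Q p = g \<bullet> b" "susp_loc a \<bullet> conn i p = h \<bullet> c"
  using assms unfolding distinguished_def by blast

lemma distinguishedD: "distinguished X Y Z f g h \<Longrightarrow> f \<in> Hom L X Y \<and> g \<in> Hom L Y Z \<and> h \<in> Hom L Z (susp X)"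
  unfolding distinguished_def by blast

lemma distinguished_iso:
  assumes d: "distinguished X Y Z f g h" and f': "f' \<in> Hom L X' Y'" "g' \<in> Hom L Y' Z'" "h' \<in> Hom L Z' (susp X')"
    and i: "a \<in> Hom L X X'" "b \<in> Hom L Y Y'" "c \<in> Hom L Z Z'" "iso_arr L a" "iso_arr L b" "iso_arr L c"
    and e: "b \<bullet> f = f' \<bullet> a" "c \<bullet> g = g' \<bullet> b" "susp_loc a \<bullet> h = h' \<bullet> c"
  shows "distinguished X' Y' Z' f' g' h'"
proof -
  obtain A k B p D a0 b0 c0 where s: "cfl A k B p D" "cofb D" "a0 \<in> Hom L A X" "b0 \<in> Hom L B Y" "c0 \<in> Hom L D Z"
     "iso_arr L a0" "iso_arr L b0" "iso_arr L c0" "b0 \<bullet> Q k = f \<bullet> a0" "c0 \<bullet> Q p = g \<bullet> b0" "susp_loc a0 \<bullet> conn k p = h \<bullet> c0"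
    using distinguishedE[OF d] .
  note hs = cflD[OF s(1)] and dd = distinguishedD[OF d, unfolded Hom_def, simplified]
  note H = s(3-5)[THEN HomD] i(1-3)[THEN HomD] dd
    f'[THEN HomD] conn_Hom[OF s(1), THEN HomD]
  have "(b \<bullet> b0) \<bullet> Q k = f' \<bullet> (a \<bullet> a0)" using H hs by (simp add: s(9) L.comp_reassoc[OF e(1)])
  moreover have "(c \<bullet> c0) \<bullet> Q p = g' \<bullet> (b \<bullet> b0)" using H hs by (simp add: s(10) L.comp_reassoc[OF e(2)])
  moreover have "susp_loc (a \<bullet> a0) \<bullet> conn k p = h' \<bullet> (c \<bullet> c0)"
    using H hs by (simp add: susp_loc_comp s(11) L.comp_reassoc[OF e(3)])
  ultimately show ?thesis
    unfolding distinguished_def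
    using f' s(1,2) L.comp_Hom[OF s(3) i(1)] L.comp_Hom[OF s(4) i(2)] L.comp_Hom[OF s(5) i(3)]
      L.iso_arr_comp[OF s(6) i(4) s(3) i(1)] L.iso_arr_comp[OF s(7) i(5) s(4) i(2)] L.iso_arr_comp[OF s(8) i(6) s(5) i(3)]
    by blast
qed

text \<open>Pulling back along a cofibrant replacement of \<open>D\<close> gives a weakly equivalent
  conflation with cofibrant quotient, and naturality compares the connecting morphisms.\<close>

lemma conflation_distinguished:
  assumes c: "cfl A i B p D"
  shows "distinguished A B D (Q i) (Q p) (conn i p)"
proof -
  note h = cflD[OF c]
  obtain D' w where w: "w \<in> fib \<inter> weq" "w \<in> Hom C D' D" "cofb D'"
    using ex_cofibrant_replacement[OF h(9)] by blast
  obtain B' p' w' i' where pb: "pullback C D B D' B' p w p' w'" "cfl A i' B' p' D'" "w' \<cdot> i' = i"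
    using ex_pullback[OF c w(2)] by blast
  note P = pullbackD[OF pb(1)] and h' = cflD[OF pb(2)]
  obtain k K where k: "cfl K k D' w D" "tfib K" using fib_weqE[OF w(1,2)] .
  obtain k' where "cfl K k' B' w' B" using pullback_conflation[OF k(1) pullback_sym[OF pb(1)]] by blast
  then have w': "w' \<in> weq" using fib_weqI k(2) by blast
  have n: "susp_loc (Q (Id C A)) \<bullet> conn i' p' = conn i p \<bullet> Q w"
    by (rule conn_natural[OF pb(2) c Id_Hom[OF h(7)] P(4) w(2) _ P(5)[symmetric]]) (use pb(3) h in simp)
  have W: "w \<in> Arr C" "w' \<in> Arr C" "Dom C w = D'" "Cod C w = D" "Dom C w' = B'" "Cod C w' = B"
    using w(2) P(4) by (simp_all add: Hom_def)
  have e1: "Q w' \<bullet> Q i' = Q i \<bullet> Id L A" using Q_comp[of i' w'] pb(3) W h h' by simp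
  have e2: "Q w \<bullet> Q p' = Q p \<bullet> Q w'" using Q_comp[of p' w] Q_comp[of w' p] P(5) W h h' by simp
  have e3: "susp_loc (Id L A) \<bullet> conn i' p' = conn i p \<bullet> Q w" using n h by (simp add: Q_Id)
  have I: "Id L A \<in> Hom L A A" "iso_arr L (Id L A)" using L.Id_Hom[of A] L.iso_arr_Id[of A] h(7) by simp_all
  have "w \<in> weq" using w(1) by simp
  then show ?thesis
    unfolding distinguished_def
    using e1 e2 e3 pb(2) w(3) Q_Hom[OF h(10)] Q_Hom[OF h(11)] conn_Hom[OF c] Q_iso[OF w'] Q_iso[of w]
      Q_Hom[OF w(2)] Q_Hom[OF P(4)] I by blast
qed

lemma distinguished_fill:
  assumes d: "distinguished X Y Z f g h" "distinguished X' Y' Z' f' g' h'"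
    and m: "a \<in> Hom L X X'" "b \<in> Hom L Y Y'" "b \<bullet> f = f' \<bullet> a"
  shows "\<exists>c \<in> Hom L Z Z'. c \<bullet> g = g' \<bullet> b \<and> susp_loc a \<bullet> h = h' \<bullet> c"
proof -
  obtain A i B p D a0 b0 c0 where s: "cfl A i B p D" "cofb D" "a0 \<in> Hom L A X" "b0 \<in> Hom L B Y" "c0 \<in> Hom L D Z"
     "iso_arr L a0" "iso_arr L b0" "iso_arr L c0" "b0 \<bullet> Q i = f \<bullet> a0" "c0 \<bullet> Q p = g \<bullet> b0" "susp_loc a0 \<bullet> conn i p = h \<bullet> c0"
    using distinguishedE[OF d(1)] .
  obtain A' i' B' p' D' a1 b1 c1 where s': "cfl A' i' B' p' D'" "cofb D'" "a1 \<in> Hom L A' X'" "b1 \<in> Hom L B' Y'" "c1 \<in> Hom L D' Z'"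
     "iso_arr L a1" "iso_arr L b1" "iso_arr L c1" "b1 \<bullet> Q i' = f' \<bullet> a1" "c1 \<bullet> Q p' = g' \<bullet> b1" "susp_loc a1 \<bullet> conn i' p' = h' \<bullet> c1"
    using distinguishedE[OF d(2)] .
  obtain a1' where a1': "a1' \<in> Hom L X' A'" "a1' \<bullet> a1 = Id L A'" "a1 \<bullet> a1' = Id L X'" using L.iso_arrE[OF s'(6,3)] .
  obtain b1' where b1': "b1' \<in> Hom L Y' B'" "b1' \<bullet> b1 = Id L B'" "b1 \<bullet> b1' = Id L Y'" using L.iso_arrE[OF s'(7,4)] .
  obtain c0' where c0': "c0' \<in> Hom L Z D" "c0' \<bullet> c0 = Id L D" "c0 \<bullet> c0' = Id L Z" using L.iso_arrE[OF s(8,5)] .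
  note hs = cflD[OF s(1)] cflD[OF s'(1)]
  note H = s(3-5)[THEN HomD] s'(3-5)[THEN HomD] m(1,2)[THEN HomD]
    distinguishedD[OF d(1), unfolded Hom_def, simplified] distinguishedD[OF d(2), unfolded Hom_def, simplified]
    conn_Hom[OF s(1), THEN HomD] conn_Hom[OF s'(1), THEN HomD]
    a1'(1)[THEN HomD] b1'(1)[THEN HomD] c0'(1)[THEN HomD]
  let ?a = "a1' \<bullet> (a \<bullet> a0)" and ?b = "b1' \<bullet> (b \<bullet> b0)"
  have ab: "?a \<in> Hom L A A'" "?b \<in> Hom L B B'" using H by (simp_all add: Hom_def)
  have aa: "a1 \<bullet> ?a = a \<bullet> a0" "b1 \<bullet> ?b = b \<bullet> b0"
    using H by (simp_all add: L.comp_reassoc[OF a1'(3)] L.comp_reassoc[OF b1'(3)])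
  have "?b \<bullet> Q i = Q i' \<bullet> ?a"
  proof (rule L.iso_cancel_left[OF s'(7,4)])
    have "b1 \<bullet> (?b \<bullet> Q i) = f' \<bullet> (a \<bullet> a0)"
      using H hs by (simp add: L.comp_reassoc[OF b1'(3)] s(9) L.comp_reassoc[OF m(3)])
    moreover have "b1 \<bullet> (Q i' \<bullet> ?a) = f' \<bullet> (a1 \<bullet> ?a)" using H hs by (simp add: L.comp_reassoc[OF s'(9)])
    ultimately show "b1 \<bullet> (?b \<bullet> Q i) = b1 \<bullet> (Q i' \<bullet> ?a)" unfolding aa by simp
  qed (use ab H hs in \<open>simp_all add: Hom_def\<close>)
  from conflation_fill[OF s(1) s'(1) ab this] obtain k where k: "k \<in> Hom L D D'" "k \<bullet> Q p = Q p' \<bullet> ?b"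
    "susp_loc ?a \<bullet> conn i p = conn i' p' \<bullet> k" by blast
  note KK = k(1)[THEN HomD]
  let ?c = "c1 \<bullet> (k \<bullet> c0')"
  have c: "?c \<in> Hom L Z Z'" using H KK by (simp add: Hom_def)
  have "(?c \<bullet> g) \<bullet> b0 = c1 \<bullet> (k \<bullet> Q p)"
    using H KK hs by (simp add: s(10)[symmetric] L.comp_reassoc[OF c0'(2)])
  also have "\<dots> = g' \<bullet> (b1 \<bullet> ?b)" unfolding k(2) using H hs by (simp add: L.comp_reassoc[OF s'(10)])
  also have "\<dots> = (g' \<bullet> b) \<bullet> b0" unfolding aa using H by simp
  finally have 1: "?c \<bullet> g = g' \<bullet> b"
    by (rule L.iso_cancel_right[OF s(7,4), rotated 2]) (use H KK in \<open>simp_all add: Hom_def\<close>)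
  have "(h' \<bullet> ?c) \<bullet> c0 = (h' \<bullet> c1) \<bullet> k" using H KK hs by (simp add: c0'(2))
  also have "\<dots> = susp_loc a1 \<bullet> (susp_loc ?a \<bullet> conn i p)" unfolding s'(11)[symmetric] k(3) using H KK by simp
  also have "\<dots> = susp_loc (a1 \<bullet> ?a) \<bullet> conn i p" using H by (simp add: susp_loc_comp)
  also have "\<dots> = (susp_loc a \<bullet> h) \<bullet> c0" unfolding aa using H by (simp add: susp_loc_comp s(11))
  finally have 2: "h' \<bullet> ?c = susp_loc a \<bullet> h"
    by (rule L.iso_cancel_right[OF s(8,5), rotated 2]) (use H KK in \<open>simp_all add: Hom_def\<close>)
  from c 1 2 show ?thesis by metis
qed

text \<open>The pushout \<open>V\<close> of \<open>B\<close> and \<open>susp_mid A\<close> over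
  \<open>A\<close> is weakly equivalent to \<open>D\<close> and sits in a conflation
  \<open>B \<rightarrow> V \<rightarrow> susp A\<close>. Its connecting morphism is the suspension
  of \<open>i\<close>, while \<open>r\<close> corresponds to minus \<open>conn i p\<close>; hence
  the isomorphism of triangles is minus the identity on \<open>susp A\<close>.\<close>

lemma conflation_rotate:
  assumes c: "cfl A i B p D"
  shows "distinguished B D (susp A) (Q p) (conn i p) (L.neg (susp_loc (Q i)))"
proof -
  note h = cflD[OF c]
  note sA = susp[OF h(7)]
  note hA = cflD[OF sA(1)]
  obtain V l w z U q u y i' k where R: "cfl (susp_mid A) l V w D" "pushout C A B (susp_mid A) V i (susp_mono A) l z" "w \<cdot> z = p"
    "cfl A i' U q V" "u \<in> Hom C U B" "u \<cdot> i' = i" "w \<cdot> q = p \<cdot> u" "cfl (susp_mid A) k U u B"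
    "y \<in> Hom C U (susp_mid A)" "y \<cdot> i' = neg (susp_mono A)" "l \<cdot> y = add q (neg (z \<cdot> u))"
    using ex_roof[OF c hA(10)] .
  note hw = cflD[OF R(1)] and hq = cflD[OF R(4)] and P = pushoutD[OF R(2)]
  obtain r where r: "cfl B z V r (susp A)" "r \<cdot> l = susp_epi A" using pushout_conflation[OF sA(1) pushout_sym[OF R(2)]] by blast
  note hr = cflD[OF r(1)]
  have w: "w \<in> weq" using adm_epi_weq_iff[OF R(1)] sA(3) by blast
  note K = R(5,9)[THEN HomD]
  have ey: "susp_epi A \<cdot> y = r \<cdot> q"
  proof -
    have "susp_epi A \<cdot> y = r \<cdot> (l \<cdot> y)" using K hr hw by (simp add: comp_reassoc[OF r(2)])
    also have "\<dots> = r \<cdot> q" unfolding R(11) using K hr hq by simp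
    finally show ?thesis .
  qed
  \<comment> \<open>The sign of the rotation axiom arises here: it is \<open>neg y\<close>, not
    \<open>y\<close>, that extends \<open>susp_mono A\<close> over \<open>U\<close>.\<close>
  have "cfl_to_susp i' q A (Id C A) (neg r)"
    by (rule cfl_to_suspI[OF R(4), of "neg y"]) (use K hr hq hA ey R(10) in \<open>simp_all add: Hom_def\<close>)
  then have n0: "conn i' q = L.neg (Q r)" using conn_eq[OF R(4)] Q_neg hr by simp
  have n1: "susp_loc (Q (Id C A)) \<bullet> conn i' q = conn i p \<bullet> Q w"
    by (rule conn_natural[OF R(4) c Id_Hom[OF h(7)] R(5) hw(11) _ R(7)]) (use R(6) h in simp)
  have n2: "susp_loc (Q i) \<bullet> conn (susp_mono A) (susp_epi A) = conn z r \<bullet> Q (Id C (susp A))"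
    by (rule conn_natural[OF sA(1) r(1) h(10) hw(10) Id_Hom[OF hA(9)] P(5)[symmetric]]) (use r(2) hA in simp)
  note CC = conn_Hom[OF c, THEN HomD] conn_Hom[OF r(1), THEN HomD]
  have cz: "conn z r = susp_loc (Q i)" using n2 conn_susp[OF h(7)] CC h hA by (simp add: Q_Id)
  have cw: "conn i p \<bullet> Q w = L.neg (Q r)" using n1 n0 h hr by (simp add: Q_Id)
  have pw: "Q w \<bullet> Q z = Q p" using Q_comp[of z w] R(3) hw hr by simp
  show ?thesis
  proof (rule distinguished_iso[OF conflation_distinguished[OF r(1)], of _ B D _ "susp A" _ "Id L B" "Q w" "L.neg (Id L (susp A))"])
    show "iso_arr L (L.neg (Id L (susp A)))"
      using L.iso_arr_neg[OF L.iso_arr_Id L.Id_Hom] hA by simp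
  qed (use h hA hw hr CC cz cw pw Q_iso[OF w] L.iso_arr_Id[of B] L.Id_Hom[of B] in \<open>simp_all add: Hom_def\<close>)
qed

lemma distinguished_rotate:
  assumes "distinguished X Y Z f g h"
  shows "distinguished Y Z (susp X) g h (L.neg (susp_loc f))"
proof -
  obtain A i B p D a b c where s: "cfl A i B p D" "cofb D" "a \<in> Hom L A X" "b \<in> Hom L B Y" "c \<in> Hom L D Z"
     "iso_arr L a" "iso_arr L b" "iso_arr L c" "b \<bullet> Q i = f \<bullet> a" "c \<bullet> Q p = g \<bullet> b" "susp_loc a \<bullet> conn i p = h \<bullet> c"
    using distinguishedE[OF assms] .
  note D = distinguishedD[OF assms]
  note hs = cflD[OF s(1)]
  note H = s(3-5)[THEN HomD] D[unfolded Hom_def, simplified]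
  have e: "susp_loc b \<bullet> susp_loc (Q i) = susp_loc f \<bullet> susp_loc a"
    using H hs s(9) susp_loc_comp[of "Q i" b] susp_loc_comp[of a f] by simp
  show ?thesis
  proof (rule distinguished_iso[OF conflation_rotate[OF s(1)] _ _ _ s(4,5) susp_loc_Hom[OF s(3)] s(7,8) susp_loc_iso[OF s(6,3)] s(10,11)])
    show "susp_loc b \<bullet> L.neg (susp_loc (Q i)) = L.neg (susp_loc f) \<bullet> susp_loc a" using H hs e by simp
  qed (use D H in \<open>simp_all add: Hom_def\<close>)
qed

text \<open>For a conflation \<open>A \<rightarrow> B \<rightarrow> D\<close> modelling the given
  triangle, take a trivial cover of \<open>D\<close> with kernel \<open>K\<close> and the pullback
  \<open>U\<close>. In the conflation \<open>K \<rightarrow> U \<rightarrow> B\<close>,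
  \<open>U\<close> is weakly equivalent to \<open>A\<close>, and \<open>K\<close> is isomorphic to
  \<open>X\<close> because their suspensions are and the suspension is fully faithful. The sign from
  anticommutation cancels the one in \<open>L.neg (susp_loc f)\<close>.\<close>

lemma distinguished_unrotate:
  assumes d: "distinguished Y Z (susp X) g h (L.neg (susp_loc f))"
    and H0: "f \<in> Hom L X Y" "g \<in> Hom L Y Z" "h \<in> Hom L Z (susp X)"
  shows "distinguished X Y Z f g h"
proof -
  obtain A i B p D a b c where s: "cfl A i B p D" "cofb D" "a \<in> Hom L A Y" "b \<in> Hom L B Z" "c \<in> Hom L D (susp X)"
     "iso_arr L a" "iso_arr L b" "iso_arr L c" "b \<bullet> Q i = g \<bullet> a" "c \<bullet> Q p = h \<bullet> b"
     "susp_loc a \<bullet> conn i p = L.neg (susp_loc f) \<bullet> c"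
    using distinguishedE[OF d] .
  note hs = cflD[OF s(1)]
  obtain k P q K where P: "cfl K k P q D" "tcof P" using ex_trivial_cover[OF hs(9)] by blast
  have tP: "triv P" using P(2) tcof_iff by blast
  note hP = cflD[OF P(1)]
  obtain U v u kA where U: "pullback C D B P U p q v u" "cfl A kA U v P" "u \<cdot> kA = i" using ex_pullback[OF s(1) hP(11)] by blast
  obtain kK where kK: "cfl K kK U u B" "v \<cdot> kK = k" using pullback_conflation[OF P(1) pullback_sym[OF U(1)]] by blast
  note PB = pullbackD[OF U(1)] and hA = cflD[OF U(2)] and hK = cflD[OF kK(1)]
  have kAw: "kA \<in> weq" using adm_mono_weq_iff[OF U(2)] tP by blast
  have dI: "iso_arr L (conn k q)" using conn_iso[OF P(1) s(2) tP] .
  note dk = conn_Hom[OF P(1)]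
  obtain e where e: "e \<in> Hom L (susp K) D" "e \<bullet> conn k q = Id L D" "conn k q \<bullet> e = Id L (susp K)" "iso_arr L e"
    using L.iso_arrE[OF dI dk] .
  have X: "X \<in> Obj C" using L.Hom_objs[OF H0(1)] by simp
  obtain x where x: "x \<in> Hom L K X" "susp_loc x = c \<bullet> e" using susp_loc_full[OF hP(7) X L.comp_Hom[OF e(1) s(5)]] by blast
  have ce: "iso_arr L (c \<bullet> e)" using L.iso_arr_comp[OF e(4) s(8) e(1) s(5)] .
  obtain e' where e': "e' \<in> Hom L (susp X) (susp K)" "e' \<bullet> (c \<bullet> e) = Id L (susp K)" "(c \<bullet> e) \<bullet> e' = Id L (susp X)"
    using L.iso_arrE[OF ce L.comp_Hom[OF e(1) s(5)]] .
  obtain x' where x': "x' \<in> Hom L X K" "susp_loc x' = e'" using susp_loc_full[OF X hP(7) e'(1)] by blast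
  have "x' \<bullet> x = Id L K"
    by (rule susp_loc_faithful[OF L.comp_Hom[OF x(1) x'(1)] L.Id_Hom])
      (use hP x x' e' in \<open>simp_all add: Hom_def susp_loc_comp\<close>)
  moreover have "x \<bullet> x' = Id L X"
    by (rule susp_loc_faithful[OF L.comp_Hom[OF x'(1) x(1)] L.Id_Hom])
      (use X x x' e'(1,3) in \<open>simp_all add: Hom_def susp_loc_comp\<close>)
  ultimately have xi: "iso_arr L x" using L.iso_arrI[OF x(1) x'(1)] by blast
  obtain y0 where y0: "y0 \<in> Hom L U A" "y0 \<bullet> Q kA = Id L A" "Q kA \<bullet> y0 = Id L U" "iso_arr L y0"
    using L.iso_arrE[OF Q_iso[OF kAw] Q_Hom[OF hA(10)]] .
  note Y = L.comp_Hom[OF y0(1) s(3)]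
  have yi: "iso_arr L (a \<bullet> y0)" using L.iso_arr_comp[OF y0(4) s(6) y0(1) s(3)] .
  note H = s(3-5)[THEN HomD] H0[THEN HomD] dk[THEN HomD]
    e(1)[THEN HomD] x(1)[THEN HomD] y0(1)[THEN HomD]
    conn_Hom[OF s(1), THEN HomD]
  have anti: "loc_add (susp_loc (Q kA) \<bullet> conn i p) (susp_loc (Q kK) \<bullet> conn k q) = loc_null D (susp U)"
    by (rule conn_anticommute[OF s(1) P(1) s(2) U kK])
  have "susp_loc (Q kK) \<bullet> conn k q = L.neg (susp_loc (Q kA) \<bullet> conn i p)"
    by (rule L.neg_unique[OF _ _ anti]) (use H hA hK in \<open>simp_all add: Hom_def\<close>)
  then have anti': "susp_loc (Q kK) = L.neg (susp_loc (Q kA) \<bullet> (conn i p \<bullet> e))"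
  proof -
    assume z: "susp_loc (Q kK) \<bullet> conn k q = L.neg (susp_loc (Q kA) \<bullet> conn i p)"
    have "susp_loc (Q kK) = (susp_loc (Q kK) \<bullet> conn k q) \<bullet> e" using H hK hP e(3) by simp
    then show ?thesis unfolding z using H hA by simp
  qed
  have sy: "susp_loc y0 \<bullet> susp_loc (Q kA) = Id L (susp A)"
    using y0(2) H hA susp_loc_comp[of "Q kA" y0] by simp
  have 1: "(a \<bullet> y0) \<bullet> Q kK = f \<bullet> x"
  proof (rule susp_loc_faithful)
    have "susp_loc ((a \<bullet> y0) \<bullet> Q kK) = L.neg ((susp_loc a \<bullet> conn i p) \<bullet> e)"
      using H hK hA by (simp add: susp_loc_comp anti' L.comp_reassoc[OF sy])
    also have "\<dots> = susp_loc (f \<bullet> x)"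
      unfolding s(11) using H x(2) by (simp add: susp_loc_comp)
    finally show "susp_loc ((a \<bullet> y0) \<bullet> Q kK) = susp_loc (f \<bullet> x)" .
  qed (use H hK in \<open>simp_all add: Hom_def\<close>)
  have Qi: "Q u \<bullet> Q kA = Q i" using Q_comp[of kA u] U(3) hA hK by simp
  have 2: "b \<bullet> Q u = g \<bullet> (a \<bullet> y0)"
  proof -
    have "b \<bullet> Q u = b \<bullet> (Q u \<bullet> (Q kA \<bullet> y0))" using H hK y0(3) by simp
    also have "\<dots> = (b \<bullet> Q i) \<bullet> y0" using H hK hA hs by (simp add: L.comp_reassoc[OF Qi])
    also have "\<dots> = g \<bullet> (a \<bullet> y0)" unfolding s(9) using H by simp
    finally show ?thesis .
  qed
  have n: "susp_loc (Q (Id C K)) \<bullet> conn kK u = conn k q \<bullet> Q p"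
    by (rule conn_natural[OF kK(1) P(1) Id_Hom[OF hP(7)] PB(3) hs(11) _ PB(5)]) (use kK(2) hP in simp)
  have 3: "susp_loc x \<bullet> conn kK u = h \<bullet> b"
  proof -
    have "conn kK u = conn k q \<bullet> Q p" using n hP conn_Hom[OF kK(1)] by (simp add: Q_Id Hom_def)
    then have "susp_loc x \<bullet> conn kK u = c \<bullet> ((e \<bullet> conn k q) \<bullet> Q p)" using x(2) H hs by simp
    also have "\<dots> = h \<bullet> b" unfolding e(2) using H hs s(10) by simp
    finally show ?thesis .
  qed
  show ?thesis
    by (rule distinguished_iso[OF conflation_distinguished[OF kK(1)] H0 x(1) Y s(4) xi yi s(7) 1 2 3])
qed

text \<open>Fill in a morphism from the rotated triangle to the triangle on
  \<open>0 \<rightarrow> W \<rightarrow> W\<close>.\<close>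

lemma distinguished_weak_cokernel:
  assumes d: "distinguished X Y Z f g h" and t: "t \<in> Hom L Z W" "t \<bullet> g = loc_null Y W"
  shows "\<exists>u \<in> Hom L (susp X) W. t = u \<bullet> h"
proof -
  obtain O' where O': "zero_object C O'" using ex_zero_object by blast
  have o: "W \<in> Obj C" "Y \<in> Obj C" "O' \<in> Obj C"
    using L.Hom_objs[OF t(1)] L.Hom_objs[of g Y Z] distinguishedD[OF d] zero_ObjD[OF O'] by simp_all
  have d': "distinguished O' W W (Q (null O' W)) (Q (Id C W)) (conn (null O' W) (Id C W))"
    by (rule conflation_distinguished[OF conflation_Id'[OF o(1) O']])
  have "t \<bullet> g = Q (null O' W) \<bullet> loc_null Y O'"
    unfolding t(2) loc_null_def using o Q_comp[of "null Y O'" "null O' W"] by simp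
  from distinguished_fill[OF distinguished_rotate[OF d] d' loc_null_Hom[OF o(2,3)] t(1) this]
  obtain c where c: "c \<in> Hom L (susp X) W" "c \<bullet> h = Q (Id C W) \<bullet> t" by blast
  have "Q (Id C W) \<bullet> t = t" using t(1) o by (simp add: Q_Id Hom_def)
  with c show ?thesis by auto
qed

text \<open>With \<open>n\<close> the difference of \<open>t\<close> and the identity,
  \<open>n \<bullet> g\<close> vanishes, so \<open>n\<close> factors through \<open>h\<close>; as
  \<open>h \<bullet> n\<close> vanishes too, \<open>n\<close> has square zero. Hence identity minus
  \<open>n\<close> inverts \<open>t\<close>.\<close>

lemma distinguished_endo_iso:
  assumes d: "distinguished X Y Z f g h" and t: "t \<in> Hom L Z Z" "t \<bullet> g = g" "h \<bullet> t = h"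
  shows "iso_arr L t"
proof -
  note D = distinguishedD[OF d]
  note o = L.Hom_objs[OF t(1)]
  define n where "n = loc_add t (L.neg (Id L Z))"
  note H = t(1)[THEN HomD] D[unfolded Hom_def, simplified]
  have n: "n \<in> Hom L Z Z" unfolding n_def using H o by (simp add: Hom_def)
  have "n \<bullet> g = loc_null Y Z" unfolding n_def using H o t(2) by simp
  then obtain u where u: "u \<in> Hom L (susp X) Z" "n = u \<bullet> h" using distinguished_weak_cokernel[OF d n] by blast
  have "h \<bullet> n = loc_null Z (susp X)" unfolding n_def using H o t(3) by simp
  then have nn: "n \<bullet> n = loc_null Z Z"
    using arg_cong[of "h \<bullet> n" _ "\<lambda>x. u \<bullet> x"] u H n L.Hom_objs[OF u(1)] by (simp add: Hom_def)
  have te: "t = loc_add n (Id L Z)" unfolding n_def using H o by (simp add: L.add_assoc)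
  let ?s = "loc_add (Id L Z) (L.neg n)"
  have s: "?s \<in> Hom L Z Z" using n o by (simp add: Hom_def)
  have N: "n \<in> Arr L" "Dom L n = Z" "Cod L n = Z" using n by (simp_all add: Hom_def)
  have "?s \<bullet> t = Id L Z" "t \<bullet> ?s = Id L Z"
    unfolding te using N o nn by (simp_all add: L.add_assoc L.add_commute[of "Id L Z" "L.neg n"])
  then show ?thesis using L.iso_arrI[OF t(1) s] by blast
qed

text \<open>Fill in both directions. Both composites are invertible by
  \<open>distinguished_endo_iso\<close>, hence so are the fillers.\<close>

lemma distinguished_fill_iso:
  assumes d: "distinguished X Y Z f g h" "distinguished X' Y' Z' f' g' h'"
    and m: "a \<in> Hom L X X'" "b \<in> Hom L Y Y'" "iso_arr L a" "iso_arr L b" "b \<bullet> f = f' \<bullet> a"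
  obtains c where "c \<in> Hom L Z Z'" "iso_arr L c" "c \<bullet> g = g' \<bullet> b" "susp_loc a \<bullet> h = h' \<bullet> c"
proof -
  obtain a' where a': "a' \<in> Hom L X' X" "a' \<bullet> a = Id L X" "a \<bullet> a' = Id L X'" using L.iso_arrE[OF m(3,1)] .
  obtain b' where b': "b' \<in> Hom L Y' Y" "b' \<bullet> b = Id L Y" "b \<bullet> b' = Id L Y'" using L.iso_arrE[OF m(4,2)] .
  note H = m(1,2)[THEN HomD] a'(1)[THEN HomD] b'(1)[THEN HomD]
    distinguishedD[OF d(1), unfolded Hom_def, simplified] distinguishedD[OF d(2), unfolded Hom_def, simplified]
  obtain c where c: "c \<in> Hom L Z Z'" "c \<bullet> g = g' \<bullet> b" "susp_loc a \<bullet> h = h' \<bullet> c"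
    using distinguished_fill[OF d m(1,2,5)] by blast
  have "b' \<bullet> f' = b' \<bullet> ((f' \<bullet> a) \<bullet> a')" using H a'(3) by simp
  also have "\<dots> = f \<bullet> a'" unfolding m(5)[symmetric] using H by (simp add: L.comp_reassoc[OF b'(2)])
  finally obtain c' where c': "c' \<in> Hom L Z' Z" "c' \<bullet> g' = g \<bullet> b'" "susp_loc a' \<bullet> h' = h \<bullet> c'"
    using distinguished_fill[OF d(2,1) a'(1) b'(1)] by blast
  note CH = c(1)[THEN HomD] c'(1)[THEN HomD]
  have sa: "susp_loc a' \<bullet> susp_loc a = Id L (susp X)" "susp_loc a \<bullet> susp_loc a' = Id L (susp X')"
    using a'(2,3) H susp_loc_comp[of a a'] susp_loc_comp[of a' a] L.Hom_objs[OF m(1)] by simp_all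
  have 1: "iso_arr L (c' \<bullet> c)"
    by (rule distinguished_endo_iso[OF d(1) L.comp_Hom[OF c(1) c'(1)]])
      (use H CH in \<open>simp_all add: c(2) L.comp_reassoc[OF c'(2)] b'(2) L.comp_reassoc[OF c'(3)[symmetric]] c(3)[symmetric] L.comp_reassoc[OF sa(1)]\<close>)
  have 2: "iso_arr L (c \<bullet> c')"
    by (rule distinguished_endo_iso[OF d(2) L.comp_Hom[OF c'(1) c(1)]])
      (use H CH in \<open>simp_all add: c'(2) L.comp_reassoc[OF c(2)] b'(3) L.comp_reassoc[OF c(3)[symmetric]] c'(3)[symmetric] L.comp_reassoc[OF sa(2)]\<close>)
  show thesis using that[OF c(1) L.iso_of_one_sided[OF c(1) c'(1) c(1) 1 2] c(2,3)] .
qed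

text \<open>Factor the numerator of a left fraction as a cofibration \<open>j\<close> followed by a
  trivial fibration \<open>r\<close>; then \<open>t\<close> is \<open>r\<close> divided by the
  denominator \<open>s\<close>.\<close>

lemma ex_cofibration_model:
  assumes "u \<in> Hom L B Z"
  obtains T j q E t where "cfl B j T q E" "cofb E" "t \<in> Hom L T Z" "iso_arr L t" "t \<bullet> Q j = u"
proof -
  obtain Z1 k s where s: "k \<in> Hom C B Z1" "s \<in> Hom C Z Z1" "s \<in> weq" "Q s \<bullet> u = Q k" using left_fraction[OF assms] .
  obtain j r where jr: "j \<in> cof" "r \<in> fib \<inter> weq" "Cod C j = Dom C r" "k = r \<cdot> j"
    using factor_trivial_fib[of k] s(1) by (auto simp: Hom_def)
  have a: "j \<in> Arr C" "r \<in> Arr C" using jr cof_Arr fib_Arr by auto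
  have d: "Dom C j = B" "Cod C r = Z1" using s(1) jr(3) a unfolding jr(4) by (simp_all add: Hom_def)
  have H: "j \<in> Hom C B (Dom C r)" "r \<in> Hom C (Dom C r) Z1" using a d jr(3) by (simp_all add: Hom_def)
  obtain q E where q: "cfl B j (Dom C r) q E" "cofb E" using cofE[OF jr(1) H(1)] .
  obtain t where t: "t \<in> Hom L (Dom C r) Z" "Q s \<bullet> t = Q r" using ex_loc_left[OF s(3,2) Q_Hom[OF H(2)]] by blast
  have "iso_arr L t"
  proof -
    obtain r' where r': "r' \<in> Hom L Z1 (Dom C r)" "r' \<bullet> Q r = Id L (Dom C r)" "Q r \<bullet> r' = Id L Z1"
      using L.iso_arrE[OF Q_iso Q_Hom[OF H(2)]] jr(2) by blast
    have S: "Q s \<in> Hom L Z Z1" using Q_Hom[OF s(2)] .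
    have "t \<bullet> (r' \<bullet> Q s) = Id L Z"
      by (rule loc_eqI[OF s(3,2)])
        (use t(1) r'(1) S s(2) a d L.Hom_objs[OF S] in \<open>simp_all add: Hom_def L.comp_reassoc[OF t(2)] L.comp_reassoc[OF r'(3)]\<close>)
    moreover have "(r' \<bullet> Q s) \<bullet> t = Id L (Dom C r)" using t r' S by (simp add: Hom_def)
    ultimately show ?thesis using L.iso_arrI[OF t(1) L.comp_Hom[OF S r'(1)]] by blast
  qed
  moreover have "t \<bullet> Q j = u"
    by (rule loc_eqI[OF s(3,2) _ assms])
      (use t a d jr(3,4) s in \<open>simp_all add: Hom_def L.comp_reassoc[OF t(2)] Q_comp\<close>)
  ultimately show thesis using that q t(1) by blast
qed

text \<open>Once \<open>f\<close> and \<open>g\<close> are modelled by composable inflations, the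
  fourth triangle is Noether's conflation. As the given triangles on \<open>g\<close> and on the
  composite are arbitrary, \<open>distinguished_fill_iso\<close> supplies the comparisons
  \<open>d\<close> and \<open>e\<close>, and the required maps are transported along them.\<close>

lemma distinguished_octahedral:
  assumes d1: "distinguished X Y U f f1 f2" and d2: "distinguished Y Z V g g1 g2" and d3: "distinguished X Z W (g \<bullet> f) k1 k2"
  shows "\<exists>u \<in> Hom L U W. \<exists>v \<in> Hom L W V. distinguished U W V u v (susp_loc f1 \<bullet> g2) \<and>
    u \<bullet> f1 = k1 \<bullet> g \<and> k2 \<bullet> u = f2 \<and> v \<bullet> k1 = g1 \<and> g2 \<bullet> v = susp_loc f \<bullet> k2"
proof -
  obtain A i B p D a b c where s: "cfl A i B p D" "cofb D" "a \<in> Hom L A X" "b \<in> Hom L B Y" "c \<in> Hom L D U"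
     "iso_arr L a" "iso_arr L b" "iso_arr L c" "b \<bullet> Q i = f \<bullet> a" "c \<bullet> Q p = f1 \<bullet> b" "susp_loc a \<bullet> conn i p = f2 \<bullet> c"
    using distinguishedE[OF d1] .
  note D1 = distinguishedD[OF d1] and D2 = distinguishedD[OF d2] and D3 = distinguishedD[OF d3]
  have gb: "g \<bullet> b \<in> Hom L B Z" using L.comp_Hom[OF s(4)] D2 by blast
  \<comment> \<open>Modelling \<open>g \<bullet> b\<close> instead of \<open>g\<close> makes
    \<open>j\<close> start at the object \<open>B\<close> where \<open>i\<close> ends.\<close>
  obtain T j q E t where j: "cfl B j T q E" "cofb E" "t \<in> Hom L T Z" "iso_arr L t" "t \<bullet> Q j = g \<bullet> b"
    using ex_cofibration_model[OF gb] .
  obtain F r u v where n: "cfl A (j \<cdot> i) T r F" "cfl D u F v E" "r \<cdot> j = u \<cdot> p" "v \<cdot> r = q"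
    using noether[OF s(1) j(1)] by blast
  note h1 = cflD[OF s(1)] and h2 = cflD[OF j(1)] and h3 = cflD[OF n(1)] and h4 = cflD[OF n(2)]
  note H = s(3-5)[THEN HomD] j(3)[THEN HomD]
    D1[unfolded Hom_def, simplified] D2[unfolded Hom_def, simplified] D3[unfolded Hom_def, simplified]
    conn_Hom[OF s(1), THEN HomD] conn_Hom[OF j(1), THEN HomD]
    conn_Hom[OF n(1), THEN HomD] conn_Hom[OF n(2), THEN HomD]
  obtain d where d: "d \<in> Hom L E V" "iso_arr L d" "d \<bullet> Q q = g1 \<bullet> t" "susp_loc b \<bullet> conn j q = g2 \<bullet> d"
    using distinguished_fill_iso[OF conflation_distinguished[OF j(1)] d2 s(4) j(3) s(7) j(4,5)] .
  have "t \<bullet> Q (j \<cdot> i) = (g \<bullet> f) \<bullet> a"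
    using H h1 h2 by (simp add: Q_comp L.comp_reassoc[OF j(5)] s(9))
  then obtain e where e: "e \<in> Hom L F W" "iso_arr L e" "e \<bullet> Q r = k1 \<bullet> t" "susp_loc a \<bullet> conn (j \<cdot> i) r = k2 \<bullet> e"
    using distinguished_fill_iso[OF conflation_distinguished[OF n(1)] d3 s(3) j(3) s(6) j(4)] by metis
  obtain c' where c': "c' \<in> Hom L U D" "c' \<bullet> c = Id L D" "c \<bullet> c' = Id L U" using L.iso_arrE[OF s(8,5)] .
  obtain e' where e': "e' \<in> Hom L W F" "e' \<bullet> e = Id L F" "e \<bullet> e' = Id L W" using L.iso_arrE[OF e(2,1)] .
  note K = d(1)[THEN HomD] e(1)[THEN HomD]
    c'(1)[THEN HomD] e'(1)[THEN HomD]
  define x where "x = e \<bullet> (Q u \<bullet> c')"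
  define y where "y = d \<bullet> (Q v \<bullet> e')"
  have xH: "x \<in> Hom L U W" and yH: "y \<in> Hom L W V" unfolding x_def y_def using K h4 by (simp_all add: Hom_def)
  have xc: "x \<bullet> c = e \<bullet> Q u" unfolding x_def using K H h4 c'(2) by simp
  have ye: "y \<bullet> e = d \<bullet> Q v" unfolding y_def using K H h4 e'(2) by simp
  note XY = xH[THEN HomD] yH[THEN HomD]
  have Qr: "Q r \<bullet> Q j = Q u \<bullet> Q p" using n(3) h1 h2 h3 h4 Q_comp[of j r] Q_comp[of p u] by simp
  have Qq: "Q v \<bullet> Q r = Q q" using n(4) h3 h4 Q_comp[of r v] by simp
  have n1: "susp_loc (Q p) \<bullet> conn j q = conn u v \<bullet> Q (Id C E)"
    by (rule conn_natural[OF j(1) n(2) h1(11) h3(11) Id_Hom[OF h2(9)] n(3)]) (use n(4) h2 in simp)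
  have n2: "susp_loc (Q (Id C A)) \<bullet> conn i p = conn (j \<cdot> i) r \<bullet> Q u"
    by (rule conn_natural[OF s(1) n(1) Id_Hom[OF h1(7)] h2(10) h4(10) _ n(3)[symmetric]]) (use h1 h2 in simp)
  have n3: "susp_loc (Q i) \<bullet> conn (j \<cdot> i) r = conn j q \<bullet> Q v"
    by (rule conn_natural[OF n(1) j(1) h1(10) Id_Hom[OF h2(8)] h4(11)]) (use n(4) h1 h2 in simp_all)
  have n1': "susp_loc (Q p) \<bullet> conn j q = conn u v" using n1 H h2 by (simp add: Q_Id)
  have n2': "conn i p = conn (j \<cdot> i) r \<bullet> Q u" using n2 H h1 by (simp add: Q_Id)
  have S1: "susp_loc c \<bullet> susp_loc (Q p) = susp_loc f1 \<bullet> susp_loc b"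
    using s(10) H h1 susp_loc_comp[of "Q p" c] susp_loc_comp[of b f1] by simp
  have S2: "susp_loc b \<bullet> susp_loc (Q i) = susp_loc f \<bullet> susp_loc a"
    using s(9) H h1 susp_loc_comp[of "Q i" b] susp_loc_comp[of a f] by simp
  have "susp_loc c \<bullet> conn u v = (susp_loc f1 \<bullet> g2) \<bullet> d"
    unfolding n1'[symmetric] using H K h1 by (simp add: L.comp_reassoc[OF S1] d(4))
  then have dd: "distinguished U W V x y (susp_loc f1 \<bullet> g2)"
    by (intro distinguished_iso[OF conflation_distinguished[OF n(2)] xH yH _ s(5) e(1) d(1) s(8) e(2) d(2) xc[symmetric] ye[symmetric]])
      (use H in \<open>simp_all add: Hom_def\<close>)
  have "(x \<bullet> f1) \<bullet> b = e \<bullet> (Q r \<bullet> Q j)"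
    unfolding Qr using H XY K h1 h4 by (simp add: s(10)[symmetric] L.comp_reassoc[OF xc])
  also have "\<dots> = (k1 \<bullet> g) \<bullet> b" using H K h2 h3 by (simp add: L.comp_reassoc[OF e(3)] j(5))
  finally have 1: "x \<bullet> f1 = k1 \<bullet> g"
    by (rule L.iso_cancel_right[OF s(7,4), rotated 2]) (use H XY in \<open>simp_all add: Hom_def\<close>)
  have "(k2 \<bullet> x) \<bullet> c = (k2 \<bullet> e) \<bullet> Q u" using H XY K h4 by (simp add: xc)
  also have "\<dots> = f2 \<bullet> c" unfolding e(4)[symmetric] s(11)[symmetric] n2' using H h4 by simp
  finally have 2: "k2 \<bullet> x = f2"
    by (rule L.iso_cancel_right[OF s(8,5), rotated 2]) (use H XY in \<open>simp_all add: Hom_def\<close>)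
  have "(y \<bullet> k1) \<bullet> t = y \<bullet> (e \<bullet> Q r)" using H XY e(3) by simp
  also have "\<dots> = d \<bullet> (Q v \<bullet> Q r)" using H XY K h3 h4 by (simp add: L.comp_reassoc[OF ye])
  also have "\<dots> = g1 \<bullet> t" unfolding Qq by (rule d(3))
  finally have 3: "y \<bullet> k1 = g1"
    by (rule L.iso_cancel_right[OF j(4,3), rotated 2]) (use H XY in \<open>simp_all add: Hom_def\<close>)
  have "(g2 \<bullet> y) \<bullet> e = (g2 \<bullet> d) \<bullet> Q v" using H XY K h4 by (simp add: ye)
  also have "\<dots> = susp_loc b \<bullet> (susp_loc (Q i) \<bullet> conn (j \<cdot> i) r)"
    unfolding d(4)[symmetric] n3 using H h4 by simp
  also have "\<dots> = susp_loc f \<bullet> (susp_loc a \<bullet> conn (j \<cdot> i) r)" using H h1 by (simp add: L.comp_reassoc[OF S2])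
  also have "\<dots> = (susp_loc f \<bullet> k2) \<bullet> e" unfolding e(4) using H K by simp
  finally have 4: "g2 \<bullet> y = susp_loc f \<bullet> k2"
    by (rule L.iso_cancel_right[OF e(2,1), rotated 2]) (use H XY in \<open>simp_all add: Hom_def\<close>)
  show ?thesis using xH yH dd 1 2 3 4 by blast
qed

section \<open>The axioms of a triangulated category\<close>

definition distinguished_triangles where
  "distinguished_triangles = {(f, g, h). distinguished (Dom L f) (Cod L f) (Cod L g) f g h}"

lemma distinguished_iff:
  "f \<in> Hom L X Y \<Longrightarrow> g \<in> Hom L Y Z \<Longrightarrow> (f, g, h) \<in> distinguished_triangles \<longleftrightarrow> distinguished X Y Z f g h"
  by (simp add: distinguished_triangles_def Hom_def)

lemma distinguished_trianglesD:
  "(f, g, h) \<in> distinguished_triangles \<Longrightarrow> distinguished (Dom L f) (Cod L f) (Cod L g) f g h"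
  by (simp add: distinguished_triangles_def)

lemma distinguished_ends:
  assumes "(f, g, h) \<in> distinguished_triangles"
  shows "f \<in> Arr L" "g \<in> Arr L" "h \<in> Arr L" "Dom L g = Cod L f" "Dom L h = Cod L g" "Cod L h = susp (Dom L f)"
  using distinguishedD[OF distinguished_trianglesD[OF assms]] by (simp_all add: Hom_def)

text \<open>A zero object of the localization need not be one of the exact category, for every
  trivial object becomes one. The triangle of the identity conflation is therefore transported along
  the isomorphism from \<open>O'\<close> to \<open>Z\<close>.\<close>

lemma distinguished_Id:
  assumes "X \<in> Obj C" "zero_object L Z"
  shows "distinguished X X Z (Id L X) (loc_null X Z) (loc_null Z (susp X))"
proof -
  obtain O' where O': "zero_object C O'" using ex_zero_object by blast
  have o: "O' \<in> Obj C" "Z \<in> Obj C" "susp X \<in> Obj C" using zero_ObjD[OF O'] assms by (simp_all add: zero_object_def)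
  note c = conflation_Id[OF assms(1) O']
  note zO = zero_object_loc[OF O']
  have iso: "iso_arr L (loc_null O' Z)"
    using o L.zero_Id[OF zO] L.zero_Id[OF assms(2)] by (intro L.iso_arrI[of _ O' Z "loc_null Z O'"]) (simp_all add: Hom_def)
  have k: "conn (Id C X) (null X O') = loc_null O' (susp X)"
    using L.zero_arr[OF zO, of "conn (Id C X) (null X O')"] conn_Hom[OF c] by (simp add: Hom_def)
  have I: "Id L X \<in> Arr L" "Dom L (Id L X) = X" "Cod L (Id L X) = X" using assms(1) by simp_all
  show ?thesis
    by (rule distinguished_iso[OF conflation_distinguished[OF c], of _ X X _ Z _ "Id L X" "Id L X" "loc_null O' Z"])
      (use iso k o I assms(1) L.iso_arr_Id[of X] in \<open>simp_all add: Hom_def Q_Id loc_null_def[symmetric]\<close>)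
qed

lemma ex_distinguished:
  assumes "u \<in> Hom L X Y"
  shows "\<exists>Z g h. distinguished X Y Z u g h"
proof -
  obtain T j q E t where j: "cfl X j T q E" "cofb E" "t \<in> Hom L T Y" "iso_arr L t" "t \<bullet> Q j = u"
    using ex_cofibration_model[OF assms] .
  obtain t' where t': "t' \<in> Hom L Y T" "t' \<bullet> t = Id L T" "t \<bullet> t' = Id L Y" using L.iso_arrE[OF j(4,3)] .
  note h = cflD[OF j(1)]
  note H = j(3)[THEN HomD] t'(1)[THEN HomD] assms[THEN HomD]
    conn_Hom[OF j(1), THEN HomD]
  have "distinguished X Y E u (Q q \<bullet> t') (conn j q)"
    by (rule distinguished_iso[OF conflation_distinguished[OF j(1)], of _ X Y _ E _ "Id L X" t "Id L E"])
      (use H h j(4,5) t'(2) L.iso_arr_Id[of X] L.iso_arr_Id[of E] in \<open>simp_all add: Hom_def\<close>)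
  then show ?thesis by blast
qed

theorem localization_triangulated:
  "triangulated_category L loc_add loc_null susp susp_loc distinguished_triangles"
proof (intro triangulated_category.intro triangulated_category_axioms.intro)
  show "additive_category L loc_add loc_null" by (rule L.additive_category_axioms)
  show "is_equivalence L L susp susp_loc" by (rule susp_loc_equivalence)
  show "susp_loc (loc_add f g) = loc_add (susp_loc f) (susp_loc g)" if "f \<in> Hom L A B" "g \<in> Hom L A B" for f g A B
    using susp_loc_add that by blast
  show "triangle L susp f g h" if "(f, g, h) \<in> distinguished_triangles" for f g h
    using distinguished_ends[OF that] by (simp add: triangle_def)
  show "(f', g', h') \<in> distinguished_triangles"
    if t: "(f, g, h) \<in> distinguished_triangles" "triangle L susp f' g' h'" "a \<in> Hom L (Dom L f) (Dom L f')"
      "b \<in> Hom L (Dom L g) (Dom L g')" "c \<in> Hom L (Dom L h) (Dom L h')" "iso_arr L a" "iso_arr L b" "iso_arr L c"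
      "b \<bullet> f = f' \<bullet> a" "c \<bullet> g = g' \<bullet> b" "susp_loc a \<bullet> h = h' \<bullet> c" for f g h f' g' h' a b c
  proof -
    note e = distinguished_ends[OF t(1)]
    have H: "f' \<in> Hom L (Dom L f') (Cod L f')" "g' \<in> Hom L (Cod L f') (Cod L g')" "h' \<in> Hom L (Cod L g') (susp (Dom L f'))"
      "b \<in> Hom L (Cod L f) (Cod L f')" "c \<in> Hom L (Cod L g) (Cod L g')"
      using t(2,4,5) e by (simp_all add: triangle_def Hom_def)
    show ?thesis
      using distinguished_iso[OF distinguished_trianglesD[OF t(1)] H(1-3) t(3) H(4,5) t(6-11)]
        distinguished_iff[OF H(1,2)] by blast
  qed
  show "(Id L X, loc_null X Z, loc_null Z (susp X)) \<in> distinguished_triangles" if "X \<in> Obj L" "zero_object L Z" for X Z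
  proof -
    have o: "X \<in> Obj C" "Z \<in> Obj C" using that by (simp_all add: zero_object_def)
    show ?thesis using distinguished_Id[OF o(1) that(2)] distinguished_iff[of "Id L X" X X "loc_null X Z" Z]
      L.Id_Hom[OF that(1)] loc_null_Hom[OF o] by blast
  qed
  show "\<exists>g h. (f, g, h) \<in> distinguished_triangles" if "f \<in> Arr L" for f
  proof -
    have f: "f \<in> Hom L (Dom L f) (Cod L f)" using that by (simp add: Hom_def)
    from ex_distinguished[OF this] obtain Z g h where *: "distinguished (Dom L f) (Cod L f) Z f g h" by blast
    then show ?thesis using distinguished_iff[OF f] distinguishedD[OF *] by blast
  qed
  show "(f, g, h) \<in> distinguished_triangles \<longleftrightarrow>
      (g, h, inv\<^bsub>hom_group L loc_add loc_null (susp (Dom L f)) (susp (Cod L f))\<^esub> susp_loc f) \<in> distinguished_triangles"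
    if "triangle L susp f g h" for f g h
  proof -
    let ?X = "Dom L f" and ?Y = "Cod L f" and ?Z = "Cod L g"
    have H: "f \<in> Hom L ?X ?Y" "g \<in> Hom L ?Y ?Z" "h \<in> Hom L ?Z (susp ?X)" using that by (auto simp: triangle_def Hom_def)
    have n: "inv\<^bsub>hom_group L loc_add loc_null (susp ?X) (susp ?Y)\<^esub> susp_loc f = L.neg (susp_loc f)"
      using H by (simp add: L.neg_def Hom_def)
    show ?thesis
      unfolding n distinguished_iff[OF H(1,2)] distinguished_iff[OF H(2,3)]
      using distinguished_rotate distinguished_unrotate[OF _ H] by blast
  qed
  show "\<exists>c \<in> Hom L (Dom L h) (Dom L h'). c \<bullet> g = g' \<bullet> b \<and> susp_loc a \<bullet> h = h' \<bullet> c"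
    if t: "(f, g, h) \<in> distinguished_triangles" "(f', g', h') \<in> distinguished_triangles"
      "a \<in> Hom L (Dom L f) (Dom L f')" "b \<in> Hom L (Dom L g) (Dom L g')" "b \<bullet> f = f' \<bullet> a" for f g h f' g' h' a b
    using distinguished_fill[OF distinguished_trianglesD[OF t(1)] distinguished_trianglesD[OF t(2)] t(3) _ t(5)] t(4)
    unfolding distinguished_ends(4,5)[OF t(1)] distinguished_ends(4,5)[OF t(2)] by blast
  show "\<exists>u\<in>Hom L (Cod L f1) (Cod L k1). \<exists>v\<in>Hom L (Cod L k1) (Cod L g1). (u, v, susp_loc f1 \<bullet> g2) \<in> distinguished_triangles \<and>
      u \<bullet> f1 = k1 \<bullet> g \<and> k2 \<bullet> u = f2 \<and> v \<bullet> k1 = g1 \<and> g2 \<bullet> v = susp_loc f \<bullet> k2"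
    if t: "(f, f1, f2) \<in> distinguished_triangles" "(g, g1, g2) \<in> distinguished_triangles" "Cod L f = Dom L g"
      "(g \<bullet> f, k1, k2) \<in> distinguished_triangles" for f f1 f2 g g1 g2 k1 k2
  proof -
    have gf: "Dom L (g \<bullet> f) = Dom L f" "Cod L (g \<bullet> f) = Cod L g"
      using distinguished_ends[OF t(1)] distinguished_ends[OF t(2)] t(3) by simp_all
    from distinguished_octahedral[OF distinguished_trianglesD[OF t(1), unfolded t(3)] distinguished_trianglesD[OF t(2)]
        distinguished_trianglesD[OF t(4), unfolded gf]]
    obtain u v where *: "u \<in> Hom L (Cod L f1) (Cod L k1)" "v \<in> Hom L (Cod L k1) (Cod L g1)"
      "distinguished (Cod L f1) (Cod L k1) (Cod L g1) u v (susp_loc f1 \<bullet> g2)"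
      "u \<bullet> f1 = k1 \<bullet> g" "k2 \<bullet> u = f2" "v \<bullet> k1 = g1" "g2 \<bullet> v = susp_loc f \<bullet> k2" by blast
    then show ?thesis using distinguished_iff[OF *(1,2)] by blast
  qed
qed

end

theorem mainTheorem7:
  fixes E :: "('o, 'm) cat"
    and add :: "'m \<Rightarrow> 'm \<Rightarrow> 'm"
    and null :: "'o \<Rightarrow> 'o \<Rightarrow> 'm"
    and conf :: "('m \<times> 'm) set"
    and cof fib weq :: "'m set"
  assumes "exact_category E add null conf"
    and "weakly_idempotent_complete E null"
    and "exact_model_structure E add null conf cof fib weq"
  shows "\<exists>add' null' So Sm tri.
    triangulated_category (localization E weq) add' null' So Sm tri"
  using exact_model_structure.localization_triangulated[OF assms(3)] by blast

end
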